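(* Let $\pi:X\to B$ be a discrete $(r,\beta,\varepsilon)$-approximate circle bundle for some $r,\beta,\varepsilon\ge0$, and let $\mathcal{U}=\{U_j\}_{j\in J}$ be a (countable, locally finite) trivializing cover. If $\widetilde\tau(r,\beta,\varepsilon,\mathcal{U})\le\frac{\sqrt2}{36}$, then for any $\Phi\in T_{r,\beta,\varepsilon}(\pi,\mathcal{U})$ the cocycle $\Pi_Z\circ\mathrm{wit}(\mathfrak{F}(\Phi))\in\check Z^1(\mathcal{U};\mathcal{C}_{O(2)})$ is well-defined (i.e. $\mathrm{wit}(\mathfrak{F}(\Phi))$ lies in $\check Z^1_{\eta}(\mathcal{U};\underline{O(2)})$ for some $\eta<\frac12$, so that $\Pi_Z$ can be applied), and its cohomology class in $\check H^1(\mathcal{U};\mathcal{C}_{O(2)})$ does not depend on $\Phi$.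
   Context: **Metric notions.** For $f:X\to Y$ between metric spaces, $\mathrm{dist}(f)=\sup_{x,x'}|d_Y(f(x),f(x'))-d_X(x,x')|$; for $f:X\to Y$, $g:Y\to X$, $\mathrm{codist}(f,g)=\sup_{x,y}|d_Y(f(x),y)-d_X(x,g(y))|$. Given $\pi:X\to B$, $\pi':X'\to B$ between metric spaces, a discrete $(\beta,\varepsilon)$-approximate bundle map is a function $\varphi:X\to X'$ for which there is $\psi:X'\to X$ with $\max\{\mathrm{dist}(\varphi),\mathrm{dist}(\psi),\mathrm{codist}(\varphi,\psi)\}\le\varepsilon$ and $\max\{\sup_x d_B(\pi(x),\pi'\varphi(x)),\sup_{x'}d_B(\pi'(x'),\pi\psi(x'))\}\le\beta/2$. $\mathbb{S}^1_r$ is $\mathbb{S}^1$ with $r$ times the geodesic distance; $U\times\mathbb{S}^1_r$ has the sup product metric. **Discrete approximate circle bundles.** For $\beta,\varepsilon\ge0$ and $r>\frac{16}{\pi}(\varepsilon+\beta)$, a discrete $(r,\beta,\varepsilon)$-approximate local trivialization of $\pi:X\to B$ is a discrete $(\beta,\varepsilon)$-approximate bundle map $\varphi:\pi^{-1}(U)\to U\times\mathbb{S}^1_{r_0}$ over $U$ (with respect to $\pi$ and the first projection), $U\subseteq B$ open, $r_0\ge r$. The map $\pi:X\to B$ between metric spaces is a discrete $(r,\beta,\varepsilon)$-approximate circle bundle with trivializing cover $\mathcal{U}=\{U_j\}_{j\in J}$ if $\mathcal{U}$ is a good open cover of $B$ (nonempty finite intersections contractible) such that: (1) for all $j,k,l\in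 J$ (not necessarily distinct) with $U_{jkl}=U_j\cap U_k\cap U_l\ne\emptyset$ there is $x\in X$ with closed ball $\bar B_\beta(\pi(x))\subseteq U_{jkl}$; (2) for each $j$ there is a discrete $(r,\beta,\varepsilon)$-approximate local trivialization $\varphi_j:\pi^{-1}(U_j)\to U_j\times\mathbb{S}^1_{r_j}$, $r_j\ge r$. $T_{r,\beta,\varepsilon}(\pi,\mathcal{U})$ is the set of all such families $\Phi=\{\varphi_j\}_{j\in J}$, and $\mathfrak{F}(\Phi)=\{f_j=p_{\mathbb{S}^1}\circ\varphi_j:\pi^{-1}(U_j)\to\mathbb{S}^1\}_{j\in J}$. Set $$\tau(r,\beta,\varepsilon,\mathcal{U})=\tfrac1r\Big(\sup_{j}\mathrm{diam}(U_j)+10\varepsilon+9\beta\Big),\qquad \widetilde\tau(r,\beta,\varepsilon,\mathcal{U})=2\sin^{-1}\!\Big(\tfrac{\tau(r,\beta,\varepsilon,\mathcal{U})}{2}\Big)$$ (the hypothesis includes that this is defined, i.e. $\tau\le2$). **The map wit.** For $\mathfrak F=\{f_j\}$ and each pair with $U_{jk}=U_j\cap U_k\neq\emptyset$, $\mathrm{wit}(\mathfrak{F})_{jk}\in O(2)$ is defined as follows, with $f=f_j$, $g=f_k$ on $Y=\pi^{-1}(U_{jk})$. Write $f(x)=e^{i\alpha_x}$, $g(x)=e^{i\beta_x}$, $\gamma_x=\alpha_x-\beta_x$, $\tilde\gamma_x=\alpha_x+\beta_x$. Let $e^{i\theta}$ (resp. $e^{i\tilde\theta}$) be the midpoint of a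 shortest arc containing $\{e^{i\gamma_x}\}_{x\in Y}$ (resp. $\{e^{i\tilde\gamma_x}\}_{x\in Y}$). Let $R_\theta$ be rotation by $\theta$ and $\mathsf{r}=\mathrm{diag}(1,-1)$. Let $d_{\rm rot}=\sup_x|f(x)-R_\theta g(x)|$, $d_{\rm ref}=\sup_x|f(x)-R_{\tilde\theta}\mathsf{r}g(x)|$. Then $\mathrm{wit}(\mathfrak{F})_{jk}=R_\theta$ if $d_{\rm rot}<d_{\rm ref}$, and $R_{\tilde\theta}\mathsf{r}$ otherwise. **Cocycles.** $\check Z^1_\eta(\mathcal{U};\mathcal{C}_{O(2)})$ is the set of families of continuous $\Omega_{jk}:U_{jk}\to O(2)$ with $\sup_{j,k,l}\sup_{b\in U_{jkl}}\|\Omega_{jk}(b)\Omega_{kl}(b)-\Omega_{jl}(b)\|_F<\eta$; $\check Z^1_\eta(\mathcal{U};\underline{O(2)})$ is the subset of locally constant ones. $\check Z^1(\mathcal{U};\mathcal{C}_{O(2)})$ is the set of exact cocycles ($\Omega_{jk}\Omega_{kl}=\Omega_{jl}$), and $\check H^1(\mathcal{U};\mathcal{C}_{O(2)})$ its quotient by $\Omega_{jk}\sim\mu_j\Omega_{jk}\mu_k^{-1}$, $\mu_j:U_j\to O(2)$ continuous. **The map $\Pi_Z$.** Index $\mathcal{U}$ by a subset of $\mathbb{N}$ and fix a partition of unity $\{\rho_j\}$ subordinate to $\mathcal{U}$. $\mathrm{Gr}(2)$ is the space of 2-planes in $\mathbb{R}^\infty$, identified with orthogonal projection matrices in $\mathbb{R}^{\infty\times\infty}$;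 $V(2)=\{A\in\mathbb{R}^{\infty\times2}:A^TA=I_2\}$. For $\Omega\in\check Z^1_\eta(\mathcal{U};\mathcal{C}_{O(2)})$, $\eta<\frac12$, let $\Psi_j:U_j\to V(2)$ be the map whose $i$-th $2\times2$ block is $\sqrt{\rho_i(b)}\,\Omega_{ij}(b)$ (zero if $\rho_i(b)=0$), and $\mathrm{cl}(\Omega)(b)=\sum_j\rho_j(b)\Psi_j(b)\Psi_j(b)^T$. Let $f_\Omega(b)=\Pi(\mathrm{cl}(\Omega)(b))\in\mathrm{Gr}(2)$, where $\Pi(A)$ is the orthogonal projection onto the span of the eigenvectors of $\frac{A+A^T}{2}$ for its two largest eigenvalues. Let $\widetilde\Psi_j(b)\in V(2)$ be the factor $U$ in the polar decomposition $f_\Omega(b)\Psi_j(b)=UH$, $H=\big((f_\Omega\Psi_j)^T(f_\Omega\Psi_j)\big)^{1/2}$. Then $\Pi_Z(\Omega)_{jk}(b)=\widetilde\Psi_j(b)^T\widetilde\Psi_k(b)$. (It is a known result of Scoccola–Perea that for $\eta<\frac12$ this is well-defined and gives an element of $\check Z^1(\mathcal{U};\mathcal{C}_{O(2)})$, whose class is independent of the partition of unity.) *)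

theory Defs
  imports "HOL-Analysis.Analysis"
begin

section \<open>Discrete approximate bundle maps\<close>

text \<open>Metric spaces that are not types (preimages of open sets, products with a rescaled circle) are
  given by a carrier set and a distance function. All possibly infinite suprema of distances are
  taken in \<^typ>\<open>ennreal\<close>, so that they are honest suprema (with value 0 on the empty set).\<close>

definition distortion ::
  "'a set \<Rightarrow> ('a \<Rightarrow> 'a \<Rightarrow> real) \<Rightarrow> ('c \<Rightarrow> 'c \<Rightarrow> real) \<Rightarrow> ('a \<Rightarrow> 'c) \<Rightarrow> ennreal" where
  "distortion X dX dY f = (SUP (x, x') \<in> X \<times> X. ennreal \<bar>dY (f x) (f x') - dX x x'\<bar>)"

definition codistortion ::
  "'a set \<Rightarrow> ('a \<Rightarrow> 'a \<Rightarrow> real) \<Rightarrow> 'c set \<Rightarrow> ('c \<Rightarrow> 'c \<Rightarrow> real) \<Rightarrow>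
    ('a \<Rightarrow> 'c) \<Rightarrow> ('c \<Rightarrow> 'a) \<Rightarrow> ennreal" where
  "codistortion X dX Y dY f g = (SUP (x, y) \<in> X \<times> Y. ennreal \<bar>dY (f x) y - dX x (g y)\<bar>)"

definition approx_bundle_map ::
  "real \<Rightarrow> real \<Rightarrow> 'a set \<Rightarrow> ('a \<Rightarrow> 'a \<Rightarrow> real) \<Rightarrow> ('a \<Rightarrow> 'b::metric_space) \<Rightarrow>
    'c set \<Rightarrow> ('c \<Rightarrow> 'c \<Rightarrow> real) \<Rightarrow> ('c \<Rightarrow> 'b) \<Rightarrow> ('a \<Rightarrow> 'c) \<Rightarrow> bool" where
  "approx_bundle_map \<beta> \<epsilon> X dX \<pi> X' dX' \<pi>' \<phi> \<longleftrightarrow>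
     \<phi> \<in> X \<rightarrow> X' \<and>
     (\<exists>\<psi> \<in> X' \<rightarrow> X.
        max (distortion X dX dX' \<phi>)
          (max (distortion X' dX' dX \<psi>) (codistortion X dX X' dX' \<phi> \<psi>)) \<le> ennreal \<epsilon> \<and>
        max (SUP x\<in>X. ennreal (dist (\<pi> x) (\<pi>' (\<phi> x))))
          (SUP x'\<in>X'. ennreal (dist (\<pi>' x') (\<pi> (\<psi> x')))) \<le> ennreal (\<beta> / 2))"

section \<open>Discrete approximate circle bundles\<close>

text \<open>The circle is the unit circle in the complex plane. Since \<^const>\<open>Arg\<close> takes values in
  the interval from \<open>- pi\<close> to \<open>pi\<close>, the following is the geodesic distance.\<close>

definition circle_dist :: "complex \<Rightarrow> complex \<Rightarrow> real" where
  "circle_dist z w = \<bar>Arg (z / w)\<bar>"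

definition prod_circle_dist ::
  "real \<Rightarrow> 'b::metric_space \<times> complex \<Rightarrow> 'b \<times> complex \<Rightarrow> real" where
  "prod_circle_dist r0 p q =
     max (dist (fst p) (fst q)) (r0 * circle_dist (snd p) (snd q))"

definition approx_local_trivialization ::
  "real \<Rightarrow> real \<Rightarrow> real \<Rightarrow> ('x::metric_space \<Rightarrow> 'b::metric_space) \<Rightarrow> 'b set \<Rightarrow>
    real \<Rightarrow> ('x \<Rightarrow> 'b \<times> complex) \<Rightarrow> bool" where
  "approx_local_trivialization r \<beta> \<epsilon> \<pi> U r0 \<phi> \<longleftrightarrow>
     0 \<le> \<beta> \<and> 0 \<le> \<epsilon> \<and> r > 16 / pi * (\<epsilon> + \<beta>) \<and> open U \<and> r0 \<ge> r \<and>
     approx_bundle_map \<beta> \<epsilon> (\<pi> -` U) dist \<pi>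
       (U \<times> sphere (0::complex) 1) (prod_circle_dist r0) fst \<phi>"

definition good_open_cover :: "nat set \<Rightarrow> (nat \<Rightarrow> 'b::topological_space set) \<Rightarrow> bool" where
  "good_open_cover J U \<longleftrightarrow>
     (\<forall>j\<in>J. open (U j)) \<and> (\<Union>j\<in>J. U j) = UNIV \<and>
     (\<forall>F. F \<subseteq> J \<and> finite F \<and> F \<noteq> {} \<and> (\<Inter>j\<in>F. U j) \<noteq> {} \<longrightarrow> contractible (\<Inter>j\<in>F. U j))"

definition locally_finite_family ::
  "nat set \<Rightarrow> (nat \<Rightarrow> 'b::topological_space set) \<Rightarrow> bool" where
  "locally_finite_family J U \<longleftrightarrow>
     (\<forall>b. \<exists>V. open V \<and> b \<in> V \<and> finite {j\<in>J. U j \<inter> V \<noteq> {}})"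

definition approx_circle_bundle ::
  "real \<Rightarrow> real \<Rightarrow> real \<Rightarrow> ('x::metric_space \<Rightarrow> 'b::metric_space) \<Rightarrow>
    nat set \<Rightarrow> (nat \<Rightarrow> 'b set) \<Rightarrow> bool" where
  "approx_circle_bundle r \<beta> \<epsilon> \<pi> J U \<longleftrightarrow>
     0 \<le> \<beta> \<and> 0 \<le> \<epsilon> \<and> r > 16 / pi * (\<epsilon> + \<beta>) \<and>
     good_open_cover J U \<and>
     (\<forall>j\<in>J. \<forall>k\<in>J. \<forall>l\<in>J. U j \<inter> U k \<inter> U l \<noteq> {} \<longrightarrow>
        (\<exists>x. cball (\<pi> x) \<beta> \<subseteq> U j \<inter> U k \<inter> U l)) \<and>
     (\<forall>j\<in>J. \<exists>rj \<phi>. approx_local_trivialization r \<beta> \<epsilon> \<pi> (U j) rj \<phi>)"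

definition trivializations ::
  "real \<Rightarrow> real \<Rightarrow> real \<Rightarrow> ('x::metric_space \<Rightarrow> 'b::metric_space) \<Rightarrow>
    nat set \<Rightarrow> (nat \<Rightarrow> 'b set) \<Rightarrow> (nat \<Rightarrow> 'x \<Rightarrow> 'b \<times> complex) set" where
  "trivializations r \<beta> \<epsilon> \<pi> J U =
     {\<Phi>. \<forall>j\<in>J. \<exists>rj. approx_local_trivialization r \<beta> \<epsilon> \<pi> (U j) rj (\<Phi> j)}"

definition circle_coords :: "(nat \<Rightarrow> 'x \<Rightarrow> 'b \<times> complex) \<Rightarrow> nat \<Rightarrow> 'x \<Rightarrow> complex" where
  "circle_coords \<Phi> j = snd \<circ> \<Phi> j"

text \<open>The library's \<^const>\<open>diameter\<close> is only meaningful for bounded sets.\<close>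

definition ediameter :: "'b::metric_space set \<Rightarrow> ennreal" where
  "ediameter S = (SUP (b, b') \<in> S \<times> S. ennreal (dist b b'))"

definition tau ::
  "real \<Rightarrow> real \<Rightarrow> real \<Rightarrow> nat set \<Rightarrow> (nat \<Rightarrow> 'b::metric_space set) \<Rightarrow> ennreal" where
  "tau r \<beta> \<epsilon> J U =
     ((SUP j\<in>J. ediameter (U j)) + ennreal (10 * \<epsilon> + 9 * \<beta>)) / ennreal r"

text \<open>This is meaningful only if \<^term>\<open>tau r \<beta> \<epsilon> J U \<le> 2\<close>.\<close>

definition tau_tilde ::
  "real \<Rightarrow> real \<Rightarrow> real \<Rightarrow> nat set \<Rightarrow> (nat \<Rightarrow> 'b::metric_space set) \<Rightarrow> real" where
  "tau_tilde r \<beta> \<epsilon> J U = 2 * arcsin (enn2real (tau r \<beta> \<epsilon> J U) / 2)"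

section \<open>The witness of a family of circle-valued maps\<close>

definition c2v :: "complex \<Rightarrow> real^2" where
  "c2v z = vector [Re z, Im z]"

definition rot :: "real \<Rightarrow> real^2^2" where
  "rot \<theta> = vector [vector [cos \<theta>, - sin \<theta>], vector [sin \<theta>, cos \<theta>]]"

definition refl2 :: "real^2^2" where
  "refl2 = vector [vector [1, 0], vector [0, -1]]"

text \<open>The closed arc with midpoint \<open>cis \<theta>\<close> and length \<open>2 * h\<close> (for \<open>0 \<le> h \<le> pi\<close>;
  the whole circle for \<open>h \<ge> pi\<close>).\<close>

definition circle_arc :: "real \<Rightarrow> real \<Rightarrow> complex set" where
  "circle_arc \<theta> h = cis ` {\<theta> - h .. \<theta> + h}"

definition shortest_arc_midpoint :: "complex set \<Rightarrow> real \<Rightarrow> bool" where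
  "shortest_arc_midpoint S \<theta> \<longleftrightarrow>
     (\<exists>h\<ge>0. S \<subseteq> circle_arc \<theta> h \<and>
        (\<forall>\<theta>' h'. 0 \<le> h' \<and> S \<subseteq> circle_arc \<theta>' h' \<longrightarrow> h \<le> h'))"

text \<open>A shortest arc need not be unique, so the construction depends on a choice;
  \<open>wit_pair\<close> is the set of its possible values. If \<open>f x = cis a\<close> and \<open>g x = cis b\<close>, then
  \<open>f x / g x = cis (a - b)\<close> and \<open>f x * g x = cis (a + b)\<close>.\<close>

definition wit_pair ::
  "'x set \<Rightarrow> ('x \<Rightarrow> complex) \<Rightarrow> ('x \<Rightarrow> complex) \<Rightarrow> (real^2^2) set" where
  "wit_pair Y f g =
     {M. \<exists>\<theta> \<theta>'.
        shortest_arc_midpoint ((\<lambda>x. f x / g x) ` Y) \<theta> \<and>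
        shortest_arc_midpoint ((\<lambda>x. f x * g x) ` Y) \<theta>' \<and>
        M = (if (SUP x\<in>Y. norm (c2v (f x) - rot \<theta> *v c2v (g x)))
                < (SUP x\<in>Y. norm (c2v (f x) - (rot \<theta>' ** refl2) *v c2v (g x)))
             then rot \<theta> else rot \<theta>' ** refl2)}"

definition wit ::
  "('x \<Rightarrow> 'b) \<Rightarrow> nat set \<Rightarrow> (nat \<Rightarrow> 'b set) \<Rightarrow> (nat \<Rightarrow> 'x \<Rightarrow> complex) \<Rightarrow>
    (nat \<Rightarrow> nat \<Rightarrow> real^2^2) set" where
  "wit \<pi> J U f =
     {W. \<forall>j\<in>J. \<forall>k\<in>J. U j \<inter> U k \<noteq> {} \<longrightarrow>
           W j k \<in> wit_pair (\<pi> -` (U j \<inter> U k)) (f j) (f k)}"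

section \<open>Approximate and exact cocycles\<close>

text \<open>Values of cochains outside of the relevant intersections are irrelevant. The norm of
  \<^typ>\<open>real^2^2\<close> is the Frobenius norm.\<close>

type_synonym 'b cochain = "nat \<Rightarrow> nat \<Rightarrow> 'b \<Rightarrow> real^2^2"

definition cochains :: "nat set \<Rightarrow> (nat \<Rightarrow> 'b::topological_space set) \<Rightarrow> 'b cochain set" where
  "cochains J U =
     {\<Omega>. \<forall>j\<in>J. \<forall>k\<in>J. continuous_on (U j \<inter> U k) (\<Omega> j k) \<and>
           (\<forall>b\<in>U j \<inter> U k. orthogonal_matrix (\<Omega> j k b))}"

definition approx_cocycles ::
  "real \<Rightarrow> nat set \<Rightarrow> (nat \<Rightarrow> 'b::topological_space set) \<Rightarrow> 'b cochain set" where
  "approx_cocycles \<eta> J U =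
     {\<Omega> \<in> cochains J U.
        (SUP (j, k, l) \<in> J \<times> J \<times> J. SUP b \<in> U j \<inter> U k \<inter> U l.
           ennreal (norm (\<Omega> j k b ** \<Omega> k l b - \<Omega> j l b))) < ennreal \<eta>}"

definition locally_constant_on ::
  "'b::topological_space set \<Rightarrow> ('b \<Rightarrow> 'c) \<Rightarrow> bool" where
  "locally_constant_on S f \<longleftrightarrow>
     (\<forall>b\<in>S. \<exists>V. open V \<and> b \<in> V \<and> (\<forall>c \<in> V \<inter> S. f c = f b))"

definition approx_lc_cocycles ::
  "real \<Rightarrow> nat set \<Rightarrow> (nat \<Rightarrow> 'b::topological_space set) \<Rightarrow> 'b cochain set" where
  "approx_lc_cocycles \<eta> J U =
     {\<Omega> \<in> approx_cocycles \<eta> J U.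
        \<forall>j\<in>J. \<forall>k\<in>J. locally_constant_on (U j \<inter> U k) (\<Omega> j k)}"

definition cocycles :: "nat set \<Rightarrow> (nat \<Rightarrow> 'b::topological_space set) \<Rightarrow> 'b cochain set" where
  "cocycles J U =
     {\<Omega> \<in> cochains J U. \<forall>j\<in>J. \<forall>k\<in>J. \<forall>l\<in>J. \<forall>b \<in> U j \<inter> U k \<inter> U l.
        \<Omega> j k b ** \<Omega> k l b = \<Omega> j l b}"

definition cohomologous ::
  "nat set \<Rightarrow> (nat \<Rightarrow> 'b::topological_space set) \<Rightarrow> ('b cochain \<times> 'b cochain) set" where
  "cohomologous J U =
     {(\<Omega>, \<Omega>'). \<Omega> \<in> cocycles J U \<and> \<Omega>' \<in> cocycles J U \<and>
        (\<exists>\<mu> :: nat \<Rightarrow> 'b \<Rightarrow> real^2^2.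
           (\<forall>j\<in>J. continuous_on (U j) (\<mu> j) \<and> (\<forall>b\<in>U j. orthogonal_matrix (\<mu> j b))) \<and>
           (\<forall>j\<in>J. \<forall>k\<in>J. \<forall>b \<in> U j \<inter> U k.
              \<Omega>' j k b = \<mu> j b ** \<Omega> j k b ** matrix_inv (\<mu> k b)))}"

definition H1 :: "nat set \<Rightarrow> (nat \<Rightarrow> 'b::topological_space set) \<Rightarrow> 'b cochain set set" where
  "H1 J U = cocycles J U // cohomologous J U"

definition coh_class ::
  "nat set \<Rightarrow> (nat \<Rightarrow> 'b::topological_space set) \<Rightarrow> 'b cochain \<Rightarrow> 'b cochain set" where
  "coh_class J U \<Omega> = cohomologous J U `` {\<Omega>}"

section \<open>The projection from approximate to exact cocycles\<close>

definition partition_of_unity ::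
  "nat set \<Rightarrow> (nat \<Rightarrow> 'b::topological_space set) \<Rightarrow> (nat \<Rightarrow> 'b \<Rightarrow> real) \<Rightarrow> bool" where
  "partition_of_unity J U \<rho> \<longleftrightarrow>
     (\<forall>j\<in>J. continuous_on UNIV (\<rho> j) \<and> (\<forall>b. 0 \<le> \<rho> j b) \<and> closure {b. \<rho> j b \<noteq> 0} \<subseteq> U j) \<and>
     (\<forall>b. \<exists>V. open V \<and> b \<in> V \<and> finite {j\<in>J. \<exists>c\<in>V. \<rho> j c \<noteq> 0}) \<and>
     (\<forall>b. (\<Sum>j \<in> {j\<in>J. \<rho> j b \<noteq> 0}. \<rho> j b) = 1)"

text \<open>Elements of \<open>\<real>\<close>-infinity are finitely supported sequences. Infinite square matrices have
  type \<^typ>\<open>nat \<Rightarrow> nat \<Rightarrow> real\<close>, and a matrix with two columns is given by its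
  sequence of rows, of type \<^typ>\<open>nat \<Rightarrow> real^2\<close>. All series below are in fact finite
  sums when the matrices involved have only finitely many nonzero entries.\<close>

definition Rinf :: "(nat \<Rightarrow> real) set" where
  "Rinf = {v. finite {n. v n \<noteq> 0}}"

definition inner_inf :: "(nat \<Rightarrow> real) \<Rightarrow> (nat \<Rightarrow> real) \<Rightarrow> real" where
  "inner_inf v w = (\<Sum>n. v n * w n)"

definition mat_vec_inf :: "(nat \<Rightarrow> nat \<Rightarrow> real) \<Rightarrow> (nat \<Rightarrow> real) \<Rightarrow> nat \<Rightarrow> real" where
  "mat_vec_inf A v = (\<lambda>m. \<Sum>n. A m n * v n)"

definition mat_tall_mult :: "(nat \<Rightarrow> nat \<Rightarrow> real) \<Rightarrow> (nat \<Rightarrow> real^2) \<Rightarrow> nat \<Rightarrow> real^2" where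
  "mat_tall_mult A M = (\<lambda>m. \<Sum>n. A m n *\<^sub>R M n)"

text \<open>The product of the transpose of \<open>M\<close> with \<open>N\<close>.\<close>

definition tall_transpose_mult :: "(nat \<Rightarrow> real^2) \<Rightarrow> (nat \<Rightarrow> real^2) \<Rightarrow> real^2^2" where
  "tall_transpose_mult M N = (\<chi> a c. \<Sum>n. M n $ a * N n $ c)"

definition V2 :: "(nat \<Rightarrow> real^2) set" where
  "V2 = {M. finite {n. M n \<noteq> 0} \<and> tall_transpose_mult M M = mat 1}"

text \<open>Row \<open>n\<close> lies in the \<open>2 \<times> 2\<close> block with index \<open>n div 2\<close>.\<close>

definition Psi ::
  "nat set \<Rightarrow> (nat \<Rightarrow> 'b \<Rightarrow> real) \<Rightarrow> 'b cochain \<Rightarrow> nat \<Rightarrow> 'b \<Rightarrow> nat \<Rightarrow> real^2" where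
  "Psi J \<rho> \<Omega> j b n =
     (let i = n div 2; a = (if even n then 1 else 2) in
      if i \<in> J \<and> \<rho> i b \<noteq> 0 then sqrt (\<rho> i b) *\<^sub>R (\<Omega> i j b $ a) else 0)"

definition cl ::
  "nat set \<Rightarrow> (nat \<Rightarrow> 'b \<Rightarrow> real) \<Rightarrow> 'b cochain \<Rightarrow> 'b \<Rightarrow> nat \<Rightarrow> nat \<Rightarrow> real" where
  "cl J \<rho> \<Omega> b m n =
     (\<Sum>j \<in> {j\<in>J. \<rho> j b \<noteq> 0}. \<rho> j b * (Psi J \<rho> \<Omega> j b m \<bullet> Psi J \<rho> \<Omega> j b n))"

text \<open>\<open>u\<close>, \<open>v\<close> are orthonormal eigenvectors of the symmetric matrix \<open>S\<close> for its two largest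
  eigenvalues (counted with multiplicity). Their span, and hence the projection, is determined
  by \<open>S\<close> because the remaining eigenvalues are required to be strictly smaller.\<close>

definition top_eigenpair ::
  "(nat \<Rightarrow> nat \<Rightarrow> real) \<Rightarrow> (nat \<Rightarrow> real) \<Rightarrow> (nat \<Rightarrow> real) \<Rightarrow> bool" where
  "top_eigenpair S u v \<longleftrightarrow>
     u \<in> Rinf \<and> v \<in> Rinf \<and> inner_inf u u = 1 \<and> inner_inf v v = 1 \<and> inner_inf u v = 0 \<and>
     (\<exists>l1 l2. mat_vec_inf S u = (\<lambda>n. l1 * u n) \<and> mat_vec_inf S v = (\<lambda>n. l2 * v n) \<and> l2 \<le> l1 \<and>
        (\<forall>w\<in>Rinf. \<forall>l. w \<noteq> (\<lambda>n. 0) \<and> inner_inf u w = 0 \<and> inner_inf v w = 0 \<and>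
           mat_vec_inf S w = (\<lambda>n. l * w n) \<longrightarrow> l < l2))"

definition Gr_proj :: "(nat \<Rightarrow> nat \<Rightarrow> real) \<Rightarrow> nat \<Rightarrow> nat \<Rightarrow> real" where
  "Gr_proj A =
     (THE P. \<exists>u v. top_eigenpair (\<lambda>m n. (A m n + A n m) / 2) u v \<and>
                   P = (\<lambda>m n. u m * u n + v m * v n))"

text \<open>The factor \<open>Q\<close> in the polar decomposition \<open>M = Q H\<close>, where \<open>H\<close> is the positive
  semidefinite square root of the Gram matrix of \<open>M\<close>. It is unique if \<open>M\<close> has rank 2.\<close>

definition polar_factor :: "(nat \<Rightarrow> real^2) \<Rightarrow> nat \<Rightarrow> real^2" where
  "polar_factor M =
     (THE Q. Q \<in> V2 \<and>
        (\<exists>H :: real^2^2. transpose H = H \<and> (\<forall>x. 0 \<le> x \<bullet> (H *v x)) \<and>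
           H ** H = tall_transpose_mult M M \<and> M = (\<lambda>n. Q n v* H)))"

definition Psi_tilde ::
  "nat set \<Rightarrow> (nat \<Rightarrow> 'b \<Rightarrow> real) \<Rightarrow> 'b cochain \<Rightarrow> nat \<Rightarrow> 'b \<Rightarrow> nat \<Rightarrow> real^2" where
  "Psi_tilde J \<rho> \<Omega> j b =
     polar_factor (mat_tall_mult (Gr_proj (cl J \<rho> \<Omega> b)) (Psi J \<rho> \<Omega> j b))"

definition Pi_Z :: "nat set \<Rightarrow> (nat \<Rightarrow> 'b \<Rightarrow> real) \<Rightarrow> 'b cochain \<Rightarrow> 'b cochain" where
  "Pi_Z J \<rho> \<Omega> j k b = tall_transpose_mult (Psi_tilde J \<rho> \<Omega> j b) (Psi_tilde J \<rho> \<Omega> k b)"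

end

theory Submission
  imports Defs
begin

text \<open>
  Two local trivializations over overlapping charts differ by a map of circles that distorts
  distances by at most a multiple of \<open>\<tau>\<close>. Looking at a base point and at points near its two
  quarter turns, such a map is within \<open>3 \<tau>\<close> of an isometry, and the midpoint of a shortest arc is
  an optimal approximation; so witnesses are \<open>3 \<tau>\<close>-close to the coordinate changes and
  form an approximate cocycle with operator-norm error \<open>9 \<tau>\<close>, hence Frobenius error
  \<open>9 \<surd>2 \<tau> < 1/2\<close>.

  For an approximate cocycle with operator-norm error \<open>\<kappa>\<close>, the quadratic form of \<open>cl(\<Omega>)(b)\<close> is at
  least \<open>1 - \<kappa>\<^sup>2\<close> on the image of \<open>\<Psi>\<^sub>k(b)\<close> and at most \<open>\<kappa>\<^sup>2\<close> on its orthogonal complement. This gap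
  yields the spectral projection, its continuity in \<open>b\<close>, and the exactness of \<open>\<Pi>\<^sub>Z(\<Omega>)\<close>, whose
  transition functions are those of the plane bundle of images of the projection.

  For two families \<open>\<Phi>\<close>, \<open>\<Phi>'\<close>, the isometries comparing \<open>f\<^sub>j\<close> with \<open>f'\<^sub>j\<close> give constants \<open>\<mu>\<^sub>j\<close> that
  intertwine the two witnesses up to \<open>\<kappa>' = 12 \<tau>\<close>. Since \<open>3 \<kappa>\<^sup>2 + 2 \<kappa>'\<^sup>2 < 1\<close>, the block diagonal matrix
  of the \<open>\<mu>\<^sub>i\<close> followed by the second projection is injective on the first plane bundle; its
  polar factor in the frames \<open>\<Psi>\<close>-tilde is the required coboundary.
\<close>

section \<open>Near isometries of the circle\<close>

text \<open>The bound sqrt 2 / 36 is exactly what the Frobenius condition asks for: on a triple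
  overlap three witness errors of 3 \<tau> accumulate, the Frobenius norm adds a factor sqrt 2, and
  9 * sqrt 2 * (sqrt 2 / 36) = 1/2. Strictness is gained from sin s < s in the passage from
  \<open>tau_tilde\<close> to \<open>tau\<close>. Afterwards only the operator norm matters, where
  \<kappa> = 9 \<tau> and \<kappa>' = 12 \<tau> leave ample room. Two obstacles shape the rest. A
  shortest arc is not unique, so a family has many witnesses; independence is shown for arbitrary
  witnesses of arbitrary families, and equal families cover the choice of a witness. Finitely
  supported sequences form an incomplete space, so eigenvectors are found as maximizers over a
  compact set of coordinates, which works because each matrix \<open>cl\<close> has finite support.
  The two plane bundles come without a common frame. The polar factor of the comparison map is
  natural under changes of orthonormal frame on both sides, and this naturality is what turns it
  into a coboundary.\<close>

lemma abs_Arg_cis: "\<bar>Arg (cis t)\<bar> = \<bar>t\<bar>" if "\<bar>t\<bar> \<le> pi"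
proof (cases "t = -pi")
  case True
  then have "cis t = cis pi" by (simp add: complex_eq_iff)
  then show ?thesis using True Arg_cis[of pi] by simp
next
  case False
  then show ?thesis using that Arg_cis[of t] by (auto simp: abs_le_iff)
qed

lemma abs_Arg_cis_le: "\<bar>Arg (cis t)\<bar> \<le> \<bar>t\<bar>"
proof (cases "\<bar>t\<bar> \<le> pi")
  case True then show ?thesis by (simp add: abs_Arg_cis)
next
  case False then show ?thesis using Arg_bounded[of "cis t"] by linarith
qed

lemma cis_Arg_unit: "norm z = 1 \<Longrightarrow> cis (Arg z) = z"
  by (metis cis_Arg norm_zero sgn_div_norm divide_inverse inverse_1 mult.commute scaleR_one zero_neq_one)

lemma circle_dist_cis_le: "circle_dist (cis a) (cis b) \<le> \<bar>a - b\<bar>"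
  unfolding circle_dist_def cis_divide by (rule abs_Arg_cis_le)

lemma circle_dist_cis: "\<bar>a - b\<bar> \<le> pi \<Longrightarrow> circle_dist (cis a) (cis b) = \<bar>a - b\<bar>"
  unfolding circle_dist_def cis_divide by (rule abs_Arg_cis)

lemma circle_dist_cis':
  assumes "pi \<le> \<bar>a - b\<bar>" "\<bar>a - b\<bar> \<le> 2 * pi"
  shows "circle_dist (cis a) (cis b) = 2 * pi - \<bar>a - b\<bar>"
proof (cases "a \<ge> b")
  case True
  have "cis a = cis (a - 2 * pi)" by (simp add: complex_eq_iff cos_diff sin_diff)
  then show ?thesis using circle_dist_cis[of "a - 2 * pi" b] assms True by (simp add: abs_if split: if_splits)
next
  case False
  have "cis b = cis (b - 2 * pi)" by (simp add: complex_eq_iff cos_diff sin_diff)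
  then show ?thesis using circle_dist_cis[of a "b - 2 * pi"] assms False by (simp add: abs_if split: if_splits)
qed

lemma circle_dist_le_pi: "circle_dist z w \<le> pi"
  using Arg_bounded[of "z / w"] by (simp add: circle_dist_def abs_le_iff)

lemma circle_dist_nonneg: "0 \<le> circle_dist z w"
  by (simp add: circle_dist_def)

lemma unit_cisE:
  assumes "norm z = 1" obtains t where "z = cis t" "- pi < t" "t \<le> pi"
  using that[of "Arg z"] cis_Arg_unit[OF assms] Arg_bounded[of z] by simp

lemma circle_dist_commute:
  assumes "norm z = 1" "norm w = 1" shows "circle_dist z w = circle_dist w z"
proof -
  obtain a b where "z = cis a" "w = cis b" "- pi < a" "a \<le> pi" "- pi < b" "b \<le> pi"
    using unit_cisE[OF assms(1)] unit_cisE[OF assms(2)] by metis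
  then show ?thesis
    by (cases "\<bar>a - b\<bar> \<le> pi") (auto simp: circle_dist_cis circle_dist_cis' abs_minus_commute)
qed

lemma circle_dist_triangle:
  assumes "norm z = 1" "norm w = 1" "norm v = 1"
  shows "circle_dist z v \<le> circle_dist z w + circle_dist w v"
proof -
  have "z / v = (z / w) * (w / v)" using assms by (auto simp: field_simps)
  also have "\<dots> = cis (Arg (z / w)) * cis (Arg (w / v))"
    using assms by (simp add: cis_Arg_unit norm_divide)
  finally have "\<bar>Arg (z / v)\<bar> \<le> \<bar>Arg (z / w) + Arg (w / v)\<bar>"
    by (metis abs_Arg_cis_le cis_mult)
  then show ?thesis unfolding circle_dist_def by linarith
qed

lemma circle_dist_mult:
  assumes "norm u = 1" shows "circle_dist (u * z) (u * w) = circle_dist z w"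
  using assms by (auto simp: circle_dist_def)

lemma circle_dist_cnj:
  assumes "norm z = 1" "norm w = 1" shows "circle_dist (cnj z) (cnj w) = circle_dist z w"
proof -
  obtain a b where "z = cis a" "w = cis b" "- pi < a" "a \<le> pi" "- pi < b" "b \<le> pi"
    using unit_cisE[OF assms(1)] unit_cisE[OF assms(2)] by metis
  moreover have "cnj (cis a) = cis (-a)" "cnj (cis b) = cis (-b)" by (simp_all add: cis_cnj)
  ultimately show ?thesis
    by (cases "\<bar>a - b\<bar> \<le> pi") (auto simp: circle_dist_cis circle_dist_cis' abs_minus_commute)
qed

lemma norm_cis_diff_le: "norm (cis a - cis b) \<le> \<bar>a - b\<bar>"
proof -
  have "(norm (cis a - cis b))\<^sup>2 = (cos a - cos b)\<^sup>2 + (sin a - sin b)\<^sup>2"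
    by (simp add: cmod_power2)
  also have "\<dots> = 2 - 2 * cos (a - b)"
    using sin_cos_squared_add[of a] sin_cos_squared_add[of b]
    by (simp add: cos_diff power2_eq_square algebra_simps)
  also have "\<dots> = (2 * sin ((a - b) / 2))\<^sup>2"
  proof -
    have "2 * ((a - b) / 2) = a - b" by simp
    then have "cos (a - b) = 1 - 2 * (sin ((a - b) / 2))\<^sup>2"
      by (metis cos_double_sin)
    then show ?thesis by (simp add: power2_eq_square)
  qed
  also have "\<dots> \<le> (a - b)\<^sup>2"
    using abs_sin_x_le_abs_x[of "(a - b) / 2"] 
    by (intro abs_le_square_iff[THEN iffD1]) (simp add: abs_mult)
  finally show ?thesis by (metis abs_le_square_iff abs_norm_cancel)
qed

text \<open>A chord is no longer than its arc. Through this inequality estimates of angles become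
  estimates in the plane.\<close>

lemma norm_diff_le_circle_dist:
  assumes "norm z = 1" "norm w = 1" shows "norm (z - w) \<le> circle_dist z w"
proof -
  have "z = w * cis (Arg (z / w))" using assms by (auto simp: cis_Arg_unit norm_divide)
  then have "z - w = w * (cis (Arg (z / w)) - cis 0)"
    by (metis cis_zero mult.right_neutral right_diff_distrib)
  then have "norm (z - w) = norm (cis (Arg (z / w)) - cis 0)" using assms by (simp add: norm_mult)
  also have "\<dots> \<le> \<bar>Arg (z / w) - 0\<bar>" by (rule norm_cis_diff_le)
  finally show ?thesis by (simp add: circle_dist_def)
qed

section \<open>Arcs as geodesic balls, and existence of shortest arcs\<close>

lemma circle_arc_eq:
  assumes "0 \<le> h" shows "circle_arc \<theta> h = {z. norm z = 1 \<and> circle_dist z (cis \<theta>) \<le> h}"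
proof (intro set_eqI iffI)
  fix z assume "z \<in> circle_arc \<theta> h"
  then obtain t where "z = cis t" "\<bar>t - \<theta>\<bar> \<le> h" by (auto simp: circle_arc_def abs_le_iff)
  then show "z \<in> {z. norm z = 1 \<and> circle_dist z (cis \<theta>) \<le> h}"
    using circle_dist_cis_le[of t \<theta>] by auto
next
  fix z assume "z \<in> {z. norm z = 1 \<and> circle_dist z (cis \<theta>) \<le> h}"
  then have z: "norm z = 1" "\<bar>Arg (z / cis \<theta>)\<bar> \<le> h" by (auto simp: circle_dist_def)
  have "z = cis (Arg (z / cis \<theta>)) * cis \<theta>" using z by (simp add: cis_Arg_unit norm_divide)
  also have "\<dots> = cis (Arg (z / cis \<theta>) + \<theta>)" by (simp add: cis_mult)
  finally show "z \<in> circle_arc \<theta> h" using z(2)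
    unfolding circle_arc_def by (intro image_eqI) (auto simp: abs_le_iff)
qed

text \<open>The largest geodesic distance \<open>F\<close> from the set to a candidate midpoint is
  1-Lipschitz in the angle, so it attains its minimum over a full period. A minimizer is a midpoint,
  and the minimum is the half-length.\<close>

lemma shortest_arc_midpoint_exists:
  assumes "S \<noteq> {}" "\<And>s. s \<in> S \<Longrightarrow> norm s = 1"
  shows "\<exists>\<theta>. shortest_arc_midpoint S \<theta>"
proof -
  define F where "F \<theta> = (SUP s\<in>S. circle_dist s (cis \<theta>))" for \<theta>
  have bdd: "bdd_above ((\<lambda>s. circle_dist s (cis \<theta>)) ` S)" for \<theta>
    by (rule bdd_aboveI2[of _ _ pi]) (rule circle_dist_le_pi)
  have up: "circle_dist s (cis \<theta>) \<le> F \<theta>" if "s \<in> S" for s \<theta>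
    unfolding F_def using that bdd by (rule cSUP_upper)
  have lub: "F \<theta> \<le> c" if "\<And>s. s \<in> S \<Longrightarrow> circle_dist s (cis \<theta>) \<le> c" for \<theta> c
    unfolding F_def using assms(1) that by (rule cSUP_least)
  have lip: "F a \<le> F b + \<bar>a - b\<bar>" for a b
  proof (rule lub)
    fix s assume s: "s \<in> S"
    show "circle_dist s (cis a) \<le> F b + \<bar>a - b\<bar>"
      using circle_dist_triangle[of s "cis b" "cis a"] circle_dist_cis_le[of b a] up[OF s, of b] assms(2)[OF s]
      by (simp add: abs_minus_commute)
  qed
  have "continuous_on {-pi..pi} F"
  proof (rule continuous_on_iff[THEN iffD2], intro ballI allI impI)
    fix a e :: real assume "0 < e"
    show "\<exists>d>0. \<forall>x'\<in>{-pi..pi}. dist x' a < d \<longrightarrow> dist (F x') (F a) < e"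
    proof (intro exI[of _ e] conjI ballI impI)
      fix x assume "dist x a < e"
      then show "dist (F x) (F a) < e" using lip[of x a] lip[of a x]
        unfolding dist_real_def by linarith
    qed (rule \<open>0 < e\<close>)
  qed
  moreover have "{-pi..pi} \<noteq> {}" by simp
  ultimately obtain \<theta> where \<theta>: "\<And>t. t \<in> {-pi..pi} \<Longrightarrow> F \<theta> \<le> F t"
    using continuous_attains_inf[OF compact_Icc, of "-pi" pi F] by blast
  obtain s0 where s0: "s0 \<in> S" using assms(1) by blast
  have F0: "0 \<le> F \<theta>" using up[OF s0, of \<theta>] circle_dist_nonneg[of s0 "cis \<theta>"] by linarith
  show ?thesis unfolding shortest_arc_midpoint_def
  proof (rule exI[of _ \<theta>], rule exI[of _ "F \<theta>"], intro conjI allI impI)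
    show "S \<subseteq> circle_arc \<theta> (F \<theta>)" using F0 up assms(2) by (auto simp: circle_arc_eq)
    fix \<theta>' h' assume A: "0 \<le> h' \<and> S \<subseteq> circle_arc \<theta>' h'"
    then have "circle_dist s (cis \<theta>') \<le> h'" if "s \<in> S" for s
      using that by (auto simp: circle_arc_eq)
    then have "F \<theta>' \<le> h'" by (intro lub) blast
    \<comment> \<open>An arbitrary angle enters the compact interval through its principal
      value.\<close>
    moreover have "F (Arg (cis \<theta>')) = F \<theta>'" by (simp add: F_def cis_Arg_unit)
    moreover have "F \<theta> \<le> F (Arg (cis \<theta>'))" using Arg_bounded[of "cis \<theta>'"] by (intro \<theta>) auto
    ultimately show "F \<theta> \<le> h'" by simp
  qed (rule F0)
qed

text \<open>Only the upper half circle is treated: on the lower half, the comparison with \<open>p\<close> would give a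
  worse constant, and a point near the opposite quarter turn is used instead.\<close>

lemma near_isometry_upper:
  fixes a c p q \<delta> :: real
  assumes a: "0 \<le> a" "a \<le> pi" and c: "\<bar>c\<bar> \<le> pi" and p: "\<bar>p - pi/2\<bar> \<le> 1/5" and q: "0 \<le> q"
    and \<delta>: "0 \<le> \<delta>" "\<delta> \<le> 1/20"
    and ca: "\<bar>c\<bar> \<le> a + \<delta>" and ac: "a \<le> \<bar>c\<bar> + 2 * \<delta>" and qp: "q \<le> p + \<delta>" and pq: "p \<le> q + 2 * \<delta>"
    and cq: "circle_dist (cis c) (cis q) \<le> \<bar>a - p\<bar> + \<delta>"
  shows "circle_dist (cis c) (cis a) \<le> 3 * \<delta>"
proof -
  have pi: "pi > 3" using pi_gt3 by simp
  show ?thesis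
  proof (cases "0 \<le> c")
    case True
    then show ?thesis using circle_dist_cis_le[of c a] ca ac \<delta> by linarith
  next
    case False
    have le: "circle_dist (cis c) (cis a) \<le> 2 * pi - (a - c)"
      using False a c circle_dist_cis[of c a] circle_dist_cis'[of c a] pi
      by (cases "\<bar>c - a\<bar> \<le> pi") auto
    show ?thesis
    proof (cases "\<bar>c - q\<bar> \<le> pi")
      case True
      \<comment> \<open>If a \<le> p, then q \<ge> p - 2 \<delta> turns this into a - c \<le> 3
        \<delta>, the worst case of the lemma. If a > p, the bounds would force 2 p \<le> 5
        \<delta>, although p is close to a quarter turn.\<close>
      then have "q - c \<le> \<bar>a - p\<bar> + \<delta>" using cq circle_dist_cis[of c q] False q by simp
      then show ?thesis using circle_dist_cis_le[of c a] False ca ac qp pq \<delta> a c p pi by argo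
    next
      case F2: False
      \<comment> \<open>If a \<ge> p, the way around the far side has length at most 2 \<delta>. If
        a < p, the bounds would give 2 pi \<le> 2 p + 3 \<delta>, impossible for p close to a
        quarter turn.\<close>
      then have "2 * pi - (q - c) \<le> \<bar>a - p\<bar> + \<delta>" using cq circle_dist_cis'[of c q] False q c qp p \<delta> pi by argo
      then show ?thesis using le circle_dist_cis_le[of c a] False ca ac qp pq \<delta> a c p pi by argo
    qed
  qed
qed


text \<open>Once \<open>x1\<close> is sent to the upper half, \<open>x2\<close> must be sent to the
  lower half, since otherwise two nearly antipodal points would have images close to each other.
  Points of the lower half are then handled like those of the upper half, after conjugation and with
  \<open>x2\<close> as the reference point.\<close>

lemma near_isometry_real:
  fixes a c :: "'x \<Rightarrow> real"
  assumes a: "\<And>x. x \<in> Y \<Longrightarrow> \<bar>a x\<bar> \<le> pi" and c: "\<And>x. x \<in> Y \<Longrightarrow> \<bar>c x\<bar> \<le> pi"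
    and \<delta>: "0 \<le> \<delta>" "\<delta> \<le> 1/20"
    and ca: "\<And>x. x \<in> Y \<Longrightarrow> \<bar>c x\<bar> \<le> \<bar>a x\<bar> + \<delta>"
    and ac: "\<And>x. x \<in> Y \<Longrightarrow> \<bar>a x\<bar> \<le> \<bar>c x\<bar> + 2 * \<delta>"
    and d1: "\<And>x y. x \<in> Y \<Longrightarrow> y \<in> Y \<Longrightarrow>
      circle_dist (cis (c x)) (cis (c y)) \<le> circle_dist (cis (a x)) (cis (a y)) + \<delta>"
    and d2: "\<And>x y. x \<in> Y \<Longrightarrow> y \<in> Y \<Longrightarrow>
      circle_dist (cis (a x)) (cis (a y)) \<le> circle_dist (cis (c x)) (cis (c y)) + 2 * \<delta>"
    and x1: "x1 \<in> Y" "\<bar>a x1 - pi/2\<bar> \<le> 1/5" "0 \<le> c x1"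
    and x2: "x2 \<in> Y" "\<bar>a x2 + pi/2\<bar> \<le> 1/5"
    and x: "x \<in> Y"
  shows "circle_dist (cis (c x)) (cis (a x)) \<le> 3 * \<delta>"
proof -
  have pi: "pi > 3" using pi_gt3 by simp
  have cm: "circle_dist (cis (- s)) (cis (- t)) = circle_dist (cis s) (cis t)" for s t
    by (metis cis_cnj circle_dist_cnj norm_cis)
  have x2': "c x2 \<le> 0"
  proof (rule ccontr)
    assume neg: "\<not> c x2 \<le> 0"
    have "circle_dist (cis (a x1)) (cis (a x2)) \<ge> pi - 2/5"
      using x1 x2 circle_dist_cis[of "a x1" "a x2"] circle_dist_cis'[of "a x1" "a x2"] pi by argo
    moreover have "\<bar>c x1 - c x2\<bar> \<le> 2/5 + 3 * \<delta>"
      using neg x1 x2 ca[OF x1(1)] ca[OF x2(1)] ac[OF x1(1)] ac[OF x2(1)] pi by argo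
    ultimately show False
      using d2[OF x1(1) x2(1)] circle_dist_cis_le[of "c x1" "c x2"] \<delta> pi by linarith
  qed
  show ?thesis
  proof (cases "0 \<le> a x")
    case True
    show ?thesis
    proof (rule near_isometry_upper[where p = "a x1" and q = "c x1"])
      show "circle_dist (cis (c x)) (cis (c x1)) \<le> \<bar>a x - a x1\<bar> + \<delta>"
        using d1[OF x x1(1)] circle_dist_cis_le[of "a x" "a x1"] by linarith
      show "c x1 \<le> a x1 + \<delta>" "a x1 \<le> c x1 + 2 * \<delta>"
        using ca[OF x1(1)] ac[OF x1(1)] x1 pi by argo+
    qed (use True a[OF x] c[OF x] \<delta> ca[OF x] ac[OF x] x1 in auto)
  next
    case False
    have "circle_dist (cis (- c x)) (cis (- a x)) \<le> 3 * \<delta>"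
    proof (rule near_isometry_upper[where p = "- a x2" and q = "- c x2"])
      show "circle_dist (cis (- c x)) (cis (- c x2)) \<le> \<bar>- a x - (- a x2)\<bar> + \<delta>"
        unfolding cm using d1[OF x x2(1)] circle_dist_cis_le[of "a x" "a x2"] by linarith
      show "- c x2 \<le> - a x2 + \<delta>" "- a x2 \<le> - c x2 + 2 * \<delta>"
        using ca[OF x2(1)] ac[OF x2(1)] x2 x2' pi by argo+
      show "\<bar>- a x2 - pi / 2\<bar> \<le> 1 / 5" using x2 by argo
    qed (use False a[OF x] c[OF x] \<delta> ca[OF x] ac[OF x] x2 x2' in auto)
    then show ?thesis unfolding cm .
  qed
qed

text \<open>Multiplication by a unit \<open>u\<close>, possibly after conjugation, gives all
  isometries of the circle; the two cases match the two candidates between which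
  \<open>wit_pair\<close> decides.\<close>

definition isometric_within :: "real \<Rightarrow> 'x set \<Rightarrow> ('x \<Rightarrow> complex) \<Rightarrow> ('x \<Rightarrow> complex) \<Rightarrow> bool" where
  "isometric_within e Y f g \<longleftrightarrow> (\<exists>u. norm u = 1 \<and>
     ((\<forall>x\<in>Y. circle_dist (f x) (u * g x) \<le> e) \<or> (\<forall>x\<in>Y. circle_dist (f x) (u * cnj (g x)) \<le> e)))"

text \<open>Dividing by the values at a base point \<open>x0\<close> puts this point at angle 0 for
  both maps. Distances to \<open>x0\<close> then fix the angles up to sign, and the side on which
  the quarter turn \<open>x1\<close> lands decides between a rotation and a reflection.\<close>

lemma near_isometry:
  fixes f g :: "'x \<Rightarrow> complex"
  assumes f: "\<And>x. x \<in> Y \<Longrightarrow> norm (f x) = 1" and g: "\<And>x. x \<in> Y \<Longrightarrow> norm (g x) = 1"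
    and \<delta>: "0 \<le> \<delta>" "\<delta> \<le> 1/20"
    and d1: "\<And>x y. x \<in> Y \<Longrightarrow> y \<in> Y \<Longrightarrow> circle_dist (f x) (f y) \<le> circle_dist (g x) (g y) + \<delta>"
    and d2: "\<And>x y. x \<in> Y \<Longrightarrow> y \<in> Y \<Longrightarrow> circle_dist (g x) (g y) \<le> circle_dist (f x) (f y) + 2 * \<delta>"
    and dense: "\<And>z. norm z = 1 \<Longrightarrow> \<exists>x\<in>Y. circle_dist (g x) z \<le> 1/5"
  shows "isometric_within (3 * \<delta>) Y f g"
proof -
  have pi: "pi > 3" using pi_gt3 by simp
  have cm: "circle_dist (cis (- s)) (cis (- t)) = circle_dist (cis s) (cis t)" for s t
    by (metis cis_cnj circle_dist_cnj norm_cis)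
  obtain x0 where x0: "x0 \<in> Y" using dense[of 1] by auto
  obtain x1 where x1: "x1 \<in> Y" "circle_dist (g x1) (g x0 * cis (pi/2)) \<le> 1/5"
    using dense[of "g x0 * cis (pi/2)"] g[OF x0] by (auto simp: norm_mult)
  obtain x2 where x2: "x2 \<in> Y" "circle_dist (g x2) (g x0 * cis (- (pi/2))) \<le> 1/5"
    using dense[of "g x0 * cis (- (pi/2))"] g[OF x0] by (auto simp: norm_mult)
  define a where "a x = Arg (g x / g x0)" for x
  define c where "c x = Arg (f x / f x0)" for x
  have ga: "g x = g x0 * cis (a x)" if "x \<in> Y" for x
  proof -
    have "g x0 \<noteq> 0" "norm (g x / g x0) = 1" using g[OF that] g[OF x0] by (auto simp: norm_divide)
    then show ?thesis by (simp add: a_def cis_Arg_unit)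
  qed
  have fc: "f x = f x0 * cis (c x)" if "x \<in> Y" for x
  proof -
    have "f x0 \<noteq> 0" "norm (f x / f x0) = 1" using f[OF that] f[OF x0] by (auto simp: norm_divide)
    then show ?thesis by (simp add: c_def cis_Arg_unit)
  qed
  have ra: "- pi < a x \<and> a x \<le> pi" and rc: "- pi < c x \<and> c x \<le> pi" for x
    by (simp_all add: a_def c_def Arg_bounded)
  have cdg: "circle_dist (g x) (g y) = circle_dist (cis (a x)) (cis (a y))" if "x \<in> Y" "y \<in> Y" for x y
    using ga[OF that(1)] ga[OF that(2)] circle_dist_mult g[OF x0] by metis
  have cdf: "circle_dist (f x) (f y) = circle_dist (cis (c x)) (cis (c y))" if "x \<in> Y" "y \<in> Y" for x y
    using fc[OF that(1)] fc[OF that(2)] circle_dist_mult f[OF x0] by metis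
  have "circle_dist (cis (a x1)) (cis (pi/2)) \<le> 1/5"
    using x1 ga[OF x1(1)] circle_dist_mult g[OF x0] by metis
  then have a1: "\<bar>a x1 - pi/2\<bar> \<le> 1/5"
    using circle_dist_cis[of "a x1" "pi/2"] circle_dist_cis'[of "a x1" "pi/2"] ra[of x1] pi by argo
  have "circle_dist (cis (a x2)) (cis (- (pi/2))) \<le> 1/5"
    using x2 ga[OF x2(1)] circle_dist_mult g[OF x0] by metis
  then have a2: "\<bar>a x2 + pi/2\<bar> \<le> 1/5"
    using circle_dist_cis[of "a x2" "-(pi/2)"] circle_dist_cis'[of "a x2" "-(pi/2)"] ra[of x2] pi by argo
  have ca: "\<bar>c x\<bar> \<le> \<bar>a x\<bar> + \<delta>" and ac: "\<bar>a x\<bar> \<le> \<bar>c x\<bar> + 2 * \<delta>" if "x \<in> Y" for x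
    using d1[OF that x0] d2[OF that x0] unfolding circle_dist_def a_def c_def by auto
  note hyps = \<delta> ca ac x1(1) a1 x2(1) a2 d1[unfolded cdg cdf] d2[unfolded cdg cdf]
  show ?thesis
  proof (cases "0 \<le> c x1")
    case True
    have "circle_dist (f x) (f x0 / g x0 * g x) \<le> 3 * \<delta>" if x: "x \<in> Y" for x
    proof -
      have "circle_dist (cis (c x)) (cis (a x)) \<le> 3 * \<delta>"
        using True x ra rc cdf cdg d1 d2
        by (intro near_isometry_real[where Y = Y and ?x1.0 = x1 and ?x2.0 = x2] hyps)
           (auto simp: abs_le_iff less_imp_le minus_le_iff)
      moreover have "f x0 / g x0 * g x = f x0 * cis (a x)"
        by (subst ga[OF x]) (use g[OF x0] in auto)
      ultimately show ?thesis using fc[OF x] circle_dist_mult f[OF x0] by metis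
    qed
    moreover have "norm (f x0 / g x0) = 1" using f[OF x0] g[OF x0] by (simp add: norm_divide)
    ultimately show ?thesis unfolding isometric_within_def by blast
  next
    case False
    have "circle_dist (f x) (f x0 * g x0 * cnj (g x)) \<le> 3 * \<delta>" if x: "x \<in> Y" for x
    proof -
      have "circle_dist (cis (- c x)) (cis (a x)) \<le> 3 * \<delta>"
        using False x ra rc cdf cdg d1 d2
        by (intro near_isometry_real[where Y = Y and c = "\<lambda>x. - c x" and ?x1.0 = x1 and ?x2.0 = x2])
           (use hyps in \<open>auto simp: abs_le_iff less_imp_le minus_le_iff cm\<close>)
      then have "circle_dist (cis (c x)) (cis (- a x)) \<le> 3 * \<delta>"
        by (metis cm minus_minus)
      moreover have "f x0 * g x0 * cnj (g x) = f x0 * cis (- a x)"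
      proof -
        have "g x0 * cnj (g x0) = 1" using g[OF x0] by (simp add: complex_norm_square[symmetric])
        then show ?thesis by (subst ga[OF x]) (simp add: cis_cnj ac_simps)
      qed
      ultimately show ?thesis using fc[OF x] circle_dist_mult f[OF x0] by metis
    qed
    moreover have "norm (f x0 * g x0) = 1" using f[OF x0] g[OF x0] by (simp add: norm_mult)
    ultimately show ?thesis unfolding isometric_within_def by blast
  qed
qed

section \<open>Comparison of local trivializations over a common overlap\<close>

lemma SUP_ennreal_leD:
  assumes "(SUP x\<in>A. ennreal (h x)) \<le> ennreal c" "x \<in> A" "0 \<le> c"
  shows "h x \<le> c"
proof -
  have "ennreal (h x) \<le> ennreal c" using assms(1,2) by (meson SUP_le_iff)
  then show ?thesis using assms(3) by (simp add: ennreal_le_iff)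
qed

text \<open>The maximum metric dominates its circle term, and its base term is at most
  \<open>D\<close>; this gives the two comparisons with the metric of the total space. Density of
  the circle coordinates comes from \<open>\<psi>\<close>, which moves base points by at most
  \<beta>/2 and so stays over a set containing the closed ball of radius \<beta>.\<close>

lemma approx_local_trivializationD:
  assumes triv: "approx_local_trivialization r \<beta> \<epsilon> \<pi> U r0 \<phi>"
    and diam: "\<forall>b\<in>U. \<forall>b'\<in>U. dist b b' \<le> D"
  shows "\<And>x. x \<in> \<pi> -` U \<Longrightarrow> norm (snd (\<phi> x)) = 1"
    and "\<And>x y. x \<in> \<pi> -` U \<Longrightarrow> y \<in> \<pi> -` U \<Longrightarrow>
      r0 * circle_dist (snd (\<phi> x)) (snd (\<phi> y)) \<le> dist x y + \<epsilon>"
    and "\<And>x y. x \<in> \<pi> -` U \<Longrightarrow> y \<in> \<pi> -` U \<Longrightarrow>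
      dist x y \<le> r0 * circle_dist (snd (\<phi> x)) (snd (\<phi> y)) + D + \<epsilon>"
    and "\<And>x z V. cball (\<pi> x) \<beta> \<subseteq> V \<Longrightarrow> V \<subseteq> U \<Longrightarrow> norm z = 1 \<Longrightarrow>
      \<exists>y \<in> \<pi> -` V. r0 * circle_dist (snd (\<phi> y)) z \<le> \<epsilon>"
proof -
  note T = triv[unfolded approx_local_trivialization_def approx_bundle_map_def]
  have nn: "0 \<le> \<beta>" "0 \<le> \<epsilon>" using T by auto
  have "0 \<le> 16 / pi * (\<epsilon> + \<beta>)" using nn by simp
  then have r0: "0 < r0" using T by linarith
  have ran: "\<phi> \<in> \<pi> -` U \<rightarrow> U \<times> sphere 0 1" using T by blast
  obtain \<psi> where \<psi>: "\<psi> \<in> U \<times> sphere 0 1 \<rightarrow> \<pi> -` U"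
    and ds: "distortion (\<pi> -` U) dist (prod_circle_dist r0) \<phi> \<le> ennreal \<epsilon>"
    and cds: "codistortion (\<pi> -` U) dist (U \<times> sphere 0 1) (prod_circle_dist r0) \<phi> \<psi> \<le> ennreal \<epsilon>"
    and bds: "(SUP x'\<in>U \<times> sphere 0 1. ennreal (dist (fst x') (\<pi> (\<psi> x')))) \<le> ennreal (\<beta> / 2)"
    using T by auto
  show unit: "norm (snd (\<phi> x)) = 1" if "x \<in> \<pi> -` U" for x
    using funcset_mem[OF ran that] by auto
  have d: "\<bar>prod_circle_dist r0 (\<phi> x) (\<phi> y) - dist x y\<bar> \<le> \<epsilon>" if "x \<in> \<pi> -` U" "y \<in> \<pi> -` U" for x y
    using SUP_ennreal_leD[of "\<lambda>(x, y). \<bar>prod_circle_dist r0 (\<phi> x) (\<phi> y) - dist x y\<bar>"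
        "(\<pi> -` U) \<times> (\<pi> -` U)" \<epsilon> "(x, y)"] ds that nn
    unfolding distortion_def by (simp add: case_prod_unfold)
  show "r0 * circle_dist (snd (\<phi> x)) (snd (\<phi> y)) \<le> dist x y + \<epsilon>" if "x \<in> \<pi> -` U" "y \<in> \<pi> -` U" for x y
    using d[OF that] unfolding prod_circle_dist_def by linarith
  show "dist x y \<le> r0 * circle_dist (snd (\<phi> x)) (snd (\<phi> y)) + D + \<epsilon>"
    if "x \<in> \<pi> -` U" "y \<in> \<pi> -` U" for x y
  proof -
    have "dist (fst (\<phi> x)) (fst (\<phi> y)) \<le> D"
      using funcset_mem[OF ran that(1)] funcset_mem[OF ran that(2)] by (intro diam[rule_format]) auto
    moreover have "0 \<le> D" using diam[rule_format, of "\<pi> x" "\<pi> x"] that by simp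
    moreover have "0 \<le> r0 * circle_dist (snd (\<phi> x)) (snd (\<phi> y))" using r0 circle_dist_nonneg by simp
    ultimately show ?thesis using d[OF that] unfolding prod_circle_dist_def by linarith
  qed
  show "\<exists>y \<in> \<pi> -` V. r0 * circle_dist (snd (\<phi> y)) z \<le> \<epsilon>"
    if V: "cball (\<pi> x) \<beta> \<subseteq> V" "V \<subseteq> U" and z: "norm z = 1" for x z V
  proof
    let ?y = "\<psi> (\<pi> x, z)"
    have "\<pi> x \<in> V" using V(1) nn by (auto simp: subset_iff)
    then have p: "(\<pi> x, z) \<in> U \<times> sphere 0 1" using V z by auto
    have "dist (\<pi> x) (\<pi> ?y) \<le> \<beta> / 2" using SUP_ennreal_leD[OF bds p] nn by simp
    then have "\<pi> ?y \<in> cball (\<pi> x) \<beta>" using nn by simp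
    then show "?y \<in> \<pi> -` V" using V by auto
    have y: "?y \<in> \<pi> -` U" using funcset_mem[OF \<psi> p] .
    \<comment> \<open>The first argument of the codistortion is itself the image under
      \<open>\<psi>\<close>, so the subtracted distance vanishes.\<close>
    have "\<bar>prod_circle_dist r0 (\<phi> ?y) (\<pi> x, z) - dist ?y (\<psi> (\<pi> x, z))\<bar> \<le> \<epsilon>"
      using SUP_ennreal_leD[of "\<lambda>(x, y). \<bar>prod_circle_dist r0 (\<phi> x) y - dist x (\<psi> y)\<bar>"
        "(\<pi> -` U) \<times> (U \<times> sphere 0 1)" \<epsilon> "(?y, (\<pi> x, z))"] cds y p nn
      unfolding codistortion_def by (simp add: case_prod_unfold)
    then show "r0 * circle_dist (snd (\<phi> ?y)) z \<le> \<epsilon>"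
      unfolding prod_circle_dist_def by simp
  qed
qed

text \<open>Comparing antipodal points bounds the difference of the two radii, which turns the
  one-sided comparison of the metrics into the two-sided one.\<close>

lemma trivializations_near_isometric_ordered:
  fixes \<pi> :: "'x::metric_space \<Rightarrow> 'b::metric_space"
  assumes f: "approx_local_trivialization r \<beta> \<epsilon> \<pi> U1 r1 \<phi>1"
    and g: "approx_local_trivialization r \<beta> \<epsilon> \<pi> U2 r2 \<phi>2"
    and diam1: "\<forall>b\<in>U1. \<forall>b'\<in>U1. dist b b' \<le> D"
    and diam2: "\<forall>b\<in>U2. \<forall>b'\<in>U2. dist b b' \<le> D"
    and x: "cball (\<pi> x) \<beta> \<subseteq> U1 \<inter> U2"
    and \<delta>: "(D + 10 * \<epsilon>) / r \<le> \<delta>" "\<delta> \<le> 1/20" and le: "r2 \<le> r1"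
  shows "isometric_within (3 * \<delta>) (\<pi> -` (U1 \<inter> U2)) (snd \<circ> \<phi>1) (snd \<circ> \<phi>2)"
proof (rule near_isometry; (unfold comp_apply)?)
  note F = approx_local_trivializationD[OF f diam1]
  note G = approx_local_trivializationD[OF g diam2]
  note T = g[unfolded approx_local_trivialization_def]
  have nn: "0 \<le> \<beta>" "0 \<le> \<epsilon>" "r \<le> r2" using T by auto
  have "0 \<le> 16 / pi * (\<epsilon> + \<beta>)" using nn by simp
  then have r: "0 < r" using T by linarith
  have xU: "\<pi> x \<in> U1 \<inter> U2" using x nn by (auto simp: subset_iff)
  have D: "0 \<le> D" using diam1[rule_format, of "\<pi> x" "\<pi> x"] xU by simp
  have rd: "D + 10 * \<epsilon> \<le> r * \<delta>" using \<delta>(1) r by (simp add: pos_divide_le_eq mult.commute)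
  show "0 \<le> \<delta>" using \<delta>(1) D nn r by (smt (verit) divide_nonneg_pos)
  show "\<delta> \<le> 1/20" by (rule \<delta>)
  show "norm (snd (\<phi>1 x)) = 1" if "x \<in> \<pi> -` (U1 \<inter> U2)" for x using F(1) that by auto
  show "norm (snd (\<phi>2 x)) = 1" if "x \<in> \<pi> -` (U1 \<inter> U2)" for x using G(1) that by auto
  let ?f = "\<lambda>x y. circle_dist (snd (\<phi>1 x)) (snd (\<phi>1 y))"
  let ?g = "\<lambda>x y. circle_dist (snd (\<phi>2 x)) (snd (\<phi>2 y))"
  have fg: "r1 * ?f x y \<le> r2 * ?g x y + D + 2 * \<epsilon>" 
   and gf: "r2 * ?g x y \<le> r1 * ?f x y + D + 2 * \<epsilon>"
    if "x \<in> \<pi> -` (U1 \<inter> U2)" "y \<in> \<pi> -` (U1 \<inter> U2)" for x y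
    using F(2,3)[of x y] G(2,3)[of x y] that by auto
  show "?f x y \<le> ?g x y + \<delta>" if "x \<in> \<pi> -` (U1 \<inter> U2)" "y \<in> \<pi> -` (U1 \<inter> U2)" for x y
  proof -
    \<comment> \<open>Since \<open>r2 \<le> r1\<close>, the radius on the right may be enlarged at
      no cost. This is the reason for ordering the radii.\<close>
    have "r1 * ?f x y \<le> r1 * ?g x y + r1 * \<delta>"
      using fg[OF that] rd nn mult_right_mono[OF le circle_dist_nonneg] \<open>0 \<le> \<delta>\<close>
        mult_right_mono[of r r1 \<delta>] le by (smt (verit))
    then have "r1 * ?f x y \<le> r1 * (?g x y + \<delta>)" by (simp add: distrib_left)
    then show ?thesis using r nn le by simp
  qed
  obtain y1 where y1: "y1 \<in> \<pi> -` (U1 \<inter> U2)" "r1 * circle_dist (snd (\<phi>1 y1)) 1 \<le> \<epsilon>"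
    using F(4)[OF x, of 1] by auto
  obtain y2 where y2: "y2 \<in> \<pi> -` (U1 \<inter> U2)" "r1 * circle_dist (snd (\<phi>1 y2)) (- 1) \<le> \<epsilon>"
    using F(4)[OF x, of "-1"] by auto
  have n: "norm (snd (\<phi>1 y1)) = 1" "norm (snd (\<phi>1 y2)) = 1" using F(1) y1 y2 by auto
  have "pi = circle_dist 1 (- 1)" using circle_dist_cis[of 0 pi] by simp
  also have "\<dots> \<le> circle_dist 1 (snd (\<phi>1 y1)) + (?f y1 y2 + circle_dist (snd (\<phi>1 y2)) (- 1))"
    using circle_dist_triangle[of 1 "snd (\<phi>1 y1)" "-1"]
      circle_dist_triangle[of "snd (\<phi>1 y1)" "snd (\<phi>1 y2)" "-1"] n by simp
  finally have "r1 * pi \<le> r1 * circle_dist (snd (\<phi>1 y1)) 1 + r1 * ?f y1 y2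
      + r1 * circle_dist (snd (\<phi>1 y2)) (- 1)"
    using circle_dist_commute[of 1 "snd (\<phi>1 y1)"] n r le nn
    by (simp add: distrib_left[symmetric] add.assoc)
  also have "\<dots> \<le> \<epsilon> + (r2 * pi + D + 2 * \<epsilon>) + \<epsilon>"
    using y1(2) y2(2) fg[OF y1(1) y2(1)] mult_left_mono[OF circle_dist_le_pi, of r2] nn r by (smt (verit))
  finally have radii: "(r1 - r2) * pi \<le> D + 4 * \<epsilon>" by (simp add: left_diff_distrib)
  show "?g x y \<le> ?f x y + 2 * \<delta>" if "x \<in> \<pi> -` (U1 \<inter> U2)" "y \<in> \<pi> -` (U1 \<inter> U2)" for x y
  proof -
    \<comment> \<open>Replacing \<open>r1\<close> by \<open>r2\<close> costs at most D + 4
      \<epsilon> by the antipodal comparison, in addition to D + 2 \<epsilon>; hence the doubled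
      error in this direction.\<close>
    have "(r1 - r2) * ?f x y \<le> (r1 - r2) * pi" using le by (intro mult_left_mono circle_dist_le_pi) simp
    then have "r2 * ?g x y \<le> r2 * ?f x y + 2 * (r * \<delta>)"
      using gf[OF that] radii rd nn by (simp add: left_diff_distrib)
    also have "\<dots> \<le> r2 * (?f x y + 2 * \<delta>)"
      using mult_right_mono[OF nn(3) \<open>0 \<le> \<delta>\<close>] by (simp add: distrib_left)
    finally show ?thesis using r nn by simp
  qed
  fix z :: complex assume "norm z = 1"
  then obtain y where y: "y \<in> \<pi> -` (U1 \<inter> U2)" "r2 * circle_dist (snd (\<phi>2 y)) z \<le> \<epsilon>"
    using G(4)[OF x, of z] by auto
  have "r * circle_dist (snd (\<phi>2 y)) z \<le> r * (1/20)"
    using y(2) nn rd D mult_right_mono[OF nn(3) circle_dist_nonneg] mult_left_mono[OF \<delta>(2), of r] r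
    by (smt (verit))
  then have "circle_dist (snd (\<phi>2 y)) z \<le> 1/20" using r by simp
  then show "\<exists>x\<in>\<pi> -` (U1 \<inter> U2). circle_dist (snd (\<phi>2 x)) z \<le> 1/5" using y by (intro bexI[of _ y]) auto
qed

text \<open>The inverse of multiplication by \<open>u\<close> is multiplication by
  \<open>cnj u\<close>, whereas the reflection sending z to \<open>u * cnj z\<close> is its own
  inverse.\<close>

lemma isometric_within_sym:
  assumes n: "\<And>x. x \<in> Y \<Longrightarrow> norm (f x) = 1" "\<And>x. x \<in> Y \<Longrightarrow> norm (g x) = 1"
    and "isometric_within e Y g f"
  shows "isometric_within e Y f g"
proof -
  obtain u where u: "norm u = 1"
    "(\<forall>x\<in>Y. circle_dist (g x) (u * f x) \<le> e) \<or> (\<forall>x\<in>Y. circle_dist (g x) (u * cnj (f x)) \<le> e)"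
    using assms(3) unfolding isometric_within_def by blast
  have uu: "cnj u * u = 1" using u(1) by (simp add: complex_norm_square[symmetric] mult.commute)
  from u(2) show ?thesis
  proof
    assume A: "\<forall>x\<in>Y. circle_dist (g x) (u * f x) \<le> e"
    have "circle_dist (f x) (cnj u * g x) \<le> e" if "x \<in> Y" for x
    proof -
      have "circle_dist (cnj u * g x) (cnj u * (u * f x)) \<le> e"
        using A that u(1) by (simp add: circle_dist_mult)
      also have "cnj u * (u * f x) = f x" by (metis mult.assoc mult_1 uu)
      finally show ?thesis using circle_dist_commute[of "f x" "cnj u * g x"] n[OF that] u(1)
        by (simp add: norm_mult)
    qed
    then show ?thesis using u(1) unfolding isometric_within_def by (metis complex_mod_cnj)
  next
    assume A: "\<forall>x\<in>Y. circle_dist (g x) (u * cnj (f x)) \<le> e"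
    have "circle_dist (f x) (u * cnj (g x)) \<le> e" if "x \<in> Y" for x
    proof -
      have "circle_dist (u * cnj (g x)) (u * cnj (u * cnj (f x))) \<le> e"
        using A that u(1) n[OF that] by (simp only: circle_dist_mult) (subst circle_dist_cnj, auto simp: norm_mult)
      also have "u * cnj (u * cnj (f x)) = f x" using uu by (simp add: ac_simps)
      finally show ?thesis using circle_dist_commute[of "f x" "u * cnj (g x)"] n[OF that] u(1)
        by (simp add: norm_mult)
    qed
    then show ?thesis using u(1) unfolding isometric_within_def by blast
  qed
qed

lemma trivializations_near_isometric:
  fixes \<pi> :: "'x::metric_space \<Rightarrow> 'b::metric_space"
  assumes f: "approx_local_trivialization r \<beta> \<epsilon> \<pi> U1 r1 \<phi>1"
    and g: "approx_local_trivialization r \<beta> \<epsilon> \<pi> U2 r2 \<phi>2"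
    and diam1: "\<forall>b\<in>U1. \<forall>b'\<in>U1. dist b b' \<le> D" and diam2: "\<forall>b\<in>U2. \<forall>b'\<in>U2. dist b b' \<le> D"
    and x: "cball (\<pi> x) \<beta> \<subseteq> U1 \<inter> U2" and \<delta>: "(D + 10 * \<epsilon>) / r \<le> \<delta>" "\<delta> \<le> 1/20"
  shows "isometric_within (3 * \<delta>) (\<pi> -` (U1 \<inter> U2)) (snd \<circ> \<phi>1) (snd \<circ> \<phi>2)"
proof (cases "r2 \<le> r1")
  case True
  then show ?thesis by (rule trivializations_near_isometric_ordered[OF f g diam1 diam2 x \<delta>])
next
  case False
  then have iso: "isometric_within (3 * \<delta>) (\<pi> -` (U1 \<inter> U2)) (snd \<circ> \<phi>2) (snd \<circ> \<phi>1)"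
    using trivializations_near_isometric_ordered[OF g f diam2 diam1 x[unfolded Int_commute[of U1]] \<delta>]
    unfolding Int_commute[of U2] by simp
  show ?thesis
    using approx_local_trivializationD(1)[OF f diam1] approx_local_trivializationD(1)[OF g diam2]
    by (intro isometric_within_sym[OF _ _ iso]) auto
qed

section \<open>Witnesses\<close>

lemma vector2_eq_iff: "(v :: real^2) = w \<longleftrightarrow> v $ 1 = w $ 1 \<and> v $ 2 = w $ 2"
  by (simp add: vec_eq_iff forall_2)

lemma c2v_nth [simp]: "c2v z $ 1 = Re z" "c2v z $ 2 = Im z"
  by (simp_all add: c2v_def)

lemma c2v_diff: "c2v (z - w) = c2v z - c2v w"
  by (simp add: vector2_eq_iff)

lemma norm_vec2: "(norm (v :: real^2))\<^sup>2 = (v $ 1)\<^sup>2 + (v $ 2)\<^sup>2"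
  by (simp add: power2_norm_eq_inner inner_vec_def sum_2) (simp add: power2_eq_square)

lemma norm_c2v [simp]: "norm (c2v z) = norm z"
  by (rule power2_eq_imp_eq) (simp_all add: norm_vec2 cmod_power2)

lemma rot_mult_c2v: "rot \<theta> *v c2v z = c2v (cis \<theta> * z)"
  by (simp add: vector2_eq_iff matrix_vector_mult_def sum_2 rot_def)

lemma refl2_mult_c2v: "refl2 *v c2v z = c2v (cnj z)"
  by (simp add: vector2_eq_iff matrix_vector_mult_def sum_2 refl2_def)

lemma rot_refl2_mult_c2v: "(rot \<theta> ** refl2) *v c2v z = c2v (cis \<theta> * cnj z)"
  by (simp add: matrix_vector_mul_assoc[symmetric] rot_mult_c2v refl2_mult_c2v)

lemma orthogonal_matrix_2_iff:
  "orthogonal_matrix (A :: real^2^2) \<longleftrightarrow>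
    (A$1$1)\<^sup>2 + (A$2$1)\<^sup>2 = 1 \<and> (A$1$2)\<^sup>2 + (A$2$2)\<^sup>2 = 1 \<and> A$1$1 * A$1$2 + A$2$1 * A$2$2 = 0"
  unfolding orthogonal_matrix
  by (auto simp: vec_eq_iff forall_2 matrix_matrix_mult_def sum_2 transpose_def mat_def power2_eq_square mult.commute)

lemma orthogonal_rot: "orthogonal_matrix (rot \<theta>)"
  by (simp add: orthogonal_matrix_2_iff rot_def)

lemma orthogonal_refl2: "orthogonal_matrix refl2"
  by (simp add: orthogonal_matrix_2_iff refl2_def)

lemma norm_orthogonal_matrix_mult: "orthogonal_matrix A \<Longrightarrow> norm (A *v x) = norm (x :: real^'n)"
  by (metis orthogonal_transformation orthogonal_transformation_matrix matrix_of_matrix_vector_mul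
      matrix_vector_mul_linear)

lemma orthogonal_matrix_transpose_mult:
  "orthogonal_matrix A \<Longrightarrow> transpose A ** A = mat 1" "orthogonal_matrix A \<Longrightarrow> A ** transpose A = mat 1"
  by (simp_all add: orthogonal_matrix_def)

lemma orthogonal_matrix_transpose_iff: "orthogonal_matrix A \<Longrightarrow> orthogonal_matrix (transpose A)"
  by (simp add: orthogonal_matrix_def)

text \<open>Orthonormality makes the second column the determinant \<open>?t\<close> times the
  quarter turn of the first, and \<open>?t\<close> squares to one. The two cases are the rotations
  and the reflections.\<close>

lemma orthogonal_2_cases:
  assumes "orthogonal_matrix (C :: real^2^2)"
  shows "C$2$2 = C$1$1 \<and> C$1$2 = - C$2$1 \<or> C$2$2 = - C$1$1 \<and> C$1$2 = C$2$1"
proof -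
  let ?a = "C$1$1" and ?b = "C$1$2" and ?c = "C$2$1" and ?d = "C$2$2"
  have C: "?a\<^sup>2 + ?c\<^sup>2 = 1" "?b\<^sup>2 + ?d\<^sup>2 = 1" "?a * ?b + ?c * ?d = 0"
    using assms by (auto simp: orthogonal_matrix_2_iff)
  let ?t = "?a * ?d - ?b * ?c"
  have d: "?d = ?t * ?a" "?b = - ?t * ?c" using C by algebra+
  have "?t\<^sup>2 = 1" using C by algebra
  then consider "?t = 1" | "?t = -1" by (auto simp: power2_eq_1_iff)
  then show ?thesis
  proof cases
    case 1 then show ?thesis using d unfolding 1 by simp
  next
    case 2 then show ?thesis using d unfolding 2 by simp
  qed
qed

text \<open>If the determinants agree, \<open>A - B\<close> is conformal; otherwise \<open>A\<close> and \<open>B\<close> are opposite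
  on some vector.\<close>

lemma orthogonal_matrices_close:
  fixes A B :: "real^2^2"
  assumes A: "orthogonal_matrix A" and B: "orthogonal_matrix B"
    and Z: "\<And>z. z \<in> Z \<Longrightarrow> norm z = 1" "\<And>z. z \<in> Z \<Longrightarrow> norm (A *v c2v z - B *v c2v z) \<le> c"
    and dense: "\<And>z. norm z = 1 \<Longrightarrow> \<exists>w\<in>Z. norm (w - z) \<le> \<zeta>"
    and lt: "c + 2 * \<zeta> < 2"
  shows "norm ((A - B) *v v) \<le> c * norm v" and "norm (A - B) \<le> sqrt 2 * c"
proof -
  \<comment> \<open>As \<open>A\<close> is an isometry, comparing \<open>A\<close> with
    \<open>B\<close> amounts to comparing the identity with \<open>C\<close>.\<close>
  define C where "C = transpose A ** B"
  have C: "orthogonal_matrix C"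
    using A B by (simp add: C_def orthogonal_matrix_mul orthogonal_matrix_transpose_iff)
  have AC: "A ** C = B"
    using A by (simp add: C_def matrix_mul_assoc orthogonal_matrix_transpose_mult)
  have eq: "norm (A *v v - B *v v) = norm (v - C *v v)" for v
  proof -
    have "A *v v - B *v v = A *v (v - C *v v)"
      by (simp add: matrix_vector_mult_diff_distrib matrix_vector_mul_assoc AC)
    then show ?thesis using A by (simp add: norm_orthogonal_matrix_mult)
  qed
  obtain z0 where z0: "z0 \<in> Z" using dense[of 1] by auto
  have c0: "0 \<le> c" using Z(2)[OF z0] norm_ge_zero order_trans by blast
  have rot: "C$2$2 = C$1$1 \<and> C$1$2 = - C$2$1"
  proof (rule ccontr)
    assume "\<not> ?thesis"
    then have d: "C$2$2 = - C$1$1" "C$1$2 = C$2$1" using orthogonal_2_cases[OF C] by auto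
    have u: "(C$1$1)\<^sup>2 + (C$2$1)\<^sup>2 = 1" using C by (simp add: orthogonal_matrix_2_iff)
    define t where "t = Arg (Complex (C$1$1) (C$2$1))"
    have "norm (Complex (C$1$1) (C$2$1)) = 1" using u by (simp add: cmod_def)
    then have "cis t = Complex (C$1$1) (C$2$1)" by (simp add: t_def cis_Arg_unit)
    then have t: "C$1$1 = cos t" "C$2$1 = sin t" by (metis cis.simps complex.sel)+
    \<comment> \<open>\<open>C\<close> would be the reflection whose axis has angle t/2, so the
      perpendicular direction is an eigenvector for -1. There \<open>A\<close> and \<open>B\<close>
      differ by 2, and moving to a nearby point of \<open>Z\<close> changes each image by at most
      \<zeta>.\<close>
    define z where "z = cis (t/2 + pi/2)"
    have cs: "cos t = (cos (t/2))\<^sup>2 - (sin (t/2))\<^sup>2" "sin t = 2 * sin (t/2) * cos (t/2)"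
      using cos_double[of "t/2"] sin_double[of "t/2"] by simp_all
    have "C *v c2v z = - c2v z"
    proof -
      have id: "2 * x * y * y - (y\<^sup>2 - x\<^sup>2) * x = x" "(x\<^sup>2 - y\<^sup>2) * y - 2 * x * y * x = - y"
        if "x\<^sup>2 + y\<^sup>2 = 1" for x y :: real using that by algebra+
      show ?thesis using id[OF sin_cos_squared_add[of "t/2"]]
        by (simp add: vector2_eq_iff matrix_vector_mult_def sum_2 d t z_def cos_add sin_add cs)
    qed
    then have "c2v z - C *v c2v z = 2 *\<^sub>R c2v z" by (simp add: vector2_eq_iff)
    then have "norm (A *v c2v z - B *v c2v z) = 2" 
      unfolding eq by (simp add: z_def)
    obtain w where w: "w \<in> Z" "norm (w - z) \<le> \<zeta>" using dense[of z] by (auto simp: z_def)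
    have "norm (A *v c2v z - A *v c2v w) \<le> \<zeta>" "norm (B *v c2v z - B *v c2v w) \<le> \<zeta>"
      using w(2) A B
      by (simp_all add: matrix_vector_mult_diff_distrib[symmetric] norm_orthogonal_matrix_mult
          c2v_diff[symmetric] norm_minus_commute)
    then have "norm (A *v c2v z - B *v c2v z) \<le> \<zeta> + c + \<zeta>"
      using Z(2)[OF w(1)] by norm
    then show False using lt \<open>_ = 2\<close> by simp
  qed
  have sq: "(norm (v - C *v v))\<^sup>2 = ((1 - C$1$1)\<^sup>2 + (C$2$1)\<^sup>2) * (norm v)\<^sup>2" for v
  proof -
    have id: "(x - (a * x + - c * y))\<^sup>2 + (y - (c * x + a * y))\<^sup>2 = ((1 - a)\<^sup>2 + c\<^sup>2) * (x\<^sup>2 + y\<^sup>2)"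
      for a c x y :: real by algebra
    have "(C *v v) $ 1 = C$1$1 * v$1 + - C$2$1 * v$2" "(C *v v) $ 2 = C$2$1 * v$1 + C$1$1 * v$2"
      using rot by (simp_all add: matrix_vector_mult_def sum_2)
    then show ?thesis by (simp only: norm_vec2 vector_minus_component id)
  qed
  define k where "k = (1 - C$1$1)\<^sup>2 + (C$2$1)\<^sup>2"
  have "(norm (A *v c2v z0 - B *v c2v z0))\<^sup>2 = k"
    unfolding eq sq k_def by (simp add: Z(1)[OF z0])
  then have k: "k \<le> c\<^sup>2" using power_mono[OF Z(2)[OF z0], of 2] by simp
  have le: "(norm ((A - B) *v v))\<^sup>2 = k * (norm v)\<^sup>2" for v
    using eq[of v] sq[of v] by (simp add: matrix_vector_mult_diff_rdistrib k_def)
  have "(norm ((A - B) *v v))\<^sup>2 \<le> c\<^sup>2 * (norm v)\<^sup>2"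
    unfolding le by (rule mult_right_mono[OF k]) simp
  then show "norm ((A - B) *v v) \<le> c * norm v"
    using c0 power2_le_imp_le[of "norm ((A - B) *v v)" "c * norm v"] by (simp add: power_mult_distrib)
  \<comment> \<open>The Frobenius norm adds the squares over two basis vectors, both stretched by
    the same factor; this is the origin of sqrt 2.\<close>
  have "(norm (A - B))\<^sup>2 = (norm ((A - B) *v axis 1 1))\<^sup>2 + (norm ((A - B) *v axis 2 1))\<^sup>2"
    unfolding norm_vec2 by (simp add: power2_norm_eq_inner inner_vec_def sum_2 matrix_vector_mult_def axis_def)
      (simp add: power2_eq_square)
  also have "\<dots> = 2 * k" unfolding le by simp
  also have "\<dots> \<le> (sqrt 2 * c)\<^sup>2" using k by (simp add: power_mult_distrib)
  finally show "norm (A - B) \<le> sqrt 2 * c" using c0 power2_le_imp_le[of "norm (A - B)" "sqrt 2 * c"] by simp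
qed

section \<open>Existence and optimality of witnesses\<close>

lemma wit_pair_nonempty:
  assumes "Y \<noteq> {}" "\<And>x. x \<in> Y \<Longrightarrow> norm (f x) = 1" "\<And>x. x \<in> Y \<Longrightarrow> norm (g x) = 1"
  shows "wit_pair Y f g \<noteq> {}"
proof -
  have "\<exists>\<theta>. shortest_arc_midpoint ((\<lambda>x. f x / g x) ` Y) \<theta>"
    "\<exists>\<theta>. shortest_arc_midpoint ((\<lambda>x. f x * g x) ` Y) \<theta>"
    using assms by (auto intro!: shortest_arc_midpoint_exists simp: norm_divide norm_mult)
  then show ?thesis unfolding wit_pair_def by blast
qed

lemma orthogonal_wit_pair: "W \<in> wit_pair Y f g \<Longrightarrow> orthogonal_matrix W"
  by (auto simp: wit_pair_def orthogonal_rot orthogonal_refl2 orthogonal_matrix_mul split: if_splits)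

text \<open>The arc of half-length \<open>e\<close> around \<open>u\<close> covers \<open>S\<close>,
  so a shortest arc has half-length at most \<open>e\<close>. The unknown center \<open>u\<close> is
  thus replaced by the computed midpoint without loss in the bound.\<close>

lemma shortest_arc_midpoint_le:
  assumes "shortest_arc_midpoint S \<theta>" "norm u = 1" "\<And>s. s \<in> S \<Longrightarrow> norm s = 1"
    and e: "0 \<le> e" "\<And>s. s \<in> S \<Longrightarrow> circle_dist s u \<le> e" and s: "s \<in> S"
  shows "norm (s - cis \<theta>) \<le> e"
proof -
  obtain h where h: "0 \<le> h" "S \<subseteq> circle_arc \<theta> h"
    "\<And>\<theta>' h'. 0 \<le> h' \<Longrightarrow> S \<subseteq> circle_arc \<theta>' h' \<Longrightarrow> h \<le> h'"
    using assms(1) unfolding shortest_arc_midpoint_def by blast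
  have "S \<subseteq> circle_arc (Arg u) e"
    using assms by (auto simp: circle_arc_eq cis_Arg_unit)
  then have "h \<le> e" using h(3) e(1) by blast
  moreover have "circle_dist s (cis \<theta>) \<le> h" using h(1,2) s by (auto simp: circle_arc_eq)
  ultimately show ?thesis using norm_diff_le_circle_dist[of s "cis \<theta>"] assms(3)[OF s] by simp
qed

text \<open>Whether the nearby isometry is a rotation or a reflection, the midpoint of the
  corresponding arc achieves the same bound \<open>e\<close>. Hence one of the two suprema is at
  most \<open>e\<close>, and the witness is the candidate with the smaller supremum.\<close>

lemma wit_pair_close:
  assumes W: "W \<in> wit_pair Y f g" and Y: "Y \<noteq> {}"
    and f: "\<And>x. x \<in> Y \<Longrightarrow> norm (f x) = 1" and g: "\<And>x. x \<in> Y \<Longrightarrow> norm (g x) = 1"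
    and e: "0 \<le> e" and iso: "isometric_within e Y f g" and x: "x \<in> Y"
  shows "norm (c2v (f x) - W *v c2v (g x)) \<le> e"
proof -
  obtain u where u: "norm u = 1"
    and close: "(\<forall>x\<in>Y. circle_dist (f x) (u * g x) \<le> e) \<or> (\<forall>x\<in>Y. circle_dist (f x) (u * cnj (g x)) \<le> e)"
    using iso unfolding isometric_within_def by blast
  obtain \<theta> \<theta>' where
    m: "shortest_arc_midpoint ((\<lambda>x. f x / g x) ` Y) \<theta>" and m': "shortest_arc_midpoint ((\<lambda>x. f x * g x) ` Y) \<theta>'"
    and W: "W = (if (SUP x\<in>Y. norm (c2v (f x) - rot \<theta> *v c2v (g x)))
                < (SUP x\<in>Y. norm (c2v (f x) - (rot \<theta>' ** refl2) *v c2v (g x)))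
             then rot \<theta> else rot \<theta>' ** refl2)" (is "W = (if ?d < ?d' then _ else _)")
    using W unfolding wit_pair_def by blast
  have gn: "g x \<noteq> 0" "cnj (g x) * g x = 1" if "x \<in> Y" for x
    using g[OF that] by (auto simp: complex_norm_square[symmetric] mult.commute)
  have n: "norm (c2v (f x) - rot \<theta> *v c2v (g x)) = norm (f x - cis \<theta> * g x)"
    "norm (c2v (f x) - (rot \<theta>' ** refl2) *v c2v (g x)) = norm (f x - cis \<theta>' * cnj (g x))" for x
    by (simp_all only: rot_mult_c2v rot_refl2_mult_c2v c2v_diff[symmetric] norm_c2v)
  have bdd: "norm (f x - cis \<theta> * g x) \<le> 2" "norm (f x - cis \<theta>' * cnj (g x)) \<le> 2" if "x \<in> Y" for x
    using norm_triangle_ineq4[of "f x" "cis \<theta> * g x"] norm_triangle_ineq4[of "f x" "cis \<theta>' * cnj (g x)"]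
      f[OF that] g[OF that] by (simp_all add: norm_mult)
  have up: "norm (f x - cis \<theta> * g x) \<le> ?d" "norm (f x - cis \<theta>' * cnj (g x)) \<le> ?d'" if "x \<in> Y" for x
    unfolding n by (rule cSUP_upper[OF that], rule bdd_aboveI2[of _ _ 2], rule bdd, assumption)+
  from close have "?d \<le> e \<or> ?d' \<le> e"
  proof
    assume A: "\<forall>x\<in>Y. circle_dist (f x) (u * g x) \<le> e"
    have "norm (f x - cis \<theta> * g x) \<le> e" if "x \<in> Y" for x
    proof -
      have "circle_dist (f x / g x) u \<le> e" if "x \<in> Y" for x
      proof -
        have "circle_dist (f x) (u * g x) \<le> e" using A that by blast
        then show ?thesis
          using circle_dist_mult[of "g x" "f x / g x" u] g[OF that] gn[OF that] by (simp add: mult.commute)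
      qed
      then have "norm (f x / g x - cis \<theta>) \<le> e"
        using that f g by (intro shortest_arc_midpoint_le[OF m u]) (auto simp: norm_divide e)
      moreover have "f x - cis \<theta> * g x = g x * (f x / g x - cis \<theta>)" using gn[OF that] by (simp add: algebra_simps)
      ultimately show ?thesis using g[OF that] by (simp add: norm_mult)
    qed
    then show ?thesis using Y unfolding n by (intro disjI1 cSUP_least) auto
  next
    assume A: "\<forall>x\<in>Y. circle_dist (f x) (u * cnj (g x)) \<le> e"
    have "norm (f x - cis \<theta>' * cnj (g x)) \<le> e" if "x \<in> Y" for x
    proof -
      \<comment> \<open>Multiplying by \<open>g x\<close> cancels the conjugate, which is why
        reflections are detected by the products of the two maps.\<close>
      have "circle_dist (f x * g x) u \<le> e" if "x \<in> Y" for x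
        using A that circle_dist_mult[of "g x" "f x" "u * cnj (g x)"] g[OF that] gn[OF that]
        by (simp add: ac_simps)
      then have "norm (f x * g x - cis \<theta>') \<le> e"
        using that f g by (intro shortest_arc_midpoint_le[OF m' u]) (auto simp: norm_mult e)
      moreover have "f x - cis \<theta>' * cnj (g x) = cnj (g x) * (f x * g x - cis \<theta>')"
        using gn(2)[OF that] by (simp add: algebra_simps)
      ultimately show ?thesis using g[OF that] by (simp add: norm_mult)
    qed
    then show ?thesis using Y unfolding n by (intro disjI2 cSUP_least) auto
  qed
  then show ?thesis
  proof (cases "?d < ?d'")
    case True
    then have WW: "W = rot \<theta>" unfolding W by (rule if_P)
    then show ?thesis using n(1)[of x] up(1)[OF x] True \<open>?d \<le> e \<or> ?d' \<le> e\<close> unfolding WW by linarith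
  next
    case False
    then have WW: "W = rot \<theta>' ** refl2" unfolding W by (rule if_not_P)
    then show ?thesis using n(2)[of x] up(2)[OF x] False \<open>?d \<le> e \<or> ?d' \<le> e\<close> unfolding WW by linarith
  qed
qed

text \<open>Supplies the constant matrices that compare two families of trivializations over the
  same chart.\<close>

lemma orthogonal_matrix_close_exists:
  assumes f: "\<And>x. x \<in> Y \<Longrightarrow> norm (f x) = 1" and g: "\<And>x. x \<in> Y \<Longrightarrow> norm (g x) = 1"
    and iso: "isometric_within e Y f g"
  shows "\<exists>M. orthogonal_matrix M \<and> (\<forall>x\<in>Y. norm (c2v (f x) - M *v c2v (g x)) \<le> e)"
proof -
  obtain u where u: "norm u = 1"
    and close: "(\<forall>x\<in>Y. circle_dist (f x) (u * g x) \<le> e) \<or> (\<forall>x\<in>Y. circle_dist (f x) (u * cnj (g x)) \<le> e)"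
    using iso unfolding isometric_within_def by blast
  from close show ?thesis
  proof
    assume A: "\<forall>x\<in>Y. circle_dist (f x) (u * g x) \<le> e"
    have "norm (c2v (f x) - rot (Arg u) *v c2v (g x)) \<le> e" if "x \<in> Y" for x
    proof -
      have "norm (c2v (f x) - rot (Arg u) *v c2v (g x)) = norm (f x - u * g x)"
        by (simp only: rot_mult_c2v c2v_diff[symmetric] norm_c2v cis_Arg_unit[OF u])
      also have "\<dots> \<le> circle_dist (f x) (u * g x)"
        using f[OF that] g[OF that] u by (intro norm_diff_le_circle_dist) (auto simp: norm_mult)
      also have "\<dots> \<le> e" using A that by blast
      finally show ?thesis .
    qed
    then show ?thesis using orthogonal_rot by blast
  next
    assume A: "\<forall>x\<in>Y. circle_dist (f x) (u * cnj (g x)) \<le> e"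
    have "norm (c2v (f x) - (rot (Arg u) ** refl2) *v c2v (g x)) \<le> e" if "x \<in> Y" for x
    proof -
      have "norm (c2v (f x) - (rot (Arg u) ** refl2) *v c2v (g x)) = norm (f x - u * cnj (g x))"
        by (simp only: rot_refl2_mult_c2v c2v_diff[symmetric] norm_c2v cis_Arg_unit[OF u])
      also have "\<dots> \<le> circle_dist (f x) (u * cnj (g x))"
        using f[OF that] g[OF that] u by (intro norm_diff_le_circle_dist) (auto simp: norm_mult)
      also have "\<dots> \<le> e" using A that by blast
      finally show ?thesis .
    qed
    then show ?thesis using orthogonal_rot orthogonal_refl2 orthogonal_matrix_mul by blast
  qed
qed

section \<open>Finitely supported sequences\<close>

text \<open>As a type, the finitely supported sequences become an instance of
  \<open>real_inner\<close>, so that the spectral arguments can be carried out in arbitrary inner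
  product spaces.\<close>

typedef finseq = "Rinf" morphisms coords Abs_finseq
  by (rule exI[of _ "\<lambda>_. 0"]) (simp add: Rinf_def)

setup_lifting type_definition_finseq

lemma finite_support_coords: "finite {n. coords x n \<noteq> 0}"
  using coords[of x] by (simp add: Rinf_def)

lemma inner_inf_eq_sum:
  assumes "finite F" "\<And>n. n \<notin> F \<Longrightarrow> v n = 0 \<or> w n = 0"
  shows "inner_inf v w = (\<Sum>n\<in>F. v n * w n)"
  unfolding inner_inf_def using assms by (intro suminf_finite) auto

lemma inner_inf_nonzero_eq:
  assumes "finite {n. v n \<noteq> 0}"
  shows "inner_inf v w = (\<Sum>n | v n \<noteq> 0. v n * w n)"
  using assms by (intro inner_inf_eq_sum) auto

lemma finite_support_Un:
  "finite {n. v n \<noteq> (0::real)} \<Longrightarrow> finite {n. w n \<noteq> (0::real)} \<Longrightarrow> finite {n. v n \<noteq> 0 \<or> w n \<noteq> 0}"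
  by (simp add: Collect_disj_eq del: disj_not1)

instantiation finseq :: real_inner
begin

lift_definition zero_finseq :: finseq is "\<lambda>_. 0" by (simp add: Rinf_def)
lift_definition plus_finseq :: "finseq \<Rightarrow> finseq \<Rightarrow> finseq" is "\<lambda>v w n. v n + w n"
  using finite_support_Un by (fastforce simp: Rinf_def elim: rev_finite_subset)
lift_definition uminus_finseq :: "finseq \<Rightarrow> finseq" is "\<lambda>v n. - v n" by (simp add: Rinf_def)
lift_definition minus_finseq :: "finseq \<Rightarrow> finseq \<Rightarrow> finseq" is "\<lambda>v w n. v n - w n"
  using finite_support_Un by (fastforce simp: Rinf_def elim: rev_finite_subset)
lift_definition scaleR_finseq :: "real \<Rightarrow> finseq \<Rightarrow> finseq" is "\<lambda>c v n. c * v n"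
  unfolding Rinf_def by (auto elim!: rev_finite_subset)
lift_definition inner_finseq :: "finseq \<Rightarrow> finseq \<Rightarrow> real" is inner_inf .
definition norm_finseq :: "finseq \<Rightarrow> real" where "norm_finseq v = sqrt (inner v v)"
definition dist_finseq :: "finseq \<Rightarrow> finseq \<Rightarrow> real" where "dist_finseq v w = norm (v - w)"
definition sgn_finseq :: "finseq \<Rightarrow> finseq" where "sgn_finseq v = inverse (norm v) *\<^sub>R v"
definition uniformity_finseq :: "(finseq \<times> finseq) filter" where
  "uniformity_finseq = (INF e\<in>{0 <..}. principal {(x, y). dist x y < e})"
definition open_finseq :: "finseq set \<Rightarrow> bool" where
  "open_finseq U = (\<forall>x\<in>U. \<forall>\<^sub>F (x', y) in uniformity. x' = x \<longrightarrow> y \<in> U)"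

instance
proof
  fix x y z :: finseq and a b :: real
  show "x + y + z = x + (y + z)" "x + y = y + x" "0 + x = x" "- x + x = 0" "x - y = x + - y"
    "a *\<^sub>R (x + y) = a *\<^sub>R x + a *\<^sub>R y" "(a + b) *\<^sub>R x = a *\<^sub>R x + b *\<^sub>R x"
    "a *\<^sub>R b *\<^sub>R x = (a * b) *\<^sub>R x" "1 *\<^sub>R x = x"
    by (transfer, simp add: algebra_simps)+
  show "inner x y = inner y x"
    by transfer (simp add: inner_inf_def mult.commute)
  show "inner (x + y) z = inner x z + inner y z"
  proof transfer
    fix x y z :: "nat \<Rightarrow> real" assume "x \<in> Rinf" "y \<in> Rinf" "z \<in> Rinf"
    then have F: "finite {n. z n \<noteq> 0}" by (simp add: Rinf_def)
    show "inner_inf (\<lambda>n. x n + y n) z = inner_inf x z + inner_inf y z"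
      by (subst (1 2 3) inner_inf_eq_sum[OF F]) (auto simp: sum.distrib distrib_right)
  qed
  show "inner (a *\<^sub>R x) y = a * inner x y"
  proof transfer
    fix a and x y :: "nat \<Rightarrow> real" assume "x \<in> Rinf" "y \<in> Rinf"
    then have F: "finite {n. y n \<noteq> 0}" by (simp add: Rinf_def)
    show "inner_inf (\<lambda>n. a * x n) y = a * inner_inf x y"
      by (subst (1 2) inner_inf_eq_sum[OF F]) (auto simp: sum_distrib_left mult.assoc)
  qed
  show "0 \<le> inner x x"
    by transfer (auto simp: inner_inf_nonzero_eq Rinf_def intro: sum_nonneg)
  show "(inner x x = 0) = (x = 0)"
  proof transfer
    fix x :: "nat \<Rightarrow> real" assume "x \<in> Rinf"
    then have F: "finite {n. x n \<noteq> 0}" by (simp add: Rinf_def)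
    show "(inner_inf x x = 0) = (x = (\<lambda>_. 0))"
      unfolding inner_inf_nonzero_eq[OF F] by (subst sum_nonneg_eq_0_iff[OF F]) (auto simp: fun_eq_iff)
  qed
qed (simp_all only: norm_finseq_def dist_finseq_def sgn_finseq_def uniformity_finseq_def open_finseq_def)

end

lemma coords_zero [simp]: "coords 0 n = 0"
  and coords_add [simp]: "coords (x + y) n = coords x n + coords y n"
  and coords_diff [simp]: "coords (x - y) n = coords x n - coords y n"
  and coords_minus [simp]: "coords (- x) n = - coords x n"
  and coords_scaleR [simp]: "coords (c *\<^sub>R x) n = c * coords x n"
  by (transfer, simp)+

lemma finseq_eqI: "(\<And>n. coords x n = coords y n) \<Longrightarrow> x = y"
  by transfer auto

lemma inner_inf_coords: "inner_inf (coords x) (coords y) = x \<bullet> y"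
  by transfer simp

lemma inner_finseq_eq_sum:
  assumes "finite F" "\<And>n. n \<notin> F \<Longrightarrow> coords x n = 0 \<or> coords y n = 0"
  shows "x \<bullet> y = (\<Sum>n\<in>F. coords x n * coords y n)"
  using inner_inf_eq_sum[OF assms(1), of "coords x" "coords y"] assms(2) by (simp add: inner_inf_coords)

lemma abs_coords_le_norm: "\<bar>coords x n\<bar> \<le> norm x"
proof -
  let ?F = "insert n {n. coords x n \<noteq> 0}"
  have "(coords x n)\<^sup>2 \<le> (\<Sum>k\<in>?F. coords x k * coords x k)"
    using finite_support_coords[of x] by (simp add: sum.insert_remove power2_eq_square sum_nonneg)
  also have "\<dots> = (norm x)\<^sup>2"
    unfolding power2_norm_eq_inner
    using finite_support_coords[of x] by (intro inner_finseq_eq_sum[symmetric]) auto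
  finally show ?thesis by (simp add: abs_le_square_iff[symmetric])
qed

section \<open>Two largest eigenvalues of a self-adjoint operator\<close>

definition pair_proj :: "'a::real_inner \<Rightarrow> 'a \<Rightarrow> 'a \<Rightarrow> 'a" where
  "pair_proj u v x = (u \<bullet> x) *\<^sub>R u + (v \<bullet> x) *\<^sub>R v"

definition orthonormal_pair :: "'a::real_inner \<Rightarrow> 'a \<Rightarrow> bool" where
  "orthonormal_pair u v \<longleftrightarrow> u \<bullet> u = 1 \<and> v \<bullet> v = 1 \<and> u \<bullet> v = 0"

lemma pair_proj_inner_left:
  "orthonormal_pair u v \<Longrightarrow> u \<bullet> pair_proj u v x = u \<bullet> x"
  "orthonormal_pair u v \<Longrightarrow> v \<bullet> pair_proj u v x = v \<bullet> x"
  by (simp_all add: orthonormal_pair_def pair_proj_def inner_add_right inner_commute)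

lemma pair_proj_idem: "orthonormal_pair u v \<Longrightarrow> pair_proj u v (pair_proj u v x) = pair_proj u v x"
  by (simp add: pair_proj_def[of u v "pair_proj u v x"] pair_proj_inner_left) (simp add: pair_proj_def)

lemma pair_proj_self_adjoint: "pair_proj u v x \<bullet> y = x \<bullet> pair_proj u v y"
  by (simp add: pair_proj_def inner_add_left inner_add_right inner_commute)

text \<open>The coefficients of \<open>u\<close>, \<open>v\<close> with respect to
  \<open>u'\<close>, \<open>v'\<close> form a square matrix with orthonormal rows, hence with
  orthonormal columns. One inclusion of the planes suffices because the dimensions agree.\<close>

lemma pair_proj_subspaces_eq:
  assumes o: "orthonormal_pair u v" "orthonormal_pair u' v'"
    and sub: "pair_proj u' v' u = u" "pair_proj u' v' v = v"
  shows "pair_proj u v = pair_proj u' v'"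
proof -
  obtain a b c d where u: "u = a *\<^sub>R u' + b *\<^sub>R v'" and v: "v = c *\<^sub>R u' + d *\<^sub>R v'"
    using sub unfolding pair_proj_def by metis
  have o': "u' \<bullet> u' = 1" "v' \<bullet> v' = 1" "u' \<bullet> v' = 0" "v' \<bullet> u' = 0"
    using o(2) by (auto simp: orthonormal_pair_def inner_commute)
  have r: "a * a + b * b = 1" "c * c + d * d = 1" "a * c + b * d = 0"
    using o(1) unfolding orthonormal_pair_def u v
    by (auto simp: inner_add_left inner_add_right o' algebra_simps)
  define t where "t = a * d - b * c"
  have d: "d = t * a" and c: "c = - t * b" unfolding t_def using r by algebra+
  have t: "t * t = 1" unfolding t_def using r by algebra
  have k: "a * a + c * c = 1" "b * b + d * d = 1" "a * b + c * d = 0"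
    using r(1) t unfolding c d by algebra+
  show ?thesis
  proof
    fix x
    have "pair_proj u v x = ((a * a + c * c) * (u' \<bullet> x) + (a * b + c * d) * (v' \<bullet> x)) *\<^sub>R u'
        + ((a * b + c * d) * (u' \<bullet> x) + (b * b + d * d) * (v' \<bullet> x)) *\<^sub>R v'"
      unfolding pair_proj_def u v by (simp add: inner_add_left algebra_simps)
    then show "pair_proj u v x = pair_proj u' v' x" unfolding k by (simp add: pair_proj_def)
  qed
qed

text \<open>The cross product of the two coefficient rows solves both equations. If it vanishes, the
  rows are proportional and a solution can be written down directly.\<close>

lemma two_equations_three_unknowns:
  fixes a1 b1 c1 a2 b2 c2 :: real
  shows "\<exists>x y z. (x \<noteq> 0 \<or> y \<noteq> 0 \<or> z \<noteq> 0) \<and> x * a1 + y * b1 + z * c1 = 0 \<and> x * a2 + y * b2 + z * c2 = 0"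
proof -
  define x y z where "x = b1 * c2 - b2 * c1" "y = c1 * a2 - c2 * a1" "z = a1 * b2 - a2 * b1"
  show ?thesis
  proof (cases "x \<noteq> 0 \<or> y \<noteq> 0 \<or> z \<noteq> 0")
    case True
    then show ?thesis
      by (intro exI[of _ x] exI[of _ y] exI[of _ z]) (auto simp: x_y_z_def algebra_simps)
  next
    case False
    then have *: "b1 * c2 = b2 * c1" "c1 * a2 = c2 * a1" "a1 * b2 = a2 * b1" by (auto simp: x_y_z_def)
    consider "a1 \<noteq> 0 \<or> b1 \<noteq> 0" | "a2 \<noteq> 0 \<or> b2 \<noteq> 0" | "a1 = 0" "b1 = 0" "a2 = 0" "b2 = 0" by blast
    then show ?thesis
    proof cases
      case 1
      then show ?thesis using *
        by (intro exI[of _ "b1"] exI[of _ "-a1"] exI[of _ 0]) (auto simp: algebra_simps)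
    next
      case 2
      then show ?thesis using *
        by (intro exI[of _ "b2"] exI[of _ "-a2"] exI[of _ 0]) (auto simp: algebra_simps)
    next
      case 3
      then show ?thesis by (intro exI[of _ "1"] exI[of _ "0"] exI[of _ 0]) auto
    qed
  qed
qed

text \<open>First-order condition at a maximum of the Rayleigh quotient: moving from
  \<open>v\<close> in an admissible direction \<open>y\<close> cannot increase the quotient to first
  order.\<close>

lemma maximizer_critical:
  fixes A :: "'a::real_inner \<Rightarrow> 'a"
  assumes lin: "linear A" and sa: "\<And>x y. A x \<bullet> y = x \<bullet> A y"
    and E: "subspace E" and vE: "v \<in> E" "v \<bullet> v = 1" "v \<bullet> u = 0"
    and max: "\<And>x. x \<in> E \<Longrightarrow> x \<bullet> u = 0 \<Longrightarrow> A x \<bullet> x \<le> (A v \<bullet> v) * (x \<bullet> x)"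
    and y: "y \<in> E" "y \<bullet> u = 0" "y \<bullet> v = 0"
  shows "A v \<bullet> y = 0"
proof (rule ccontr)
  assume c: "A v \<bullet> y \<noteq> 0"
  define c k where "c = A v \<bullet> y" and "k = (A v \<bullet> v) * (y \<bullet> y) - A y \<bullet> y"
  have k: "0 \<le> k" using max[OF y(1,2)] by (simp add: k_def)
  have le: "2 * t * c \<le> t * t * k" for t
  proof -
    have "A (v + t *\<^sub>R y) \<bullet> (v + t *\<^sub>R y) \<le> (A v \<bullet> v) * ((v + t *\<^sub>R y) \<bullet> (v + t *\<^sub>R y))"
      using vE y E by (intro max) (auto simp: inner_add_left intro: subspace_add subspace_scale)
    moreover have "A (v + t *\<^sub>R y) = A v + t *\<^sub>R A y" using lin by (simp add: linear_add linear_scale)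
    moreover have "A y \<bullet> v = A v \<bullet> y" using sa[of y v] by (simp add: inner_commute)
    moreover have "v \<bullet> y = 0" using y(3) by (simp add: inner_commute)
    ultimately show ?thesis
      using vE(2) y(3) by (simp add: inner_add_left inner_add_right c_def k_def algebra_simps)
  qed
  \<comment> \<open>The denominator is positive since \<open>k\<close> is nonnegative, and for this
    \<open>t\<close> the quadratic inequality becomes
    \<open>t * t * (k + 2) \<le> 0\<close>.\<close>
  define t where "t = c / (k + 1)"
  have t: "c = t * (k + 1)" "t \<noteq> 0" using k \<open>A v \<bullet> y \<noteq> 0\<close> by (simp_all add: t_def c_def)
  have "2 * t * (t * (k + 1)) \<le> t * t * k" using le[of t] t(1) by simp
  then have "t * t * (k + 2) \<le> 0" by (simp add: algebra_simps)
  moreover have "0 < t * t" using t(2) by (metis not_real_square_gt_zero)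
  ultimately show False using k mult_pos_pos[of "t * t" "k + 2"] by linarith
qed

text \<open>The residual \<open>w\<close> lies in \<open>E\<close> and is orthogonal to
  \<open>v\<close>, and also to \<open>u\<close> because \<open>u\<close> is an eigenvector of a
  self-adjoint operator. Criticality makes \<open>w\<close> orthogonal to \<open>A v\<close>, hence
  to itself.\<close>

lemma maximizer_eigenvector:
  fixes A :: "'a::real_inner \<Rightarrow> 'a"
  assumes lin: "linear A" and sa: "\<And>x y. A x \<bullet> y = x \<bullet> A y"
    and E: "subspace E" "\<And>x. x \<in> E \<Longrightarrow> A x \<in> E" and vE: "v \<in> E" "v \<bullet> v = 1" "v \<bullet> u = 0"
    and max: "\<And>x. x \<in> E \<Longrightarrow> x \<bullet> u = 0 \<Longrightarrow> A x \<bullet> x \<le> (A v \<bullet> v) * (x \<bullet> x)"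
    and u: "A u = l *\<^sub>R u"
  shows "A v = (A v \<bullet> v) *\<^sub>R v"
proof -
  define w where "w = A v - (A v \<bullet> v) *\<^sub>R v"
  have w: "w \<in> E" using E vE by (simp add: w_def subspace_diff subspace_scale)
  have wv: "w \<bullet> v = 0" using vE by (simp add: w_def inner_diff_left)
  have "A v \<bullet> u = 0" using sa[of v u] vE u by simp
  then have wu: "w \<bullet> u = 0" using vE by (simp add: w_def inner_diff_left)
  have "A v \<bullet> w = 0" by (rule maximizer_critical[OF lin sa E(1) vE max w wu wv])
  moreover have "w \<bullet> w = A v \<bullet> w - (A v \<bullet> v) * (v \<bullet> w)"
    unfolding w_def by (simp only: inner_diff_left inner_scaleR_left)
  ultimately have "w \<bullet> w = 0" using wv by (simp add: inner_commute)
  then show ?thesis by (simp add: w_def)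
qed

definition top_pair :: "('a::real_inner \<Rightarrow> 'a) \<Rightarrow> 'a \<Rightarrow> 'a \<Rightarrow> bool" where
  "top_pair A u v \<longleftrightarrow> orthonormal_pair u v \<and>
     (\<exists>l1 l2. A u = l1 *\<^sub>R u \<and> A v = l2 *\<^sub>R v \<and> l2 \<le> l1 \<and>
        (\<forall>w l. w \<noteq> 0 \<and> u \<bullet> w = 0 \<and> v \<bullet> w = 0 \<and> A w = l *\<^sub>R w \<longrightarrow> l < l2))"

text \<open>In contrast to \<open>top_pair\<close>, nothing is asked of the remaining eigenvectors;
  for an operator with a gap the lower bound \<alpha> already forces them to have smaller
  eigenvalues.\<close>

definition spectral_pair :: "('a::real_inner \<Rightarrow> 'a) \<Rightarrow> real \<Rightarrow> 'a \<Rightarrow> 'a \<Rightarrow> bool" where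
  "spectral_pair A \<alpha> u v \<longleftrightarrow> orthonormal_pair u v \<and>
     (\<exists>l1 l2. A u = l1 *\<^sub>R u \<and> A v = l2 *\<^sub>R v \<and> l2 \<le> l1 \<and> \<alpha> \<le> l2)"

text \<open>The plane of \<open>t1\<close> and \<open>t2\<close> need not be invariant. As in the
  min-max principle it is a test plane: its form bounds separate two eigenvalues that are at least
  \<alpha> from all others, which are at most \<alpha>'.\<close>

locale gapped_operator =
  fixes A :: "'a::real_inner \<Rightarrow> 'a" and t1 t2 :: 'a and \<alpha> \<alpha>' :: real
  assumes lin: "linear A" and sa: "\<And>x y. A x \<bullet> y = x \<bullet> A y"
    and ot: "orthonormal_pair t1 t2" and gap: "\<alpha>' < \<alpha>"
    and lo: "\<And>a b. A (a *\<^sub>R t1 + b *\<^sub>R t2) \<bullet> (a *\<^sub>R t1 + b *\<^sub>R t2)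
                \<ge> \<alpha> * ((a *\<^sub>R t1 + b *\<^sub>R t2) \<bullet> (a *\<^sub>R t1 + b *\<^sub>R t2))"
    and hi: "\<And>x. t1 \<bullet> x = 0 \<Longrightarrow> t2 \<bullet> x = 0 \<Longrightarrow> A x \<bullet> x \<le> \<alpha>' * (x \<bullet> x)"
begin

text \<open>The coefficients are those of the quarter turn of
  \<open>(t1 \<bullet> u, t2 \<bullet> u)\<close>, normalized. The resulting vector is the
  competitor that keeps an eigenvalue found orthogonally to \<open>u\<close> at or above
  \<alpha>.\<close>

lemma perp_exists: "\<exists>a b. (a *\<^sub>R t1 + b *\<^sub>R t2) \<bullet> u = 0 \<and> (a *\<^sub>R t1 + b *\<^sub>R t2) \<bullet> (a *\<^sub>R t1 + b *\<^sub>R t2) = 1"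
proof -
  let ?p = "t1 \<bullet> u" and ?q = "t2 \<bullet> u"
  have n: "(a *\<^sub>R t1 + b *\<^sub>R t2) \<bullet> (a *\<^sub>R t1 + b *\<^sub>R t2) = a * a + b * b" for a b
    using ot by (simp add: orthonormal_pair_def inner_add_left inner_add_right inner_commute[of t2 t1])
  show ?thesis
  proof (cases "?p = 0 \<and> ?q = 0")
    case True
    then show ?thesis unfolding n by (intro exI[of _ 1] exI[of _ 0]) (auto simp: inner_add_left)
  next
    case False
    define s where "s = sqrt (?p * ?p + ?q * ?q)"
    have "?p * ?p + ?q * ?q > 0" using False
      by (metis add_nonneg_eq_0_iff add_nonneg_nonneg less_eq_real_def mult_eq_0_iff zero_le_square)
    then have s: "s * s = ?p * ?p + ?q * ?q" "s > 0" by (simp_all add: s_def)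
    have "(?q / s) * (?q / s) + (- (?p / s)) * (- (?p / s)) = 1"
    proof -
      have "(?q / s) * (?q / s) + (- (?p / s)) * (- (?p / s)) = (?p * ?p + ?q * ?q) / (s * s)"
        by (simp add: add_divide_distrib)
      then show ?thesis unfolding s(1)[symmetric] using s(2) by simp
    qed
    then show ?thesis unfolding n
      by (intro exI[of _ "?q / s"] exI[of _ "- (?p / s)"]) (auto simp: inner_add_left inner_diff_left)
  qed
qed

text \<open>A plane of large values and a vector with too large a value would span a 3-space,
  which meets the orthogonal complement of \<open>t1\<close> and \<open>t2\<close>.\<close>

lemma spectral_pair_perp:
  assumes uv: "spectral_pair A \<alpha> u v" and x: "u \<bullet> x = 0" "v \<bullet> x = 0"
  shows "A x \<bullet> x \<le> \<alpha>' * (x \<bullet> x)"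
proof (cases "x = 0")
  case True
  then show ?thesis using lin by (simp add: linear_0)
next
  case x0: False
  obtain l1 l2 where l: "A u = l1 *\<^sub>R u" "A v = l2 *\<^sub>R v" "l2 \<le> l1" "\<alpha> \<le> l2" and o: "orthonormal_pair u v"
    using uv unfolding spectral_pair_def by blast
  have o': "u \<bullet> u = 1" "v \<bullet> v = 1" "u \<bullet> v = 0" "v \<bullet> u = 0"
    using o by (auto simp: orthonormal_pair_def inner_commute)
  obtain a b c where abc: "a \<noteq> 0 \<or> b \<noteq> 0 \<or> c \<noteq> 0"
    "a * (t1 \<bullet> u) + b * (t1 \<bullet> v) + c * (t1 \<bullet> x) = 0"
    "a * (t2 \<bullet> u) + b * (t2 \<bullet> v) + c * (t2 \<bullet> x) = 0"
    using two_equations_three_unknowns[of "t1 \<bullet> u" "t1 \<bullet> v" "t1 \<bullet> x" "t2 \<bullet> u" "t2 \<bullet> v" "t2 \<bullet> x"] by blast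
  define y where "y = a *\<^sub>R u + b *\<^sub>R v + c *\<^sub>R x"
  have x': "x \<bullet> u = 0" "x \<bullet> v = 0" using x by (simp_all add: inner_commute)
  have Ax: "A x \<bullet> u = 0" "A x \<bullet> v = 0" using x' l sa[of x u] sa[of x v] by simp_all
  have yy: "y \<bullet> y = a * a + b * b + c * c * (x \<bullet> x)"
    using o' x x' by (simp add: y_def inner_add_left inner_add_right)
  have "A y = a *\<^sub>R (l1 *\<^sub>R u) + b *\<^sub>R (l2 *\<^sub>R v) + c *\<^sub>R A x"
    using lin l by (simp add: y_def linear_add linear_scale)
  then have Ay: "A y \<bullet> y = l1 * (a * a) + l2 * (b * b) + c * c * (A x \<bullet> x)"
    using o' x Ax by (simp add: y_def inner_add_left inner_add_right)
  have "A y \<bullet> y \<le> \<alpha>' * (y \<bullet> y)"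
    by (rule hi) (use abc in \<open>simp_all add: y_def inner_add_right\<close>)
  then have le: "(l1 - \<alpha>') * (a * a) + (l2 - \<alpha>') * (b * b) + c * c * (A x \<bullet> x - \<alpha>' * (x \<bullet> x)) \<le> 0"
    unfolding yy Ay by (simp add: algebra_simps)
  have nn: "0 \<le> (l1 - \<alpha>') * (a * a)" "0 \<le> (l2 - \<alpha>') * (b * b)" using l gap by simp_all
  show ?thesis
  proof (rule ccontr)
    assume "\<not> ?thesis"
    then have p: "A x \<bullet> x - \<alpha>' * (x \<bullet> x) > 0" by simp
    then have "0 \<le> c * c * (A x \<bullet> x - \<alpha>' * (x \<bullet> x))" by simp
    then have "(l1 - \<alpha>') * (a * a) = 0" "(l2 - \<alpha>') * (b * b) = 0" "c * c * (A x \<bullet> x - \<alpha>' * (x \<bullet> x)) = 0"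
      using le nn by linarith+
    then have "a = 0" "b = 0" "c = 0" using l gap p by auto
    then show False using abc(1) by simp
  qed
qed

lemma spectral_pair_top_pair:
  assumes "spectral_pair A \<alpha> u v" shows "top_pair A u v"
proof -
  obtain l1 l2 where l: "A u = l1 *\<^sub>R u" "A v = l2 *\<^sub>R v" "l2 \<le> l1" "\<alpha> \<le> l2" and o: "orthonormal_pair u v"
    using assms unfolding spectral_pair_def by blast
  have "l < l2" if "w \<noteq> 0" "u \<bullet> w = 0" "v \<bullet> w = 0" "A w = l *\<^sub>R w" for w l
  proof -
    have "l * (w \<bullet> w) \<le> \<alpha>' * (w \<bullet> w)" using spectral_pair_perp[OF assms that(2,3)] that(4) by simp
    moreover have "0 < w \<bullet> w" using that(1) by simp
    ultimately have "l \<le> \<alpha>'" by (simp only: mult_le_cancel_right_pos)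
    then show ?thesis using gap l(4) by linarith
  qed
  then show ?thesis unfolding top_pair_def using o l by blast
qed

text \<open>By self-adjointness \<open>x\<close> has a component along \<open>u\<close> or
  \<open>v\<close> only where the eigenvalues agree, so the projection of \<open>x\<close> to the
  plane is scaled by the same \<open>l\<close>, and so is the rest.\<close>

lemma eigenvector_perp_part:
  assumes "A x = l *\<^sub>R x" "A u = l1 *\<^sub>R u" "A v = l2 *\<^sub>R v"
    and o: "orthonormal_pair u v"
  shows "A (x - pair_proj u v x) = l *\<^sub>R (x - pair_proj u v x)"
proof -
  have e: "l1 * (u \<bullet> x) = l * (u \<bullet> x)" "l2 * (v \<bullet> x) = l * (v \<bullet> x)"
    using sa[of u x] sa[of v x] assms by simp_all
  have "A (pair_proj u v x) = (l1 * (u \<bullet> x)) *\<^sub>R u + (l2 * (v \<bullet> x)) *\<^sub>R v"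
    by (simp add: pair_proj_def linear_add[OF lin] linear_scale[OF lin] assms mult.commute)
  also have "\<dots> = l *\<^sub>R pair_proj u v x" unfolding e by (simp add: pair_proj_def scaleR_add_right)
  finally show ?thesis using assms(1) by (simp add: linear_diff[OF lin] scaleR_diff_right)
qed

text \<open>A \<open>top_pair\<close> carries no lower bound on its eigenvalues, hence the case
  distinction. If \<open>u\<close> and \<open>v\<close> lie in the plane of \<open>u'\<close> and
  \<open>v'\<close>, the planes agree. Otherwise one of them has a part outside that plane, an
  eigenvector with value at least \<alpha>; this pushes \<open>m2\<close> above \<alpha> and forces
  \<open>u'\<close> and \<open>v'\<close> into the plane of \<open>u\<close> and
  \<open>v\<close>.\<close>

lemma top_pair_unique:
  assumes s: "spectral_pair A \<alpha> u v" and t: "top_pair A u' v'"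
  shows "pair_proj u' v' = pair_proj u v"
proof -
  obtain l1 l2 where l: "A u = l1 *\<^sub>R u" "A v = l2 *\<^sub>R v" "l2 \<le> l1" "\<alpha> \<le> l2" and o: "orthonormal_pair u v"
    using s unfolding spectral_pair_def by blast
  obtain m1 m2 where m: "A u' = m1 *\<^sub>R u'" "A v' = m2 *\<^sub>R v'" "m2 \<le> m1" and o': "orthonormal_pair u' v'"
    and mt: "\<And>w l. w \<noteq> 0 \<Longrightarrow> u' \<bullet> w = 0 \<Longrightarrow> v' \<bullet> w = 0 \<Longrightarrow> A w = l *\<^sub>R w \<Longrightarrow> l < m2"
    using t unfolding top_pair_def by blast
  have big: "\<alpha> < m2" if "A x = k *\<^sub>R x" "\<alpha> \<le> k" "pair_proj u' v' x \<noteq> x" for x k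
  proof -
    have "k < m2"
      using that(3) eigenvector_perp_part[OF that(1) m(1,2) o']
      by (intro mt[of "x - pair_proj u' v' x"]) (auto simp: inner_diff_right pair_proj_inner_left[OF o'])
    then show ?thesis using that(2) by simp
  qed
  have inside: "pair_proj u v x = x" if "A x = k *\<^sub>R x" "\<alpha> < k" for x k
  proof (rule ccontr)
    let ?w = "x - pair_proj u v x"
    assume "pair_proj u v x \<noteq> x"
    then have w: "?w \<noteq> 0" by simp
    have "A ?w = k *\<^sub>R ?w" by (rule eigenvector_perp_part[OF that(1) l(1,2) o])
    moreover have "A ?w \<bullet> ?w \<le> \<alpha>' * (?w \<bullet> ?w)"
      by (rule spectral_pair_perp[OF s]) (simp_all add: inner_diff_right pair_proj_inner_left[OF o])
    ultimately have "k * (?w \<bullet> ?w) \<le> \<alpha>' * (?w \<bullet> ?w)" by simp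
    moreover have "?w \<bullet> ?w > 0" using w by simp
    ultimately have "k \<le> \<alpha>'" by (simp only: mult_le_cancel_right)
    then show False using that(2) gap by simp
  qed
  have eq: "pair_proj u' v' = pair_proj u v" if "\<alpha> < m2"
    using inside[OF m(1)] inside[OF m(2)] m(3) that by (intro pair_proj_subspaces_eq o o') auto
  show ?thesis
  proof (cases "pair_proj u' v' u = u \<and> pair_proj u' v' v = v")
    case True
    then show ?thesis using pair_proj_subspaces_eq[OF o o'] by simp
  next
    case False
    then have "\<alpha> < m2" using big[OF l(1)] big[OF l(2)] l by auto
    then show ?thesis by (rule eq)
  qed
qed

text \<open>The form is maximized twice on an invariant subspace, the second time orthogonally to
  the first eigenvector. The assumption \<open>attain\<close> isolates the use of
  compactness.\<close>

lemma spectral_pair_exists: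
  assumes E: "subspace E" "\<And>x. x \<in> E \<Longrightarrow> A x \<in> E" "t1 \<in> E" "t2 \<in> E"
    and attain: "\<And>u w. u \<in> E \<Longrightarrow> w \<in> E \<Longrightarrow> w \<noteq> 0 \<Longrightarrow> w \<bullet> u = 0 \<Longrightarrow>
      \<exists>v\<in>E. v \<bullet> v = 1 \<and> v \<bullet> u = 0 \<and> (\<forall>x\<in>E. x \<bullet> u = 0 \<longrightarrow> A x \<bullet> x \<le> (A v \<bullet> v) * (x \<bullet> x))"
  shows "\<exists>u\<in>E. \<exists>v\<in>E. spectral_pair A \<alpha> u v"
proof -
  have tE: "a *\<^sub>R t1 + b *\<^sub>R t2 \<in> E" for a b using E by (simp add: subspace_add subspace_scale)
  have step: "\<exists>v\<in>E. \<exists>k. v \<bullet> v = 1 \<and> v \<bullet> u = 0 \<and> A v = k *\<^sub>R v \<and> \<alpha> \<le> k \<and>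
      (\<forall>x\<in>E. x \<bullet> u = 0 \<longrightarrow> A x \<bullet> x \<le> k * (x \<bullet> x))"
    if u: "u \<in> E" "A u = l *\<^sub>R u" for u l
  proof -
    obtain a b where ab: "(a *\<^sub>R t1 + b *\<^sub>R t2) \<bullet> u = 0" "(a *\<^sub>R t1 + b *\<^sub>R t2) \<bullet> (a *\<^sub>R t1 + b *\<^sub>R t2) = 1"
      using perp_exists by blast
    then have "a *\<^sub>R t1 + b *\<^sub>R t2 \<noteq> 0" by (metis inner_zero_left zero_neq_one)
    then obtain v where v: "v \<in> E" "v \<bullet> v = 1" "v \<bullet> u = 0"
      "\<And>x. x \<in> E \<Longrightarrow> x \<bullet> u = 0 \<Longrightarrow> A x \<bullet> x \<le> (A v \<bullet> v) * (x \<bullet> x)"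
      using attain[OF u(1) tE _ ab(1)] by blast
    have "A v = (A v \<bullet> v) *\<^sub>R v" by (rule maximizer_eigenvector[OF lin sa E(1,2) v u(2)])
    moreover have "\<alpha> \<le> A v \<bullet> v" using v(4)[OF tE ab(1)] lo[of a b] unfolding ab(2) by simp
    ultimately show ?thesis using v by blast
  qed
  \<comment> \<open>Orthogonality to the zero vector is no condition, so the same step, started at
    0, yields the first eigenvector.\<close>
  have "(0::'a) \<in> E" "A 0 = 0 *\<^sub>R (0::'a)" using E lin by (simp_all add: subspace_0 linear_0)
  from step[OF this] obtain u k where u: "u \<in> E" "u \<bullet> u = 1" "A u = k *\<^sub>R u" "\<alpha> \<le> k"
    "\<And>x. x \<in> E \<Longrightarrow> A x \<bullet> x \<le> k * (x \<bullet> x)"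
    by auto
  from step[OF u(1,3)] obtain v m where
    v: "v \<in> E" "v \<bullet> v = 1" "v \<bullet> u = 0" "A v = m *\<^sub>R v" "\<alpha> \<le> m"
    by blast
  have "m \<le> k" using u(5)[OF v(1)] v(2,4) by simp
  then have "spectral_pair A \<alpha> u v" unfolding spectral_pair_def orthonormal_pair_def
    using u(2-4) v(2-5) by (auto simp: inner_commute)
  then show ?thesis using u(1) v(1) by blast
qed

end

text \<open>The perturbation bound for spectral projections of Davis and Kahan, in its simplest form.\<close>

lemma pair_proj_perturbation:
  fixes A A0 :: "'a::real_inner \<Rightarrow> 'a"
  assumes uv: "spectral_pair A \<alpha> u v" and uv0: "spectral_pair A0 \<alpha> u0 v0"
    and lin0: "linear A0" and gap: "\<alpha>' < \<alpha>"
    and perp0: "\<And>x. u0 \<bullet> x = 0 \<Longrightarrow> v0 \<bullet> x = 0 \<Longrightarrow> A0 x \<bullet> x \<le> \<alpha>' * (x \<bullet> x)"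
    and \<delta>: "\<And>x y. \<bar>(A0 x - A x) \<bullet> y\<bar> \<le> \<delta> * (norm x * norm y)"
  shows "norm (pair_proj u v x - pair_proj u0 v0 (pair_proj u v x)) \<le> 2 * (\<delta> / (\<alpha> - \<alpha>')) * norm x"
proof -
  obtain l1 l2 where l: "A u = l1 *\<^sub>R u" "A v = l2 *\<^sub>R v" "l2 \<le> l1" "\<alpha> \<le> l2" and o: "orthonormal_pair u v"
    using uv unfolding spectral_pair_def by blast
  obtain k1 k2 where k: "A0 u0 = k1 *\<^sub>R u0" "A0 v0 = k2 *\<^sub>R v0" and o0: "orthonormal_pair u0 v0"
    using uv0 unfolding spectral_pair_def by blast
  let ?Q = "\<lambda>x. x - pair_proj u0 v0 x"
  define g where "g = \<delta> / (\<alpha> - \<alpha>')"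
  have un: "norm u = 1" "norm v = 1" using o by (simp_all add: orthonormal_pair_def norm_eq_sqrt_inner)
  have Qperp: "u0 \<bullet> ?Q x = 0" "v0 \<bullet> ?Q x = 0" for x
    by (simp_all add: inner_diff_right pair_proj_inner_left[OF o0])
  have main: "norm (?Q z) \<le> g" if z: "A z = m *\<^sub>R z" "\<alpha> \<le> m" "norm z = 1" for z m
  proof (cases "?Q z = 0")
    case True
    have "0 \<le> \<delta>" using \<delta>[of z z] z(3) by simp
    then show ?thesis using True gap by (simp add: g_def)
  next
    case False
    let ?w = "?Q z"
    \<comment> \<open>The range of the second projection is invariant under \<open>A0\<close>, so
      the component of \<open>z\<close> in it does not contribute to the pairing with
      \<open>?w\<close>.\<close>
    have "A0 (pair_proj u0 v0 z) \<bullet> ?w = 0"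
      using Qperp[of z] by (simp add: pair_proj_def linear_add[OF lin0] linear_scale[OF lin0] k inner_add_left)
    then have "A0 ?w \<bullet> ?w = A0 z \<bullet> ?w" by (simp add: linear_diff[OF lin0] inner_diff_left)
    also have "\<dots> = (A0 z - A z) \<bullet> ?w + m * (z \<bullet> ?w)" using z by (simp add: inner_diff_left)
    also have "z \<bullet> ?w = ?w \<bullet> ?w + pair_proj u0 v0 z \<bullet> ?w" by (simp add: inner_diff_left)
    also have "pair_proj u0 v0 z \<bullet> ?w = 0"
      by (subst pair_proj_def) (use Qperp[of z] in \<open>simp add: inner_add_left\<close>)
    finally have "A0 ?w \<bullet> ?w = (A0 z - A z) \<bullet> ?w + m * (?w \<bullet> ?w)" by simp
    moreover have "A0 ?w \<bullet> ?w \<le> \<alpha>' * (?w \<bullet> ?w)" by (rule perp0[OF Qperp])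
    moreover have "- (\<delta> * norm ?w) \<le> (A0 z - A z) \<bullet> ?w" using \<delta>[of z ?w] z(3) by (simp add: abs_le_iff)
    moreover have "\<alpha> * (?w \<bullet> ?w) \<le> m * (?w \<bullet> ?w)" using z(2) by (simp add: mult_right_mono)
    ultimately have "(\<alpha> - \<alpha>') * (?w \<bullet> ?w) \<le> \<delta> * norm ?w" by (simp add: left_diff_distrib)
    then have "(\<alpha> - \<alpha>') * norm ?w * norm ?w \<le> \<delta> * norm ?w" 
      by (simp add: power2_norm_eq_inner[symmetric] power2_eq_square mult.assoc)
    then have "(\<alpha> - \<alpha>') * norm ?w \<le> \<delta>" using False by (simp add: mult_le_cancel_right)
    then show ?thesis using gap by (simp add: g_def pos_le_divide_eq mult.commute)
  qed
  have "?Q (pair_proj u v x) = (u \<bullet> x) *\<^sub>R ?Q u + (v \<bullet> x) *\<^sub>R ?Q v"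
    by (simp add: pair_proj_def inner_add_right algebra_simps)
  then have "norm (?Q (pair_proj u v x)) \<le> \<bar>u \<bullet> x\<bar> * norm (?Q u) + \<bar>v \<bullet> x\<bar> * norm (?Q v)"
    using norm_triangle_ineq[of "(u \<bullet> x) *\<^sub>R ?Q u" "(v \<bullet> x) *\<^sub>R ?Q v"] by simp
  also have "\<dots> \<le> norm x * g + norm x * g"
    using Cauchy_Schwarz_ineq2[of u x] Cauchy_Schwarz_ineq2[of v x] un main[OF l(1)] main[OF l(2)] l(3,4)
    by (intro add_mono mult_mono) auto
  finally show ?thesis unfolding g_def[symmetric] by (simp add: algebra_simps)
qed

text \<open>Projections satisfy P - R = P (1 - R) - (1 - P) R. The perturbation bound applies to (1
  - P) R directly and to P (1 - R) through its adjoint (1 - R) P.\<close>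

lemma pair_proj_continuity_bound:
  fixes A A0 :: "'a::real_inner \<Rightarrow> 'a"
  assumes uv: "spectral_pair A \<alpha> u v" and uv0: "spectral_pair A0 \<alpha> u0 v0"
    and lin: "linear A" "linear A0" and gap: "\<alpha>' < \<alpha>"
    and perp: "\<And>x. u \<bullet> x = 0 \<Longrightarrow> v \<bullet> x = 0 \<Longrightarrow> A x \<bullet> x \<le> \<alpha>' * (x \<bullet> x)"
    and perp0: "\<And>x. u0 \<bullet> x = 0 \<Longrightarrow> v0 \<bullet> x = 0 \<Longrightarrow> A0 x \<bullet> x \<le> \<alpha>' * (x \<bullet> x)"
    and \<delta>: "\<And>x y. \<bar>(A x - A0 x) \<bullet> y\<bar> \<le> \<delta> * (norm x * norm y)"
  shows "\<bar>(pair_proj u v x - pair_proj u0 v0 x) \<bullet> y\<bar> \<le> 4 * (\<delta> / (\<alpha> - \<alpha>')) * (norm x * norm y)"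
proof -
  let ?P = "pair_proj u v" and ?R = "pair_proj u0 v0"
  define g where "g = \<delta> / (\<alpha> - \<alpha>')"
  have \<delta>': "\<bar>(A0 x - A x) \<bullet> y\<bar> \<le> \<delta> * (norm x * norm y)" for x y
    using \<delta>[of x y] by (metis abs_minus_cancel inner_minus_left minus_diff_eq)
  have 1: "norm (?P y - ?R (?P y)) \<le> 2 * g * norm y"
    by (rule pair_proj_perturbation[OF uv uv0 lin(2) gap perp0 \<delta>', folded g_def])
  have 2: "norm (?R x - ?P (?R x)) \<le> 2 * g * norm x"
    by (rule pair_proj_perturbation[OF uv0 uv lin(1) gap perp \<delta>, folded g_def])
  have "(?P x - ?R x) \<bullet> y = x \<bullet> (?P y - ?R (?P y)) - (?R x - ?P (?R x)) \<bullet> y"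
    by (simp add: inner_diff_left inner_diff_right pair_proj_self_adjoint)
  then have "\<bar>(?P x - ?R x) \<bullet> y\<bar> \<le> norm x * norm (?P y - ?R (?P y)) + norm (?R x - ?P (?R x)) * norm y"
    using Cauchy_Schwarz_ineq2[of x "?P y - ?R (?P y)"] Cauchy_Schwarz_ineq2[of "?R x - ?P (?R x)" y]
    by linarith
  also have "\<dots> \<le> norm x * (2 * g * norm y) + (2 * g * norm x) * norm y"
    using 1 2 by (intro add_mono mult_left_mono mult_right_mono) auto
  finally show ?thesis unfolding g_def[symmetric] by (simp add: algebra_simps)
qed

section \<open>Matrices acting on finitely supported sequences\<close>

lift_definition basis_finseq :: "nat \<Rightarrow> finseq" is "\<lambda>n k. if k = n then 1 else 0"
  by (simp add: Rinf_def)

lemma coords_basis_finseq [simp]: "coords (basis_finseq n) k = (if k = n then 1 else 0)"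
  by transfer simp

lemma inner_basis_finseq: "x \<bullet> basis_finseq n = coords x n"
  by (subst inner_finseq_eq_sum[of "{n}"]) auto

lemma norm_basis_finseq: "norm (basis_finseq n) = 1"
  by (simp add: norm_eq_sqrt_inner inner_basis_finseq)

lemma coords_Abs_finseq: "finite {n. v n \<noteq> 0} \<Longrightarrow> coords (Abs_finseq v) = v"
  by (simp add: Abs_finseq_inverse Rinf_def)

definition mat_below :: "nat \<Rightarrow> (nat \<Rightarrow> nat \<Rightarrow> real) \<Rightarrow> bool" where
  "mat_below N B \<longleftrightarrow> (\<forall>m n. N \<le> m \<or> N \<le> n \<longrightarrow> B m n = 0)"

definition mat_op :: "(nat \<Rightarrow> nat \<Rightarrow> real) \<Rightarrow> finseq \<Rightarrow> finseq" where
  "mat_op B x = Abs_finseq (mat_vec_inf B (coords x))"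

lemma mat_vec_inf_eq_sum:
  "mat_below N B \<Longrightarrow> mat_vec_inf B v m = (\<Sum>n<N. B m n * v n)"
  unfolding mat_vec_inf_def by (rule suminf_finite) (auto simp: mat_below_def)

lemma coords_mat_op:
  assumes "mat_below N B" shows "coords (mat_op B x) = mat_vec_inf B (coords x)"
proof -
  have "{m. mat_vec_inf B (coords x) m \<noteq> 0} \<subseteq> {..<N}"
    unfolding mat_vec_inf_eq_sum[OF assms] using assms by (auto simp: mat_below_def not_less intro!: sum.neutral)
  then have "finite {m. mat_vec_inf B (coords x) m \<noteq> 0}" by (rule finite_subset) simp
  then show ?thesis unfolding mat_op_def by (rule coords_Abs_finseq)
qed

lemma coords_mat_op_sum: "mat_below N B \<Longrightarrow> coords (mat_op B x) m = (\<Sum>n<N. B m n * coords x n)"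
  by (simp add: coords_mat_op mat_vec_inf_eq_sum)

lemma linear_mat_op: "mat_below N B \<Longrightarrow> linear (mat_op B)"
  by (intro linearI finseq_eqI)
    (simp_all add: coords_mat_op_sum distrib_left sum.distrib sum_distrib_left mult.left_commute)

lemma coords_mat_op_ge: "mat_below N B \<Longrightarrow> N \<le> m \<Longrightarrow> coords (mat_op B x) m = 0"
  by (simp add: coords_mat_op_sum mat_below_def)

lemma mat_op_inner:
  assumes "mat_below N B"
  shows "mat_op B x \<bullet> y = (\<Sum>m<N. \<Sum>n<N. B m n * coords x n * coords y m)"
proof -
  have "mat_op B x \<bullet> y = (\<Sum>m<N. coords (mat_op B x) m * coords y m)"
    using coords_mat_op_ge[OF assms] by (intro inner_finseq_eq_sum) (auto simp: not_less)
  then show ?thesis by (simp add: coords_mat_op_sum[OF assms] sum_distrib_right)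
qed

lemma mat_op_self_adjoint:
  assumes "mat_below N B" "\<And>m n. B m n = B n m"
  shows "mat_op B x \<bullet> y = x \<bullet> mat_op B y"
proof -
  have "mat_op B x \<bullet> y = (\<Sum>n<N. \<Sum>m<N. B m n * coords x n * coords y m)"
    unfolding mat_op_inner[OF assms(1)] by (rule sum.swap)
  also have "\<dots> = mat_op B y \<bullet> x"
    unfolding mat_op_inner[OF assms(1)] by (intro sum.cong refl) (simp add: assms(2) mult.assoc mult.commute)
  finally show ?thesis by (simp add: inner_commute)
qed

section \<open>Attainment of the Rayleigh maximum by compactness\<close>

lemma continuous_on_quadratic:
  "continuous_on UNIV (\<lambda>g :: nat \<Rightarrow> real. \<Sum>m<N. \<Sum>n<N. B m n * g n * g m)"
  by (intro continuous_intros continuous_on_subset[OF continuous_on_product_coordinates]) auto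

text \<open>Vectors supported below \<open>N\<close> are viewed as functions in the product
  topology, where a box is compact by Tychonoff's theorem; the coordinates from \<open>N\<close> on
  are pinned to 0.\<close>

lemma compact_box_finseq:
  "compact {g :: nat \<Rightarrow> real. \<forall>n. g n \<in> (if n < N then {-1..1} else {0})}"
proof -
  let ?S = "\<lambda>n. if n < N then {-1..1} else {0::real}"
  have "compactin (product_topology (\<lambda>n. euclidean) UNIV) (PiE UNIV ?S)"
    by (subst compactin_PiE) auto
  then have "compact (PiE UNIV ?S)"
    by (simp add: euclidean_product_topology)
  moreover have "PiE UNIV ?S = {g. \<forall>n. g n \<in> ?S n}" by (simp add: PiE_def Pi_def)
  ultimately show ?thesis by simp
qed

lemma subspace_below: "subspace {x. \<forall>n\<ge>N. coords x n = 0}"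
  by (rule subspaceI) auto

text \<open>\<open>K\<close> consists of the coordinate functions of the unit vectors orthogonal to
  \<open>u\<close> and supported below \<open>N\<close>; the normalized \<open>w\<close> shows that
  it is nonempty. Homogeneity extends the maximum from unit vectors to all admissible ones.\<close>

lemma mat_op_attains_max:
  fixes u :: finseq
  assumes B: "mat_below N B"
    and u: "\<forall>n\<ge>N. coords u n = 0" and w: "\<forall>n\<ge>N. coords w n = 0" "w \<noteq> 0" "w \<bullet> u = 0"
  shows "\<exists>v\<in>{x. \<forall>n\<ge>N. coords x n = 0}. v \<bullet> v = 1 \<and> v \<bullet> u = 0 \<and>
    (\<forall>x\<in>{x. \<forall>n\<ge>N. coords x n = 0}. x \<bullet> u = 0 \<longrightarrow> mat_op B x \<bullet> x \<le> (mat_op B v \<bullet> v) * (x \<bullet> x))"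
proof -
  define q where "q g = (\<Sum>m<N. \<Sum>n<N. B m n * g n * g m)" for g :: "nat \<Rightarrow> real"
  define K where "K = {g :: nat \<Rightarrow> real. \<forall>n. g n \<in> (if n < N then {-1..1} else {0})}
      \<inter> {g. (\<Sum>n<N. g n * g n) = 1} \<inter> {g. (\<Sum>n<N. g n * coords u n) = 0}"
  have inner_eq: "x \<bullet> y = (\<Sum>n<N. coords x n * coords y n)" if "\<forall>n\<ge>N. coords x n = 0" for x y
    using that by (intro inner_finseq_eq_sum) auto
  have q: "mat_op B x \<bullet> x = q (coords x)" for x by (simp add: q_def mat_op_inner[OF B])
  have inK: "coords x \<in> K" if "\<forall>n\<ge>N. coords x n = 0" "x \<bullet> x = 1" "x \<bullet> u = 0" for x
  proof -
    have "norm x = 1" using that(2) by (simp add: norm_eq_sqrt_inner)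
    then have "\<bar>coords x n\<bar> \<le> 1" for n using abs_coords_le_norm[of x n] by simp
    then show ?thesis using that by (auto simp: K_def inner_eq[OF that(1), symmetric] abs_le_iff minus_le_iff)
  qed
  have fromK: "\<exists>x. coords x = g \<and> (\<forall>n\<ge>N. coords x n = 0) \<and> x \<bullet> x = 1 \<and> x \<bullet> u = 0" if "g \<in> K" for g
  proof -
    have g0: "g n = 0" if "n \<ge> N" for n
    proof -
      have "g n \<in> (if n < N then {-1..1} else {0})" using \<open>g \<in> K\<close> unfolding K_def by blast
      then show ?thesis using that by simp
    qed
    then have "{n. g n \<noteq> 0} \<subseteq> {..<N}" by (auto simp: not_less[symmetric])
    then have c: "coords (Abs_finseq g) = g" by (intro coords_Abs_finseq) (rule finite_subset, auto)
    then show ?thesis using that g0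
      by (intro exI[of _ "Abs_finseq g"]) (auto simp: inner_eq K_def)
  qed
  have "compact K" unfolding K_def
    by (intro compact_Int_closed compact_box_finseq closed_Collect_eq continuous_intros
        continuous_on_subset[OF continuous_on_product_coordinates]) auto
  moreover have "coords (w /\<^sub>R norm w) \<in> K"
    using w by (intro inK) (auto simp: power2_norm_eq_inner[symmetric] power2_eq_square)
  moreover have "continuous_on K q"
    unfolding q_def by (rule continuous_on_subset[OF continuous_on_quadratic]) simp
  ultimately obtain g where g: "g \<in> K" "\<And>h. h \<in> K \<Longrightarrow> q h \<le> q g"
    using continuous_attains_sup[of K q] by blast
  obtain v where v: "coords v = g" "\<forall>n\<ge>N. coords v n = 0" "v \<bullet> v = 1" "v \<bullet> u = 0"
    using fromK[OF g(1)] by blast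
  have "mat_op B x \<bullet> x \<le> (mat_op B v \<bullet> v) * (x \<bullet> x)"
    if x: "\<forall>n\<ge>N. coords x n = 0" "x \<bullet> u = 0" for x
  proof (cases "x = 0")
    case True then show ?thesis using linear_0[OF linear_mat_op[OF B]] by simp
  next
    case False
    let ?y = "x /\<^sub>R norm x"
    have "coords ?y \<in> K"
      using x False by (intro inK) (auto simp: power2_norm_eq_inner[symmetric] power2_eq_square)
    then have "mat_op B ?y \<bullet> ?y \<le> mat_op B v \<bullet> v" using g(2) by (simp only: q v(1))
    then have "(mat_op B x \<bullet> x) / (norm x)\<^sup>2 \<le> mat_op B v \<bullet> v"
      using linear_scale[OF linear_mat_op[OF B]] by (simp add: power2_eq_square divide_inverse mult.commute mult.left_commute)
    then show ?thesis using False by (simp add: pos_divide_le_eq power2_norm_eq_inner)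
  qed
  then show ?thesis using v by blast
qed

section \<open>From abstract eigenpairs to the projection matrix\<close>

lemma top_eigenpair_iff:
  assumes "mat_below N B"
  shows "top_eigenpair B (coords u) (coords v) \<longleftrightarrow> top_pair (mat_op B) u v"
proof -
  have eq: "mat_vec_inf B (coords x) = (\<lambda>n. l * coords x n) \<longleftrightarrow> mat_op B x = l *\<^sub>R x" for x l
  proof
    assume "mat_vec_inf B (coords x) = (\<lambda>n. l * coords x n)"
    then show "mat_op B x = l *\<^sub>R x" by (intro finseq_eqI) (simp add: coords_mat_op[OF assms])
  next
    assume "mat_op B x = l *\<^sub>R x"
    then show "mat_vec_inf B (coords x) = (\<lambda>n. l * coords x n)"
      using coords_mat_op[OF assms, of x] by (auto simp: fun_eq_iff)
  qed
  have all: "(\<forall>w\<in>Rinf. Q w) \<longleftrightarrow> (\<forall>w. Q (coords w))" for Q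
    by (metis coords coords_cases)
  have z: "coords w = (\<lambda>n. 0) \<longleftrightarrow> w = 0" for w
    by (metis coords_inject coords_zero finseq_eqI)
  show ?thesis
    unfolding top_eigenpair_def top_pair_def orthonormal_pair_def all eq inner_inf_coords z
    using coords by auto
qed

text \<open>The definite description in \<open>Gr_proj\<close> is meaningful because all top
  eigenpairs give the same projection, whose matrix entries are coordinates of the images of basis
  vectors.\<close>

lemma Gr_proj_eq:
  assumes B: "mat_below N B" and sym: "\<And>m n. B m n = B n m"
    and top: "top_pair (mat_op B) u v"
    and uniq: "\<And>u' v'. top_pair (mat_op B) u' v' \<Longrightarrow> pair_proj u' v' = pair_proj u v"
  shows "Gr_proj B = (\<lambda>m n. coords u m * coords u n + coords v m * coords v n)"
proof -
  have S: "(\<lambda>m n. (B m n + B n m) / 2) = B" by (simp add: fun_eq_iff sym[of _ "_"])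
  have entry: "coords u m * coords u n + coords v m * coords v n = coords (pair_proj u v (basis_finseq n)) m"
    for u v m n by (simp add: pair_proj_def inner_basis_finseq mult.commute)
  show ?thesis unfolding Gr_proj_def S
  proof (rule the_equality)
    show "\<exists>u' v'. top_eigenpair B u' v' \<and>
      (\<lambda>m n. coords u m * coords u n + coords v m * coords v n) = (\<lambda>m n. u' m * u' n + v' m * v' n)"
      using top top_eigenpair_iff[OF B] by blast
  next
    fix P assume "\<exists>u' v'. top_eigenpair B u' v' \<and> P = (\<lambda>m n. u' m * u' n + v' m * v' n)"
    then obtain u' v' where t: "top_eigenpair B u' v'" and P: "P = (\<lambda>m n. u' m * u' n + v' m * v' n)" by blast
    obtain x y where xy: "u' = coords x" "v' = coords y"
      using t unfolding top_eigenpair_def by (metis coords_cases)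
    then have "pair_proj x y = pair_proj u v" using t uniq top_eigenpair_iff[OF B] by simp
    then show "P = (\<lambda>m n. coords u m * coords u n + coords v m * coords v n)"
      unfolding P xy entry by simp
  qed
qed

section \<open>Matrices with two columns\<close>

abbreviation fin_tall :: "(nat \<Rightarrow> real^2) \<Rightarrow> bool" where
  "fin_tall M \<equiv> finite {n. M n \<noteq> 0}"

text \<open>The linear map from the plane to the finitely supported sequences with matrix
  \<open>M\<close>. Together with its adjoint \<open>tall_adj\<close> it turns products of tall
  matrices into compositions of maps.\<close>

definition tall :: "(nat \<Rightarrow> real^2) \<Rightarrow> real^2 \<Rightarrow> finseq" where
  "tall M w = Abs_finseq (\<lambda>n. M n \<bullet> w)"

definition tall_adj :: "(nat \<Rightarrow> real^2) \<Rightarrow> finseq \<Rightarrow> real^2" where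
  "tall_adj M x = (\<chi> a. tall M (axis a 1) \<bullet> x)"

lemma coords_tall [simp]:
  assumes "fin_tall M" shows "coords (tall M w) n = M n \<bullet> w"
proof -
  have "finite {n. M n \<bullet> w \<noteq> 0}" using assms by (rule rev_finite_subset) auto
  then show ?thesis by (simp add: tall_def coords_Abs_finseq)
qed

lemma linear_tall: "fin_tall M \<Longrightarrow> linear (tall M)"
  by (intro linearI finseq_eqI) (simp_all add: inner_add_right)

lemma vec2_expand: "(w :: real^2) = w $ 1 *\<^sub>R axis 1 1 + w $ 2 *\<^sub>R axis 2 1"
  by (simp add: vector2_eq_iff axis_def)

lemma inner_tall_adj:
  assumes "fin_tall M" shows "w \<bullet> tall_adj M x = tall M w \<bullet> x"
proof -
  have "tall M w = w $ 1 *\<^sub>R tall M (axis 1 1) + w $ 2 *\<^sub>R tall M (axis 2 1)"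
    by (subst vec2_expand[of w]) (simp only: linear_add[OF linear_tall[OF assms]] linear_scale[OF linear_tall[OF assms]])
  then show ?thesis by (simp add: tall_adj_def inner_vec_def sum_2 inner_add_left)
qed

lemma tall_transpose_mult_nth:
  assumes "fin_tall M" "fin_tall N"
  shows "tall_transpose_mult M N $ a $ c = tall M (axis a 1) \<bullet> tall N (axis c 1)"
proof -
  have "tall M (axis a 1) \<bullet> tall N (axis c 1) = (\<Sum>n | M n \<noteq> 0. M n $ a * N n $ c)"
    using assms by (subst inner_finseq_eq_sum[of "{n. M n \<noteq> 0}"]) (auto simp: inner_axis)
  also have "\<dots> = (\<Sum>n. M n $ a * N n $ c)"
    using assms(1) by (intro suminf_finite[symmetric]) auto
  finally show ?thesis by (simp add: tall_transpose_mult_def)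
qed

lemma tall_transpose_mult_vec:
  assumes "fin_tall M" "fin_tall N"
  shows "tall_transpose_mult M N *v w = tall_adj M (tall N w)"
proof -
  have "tall N w = w $ 1 *\<^sub>R tall N (axis 1 1) + w $ 2 *\<^sub>R tall N (axis 2 1)"
    by (subst vec2_expand[of w]) (simp only: linear_add[OF linear_tall[OF assms(2)]] linear_scale[OF linear_tall[OF assms(2)]])
  then show ?thesis
    by (simp add: vec_eq_iff matrix_vector_mult_def tall_adj_def tall_transpose_mult_nth[OF assms] sum_2
        inner_add_right mult.commute)
qed

lemma matrix_eqI_inner:
  fixes A B :: "real^2^2"
  assumes "\<And>x y. x \<bullet> (A *v y) = x \<bullet> (B *v y)" shows "A = B"
  using assms by (metis matrix_eq vector_eq_ldot)

lemma V2_iff: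
  "M \<in> V2 \<longleftrightarrow> fin_tall M \<and> (\<forall>x y. tall M x \<bullet> tall M y = x \<bullet> y)"
proof (cases "fin_tall M")
  case True
  have "tall_transpose_mult M M = mat 1 \<longleftrightarrow> (\<forall>x y. x \<bullet> (tall_transpose_mult M M *v y) = x \<bullet> (mat 1 *v y))"
    using matrix_eqI_inner by metis
  then show ?thesis using True
    by (simp add: V2_def tall_transpose_mult_vec inner_tall_adj)
qed (simp add: V2_def)

lemma fin_tall_mult: "fin_tall M \<Longrightarrow> fin_tall (\<lambda>n. M n v* B)"
  by (erule rev_finite_subset) auto

lemma tall_mult: "fin_tall M \<Longrightarrow> tall (\<lambda>n. M n v* B) w = tall M (B *v w)"
  by (intro finseq_eqI) (simp add: fin_tall_mult dot_lmul_matrix)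

lemma mat_tall_mult_proj:
  fixes u v :: finseq
  assumes "fin_tall M"
  defines "R \<equiv> mat_tall_mult (\<lambda>m n. coords u m * coords u n + coords v m * coords v n) M"
  shows "fin_tall R" and "tall R w = pair_proj u v (tall M w)"
proof -
  let ?P = "\<lambda>m n. coords u m * coords u n + coords v m * coords v n"
  have R: "R m = (\<Sum>n | M n \<noteq> 0. ?P m n *\<^sub>R M n)" for m
    unfolding R_def mat_tall_mult_def using assms(1) by (intro suminf_finite) auto
  have "{n. R n \<noteq> 0} \<subseteq> {n. coords u n \<noteq> 0} \<union> {n. coords v n \<noteq> 0}"
    by (auto simp: R)
  then show fin: "fin_tall R" by (rule finite_subset) (simp add: finite_support_coords)
  have "coords (pair_proj u v (tall M w)) m = R m \<bullet> w" for m
  proof -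
    have "x \<bullet> tall M w = (\<Sum>n | M n \<noteq> 0. coords x n * (M n \<bullet> w))" for x
      using assms(1) by (subst inner_finseq_eq_sum[of "{n. M n \<noteq> 0}"]) auto
    then show ?thesis
      by (simp add: pair_proj_def R inner_sum_left sum_distrib_left sum_distrib_right sum.distrib[symmetric]
          algebra_simps)
  qed
  then show "tall R w = pair_proj u v (tall M w)" using fin by (intro finseq_eqI) simp
qed

section \<open>Polar decomposition\<close>

definition pos_def2 :: "real^2^2 \<Rightarrow> bool" where
  "pos_def2 G \<longleftrightarrow> transpose G = G \<and> (\<forall>w. w \<noteq> 0 \<longrightarrow> 0 < w \<bullet> (G *v w))"

text \<open>By the Cayley-Hamilton theorem, a square root \<open>H\<close> of \<open>G\<close> satisfies
  \<open>G + det H = tr H * H\<close>, and \<open>det H\<close> and \<open>tr H\<close> are determined by \<open>G\<close>.\<close>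

definition sqrt_tr :: "real^2^2 \<Rightarrow> real" where
  "sqrt_tr G = sqrt (trace G + 2 * sqrt (det G))"

definition sqrt_mat :: "real^2^2 \<Rightarrow> real^2^2" where
  "sqrt_mat G = (1 / sqrt_tr G) *\<^sub>R (G + sqrt (det G) *\<^sub>R mat 1)"

text \<open>Cayley-Hamilton for the square root H of \<open>G\<close> gives the inverse of H as (tr
  H - H) / det H. The closed formula makes continuity in \<open>G\<close> visible.\<close>

definition inv_sqrt_mat :: "real^2^2 \<Rightarrow> real^2^2" where
  "inv_sqrt_mat G = (1 / sqrt (det G)) *\<^sub>R (sqrt_tr G *\<^sub>R mat 1 - sqrt_mat G)"

lemma matrix2_eq_iff:
  "(A :: real^2^2) = B \<longleftrightarrow> A$1$1 = B$1$1 \<and> A$1$2 = B$1$2 \<and> A$2$1 = B$2$1 \<and> A$2$2 = B$2$2"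
  by (auto simp: vec_eq_iff forall_2)

lemma matrix2_mult_nth: "((A :: real^2^2) ** B) $ i $ j = A$i$1 * B$1$j + A$i$2 * B$2$j"
  by (simp add: matrix_matrix_mult_def sum_2)

lemma mat2_nth [simp]: "(mat 1 :: real^2^2) $ 1 $ 1 = 1" "(mat 1 :: real^2^2) $ 1 $ 2 = 0"
  "(mat 1 :: real^2^2) $ 2 $ 1 = 0" "(mat 1 :: real^2^2) $ 2 $ 2 = 1"
  by (simp_all add: mat_def)

lemma trace_2: "trace (A :: real^2^2) = A$1$1 + A$2$2"
  by (simp add: trace_def sum_2)

lemma quadratic_form_2:
  "w \<bullet> ((G :: real^2^2) *v w) = G$1$1 * (w$1 * w$1) + (G$1$2 + G$2$1) * (w$1 * w$2) + G$2$2 * (w$2 * w$2)"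
  by (simp add: inner_vec_def sum_2 matrix_vector_mult_def algebra_simps)

lemma inner_matrix_vector_2: "((B :: real^2^2) *v x) \<bullet> y = x \<bullet> (transpose B *v y)"
  by (simp add: inner_vec_def sum_2 matrix_vector_mult_def transpose_def algebra_simps)

lemma symmetric_2: "transpose (G :: real^2^2) = G \<longleftrightarrow> G$2$1 = G$1$2"
  by (auto simp: matrix2_eq_iff transpose_def)

lemma pos_def2D:
  assumes "pos_def2 G"
  shows "G$2$1 = G$1$2" "0 < G$1$1" "0 < G$2$2" "0 < det G" "0 < sqrt_tr G"
proof -
  have pos: "0 < w \<bullet> (G *v w)" if "w \<noteq> 0" for w using assms that by (simp add: pos_def2_def)
  show s: "G$2$1 = G$1$2" using assms by (simp add: pos_def2_def symmetric_2)
  show a: "0 < G$1$1" using pos[of "vector [1, 0]"] by (simp add: quadratic_form_2 vector2_eq_iff)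
  show c: "0 < G$2$2" using pos[of "vector [0, 1]"] by (simp add: quadratic_form_2 vector2_eq_iff)
  \<comment> \<open>On this vector, perpendicular to the first row, the quadratic form takes the
    value \<open>G$1$1 * det G\<close>.\<close>
  have "0 < vector [- (G$1$2), G$1$1] \<bullet> (G *v vector [- (G$1$2), G$1$1])"
    by (rule pos) (use a in \<open>simp add: vector2_eq_iff\<close>)
  also have "\<dots> = G$1$1 * det G" by (simp add: quadratic_form_2 s det_2 algebra_simps)
  finally show d: "0 < det G" using a by (simp add: zero_less_mult_iff)
  then show "0 < sqrt_tr G" using a c by (simp add: sqrt_tr_def trace_2 add_pos_nonneg)
qed

lemma sqrt_mat_nth:
  "sqrt_mat G $ 1 $ 1 = (G$1$1 + sqrt (det G)) / sqrt_tr G" "sqrt_mat G $ 1 $ 2 = G$1$2 / sqrt_tr G"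
  "sqrt_mat G $ 2 $ 1 = G$2$1 / sqrt_tr G" "sqrt_mat G $ 2 $ 2 = (G$2$2 + sqrt (det G)) / sqrt_tr G"
  by (simp_all add: sqrt_mat_def)

lemma sqrt_mat:
  assumes "pos_def2 G"
  shows "transpose (sqrt_mat G) = sqrt_mat G" and "sqrt_mat G ** sqrt_mat G = G"
    and "inv_sqrt_mat G ** sqrt_mat G = mat 1" and "sqrt_mat G ** inv_sqrt_mat G = mat 1"
    and "transpose (inv_sqrt_mat G) = inv_sqrt_mat G" and "0 \<le> x \<bullet> (sqrt_mat G *v x)"
proof -
  note pd = pos_def2D[OF assms]
  define a b c d s where "a = G$1$1" "b = G$1$2" "c = G$2$2" "d = sqrt (det G)" "s = sqrt_tr G"
  have dd: "d * d = a * c - b * b" and d: "0 < d" using pd by (simp_all add: a_b_c_d_s_def det_2)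
  have ss: "s * s = a + c + 2 * d" and s: "0 < s"
    using pd d by (simp_all add: a_b_c_d_s_def sqrt_tr_def trace_2 add_nonneg_nonneg less_imp_le)
  have H: "sqrt_mat G $ 1 $ 1 = (a + d) / s" "sqrt_mat G $ 1 $ 2 = b / s"
    "sqrt_mat G $ 2 $ 1 = b / s" "sqrt_mat G $ 2 $ 2 = (c + d) / s"
    by (simp_all add: sqrt_mat_nth a_b_c_d_s_def pd(1))
  have I': "s - (a + d) / s = (c + d) / s" "s - (c + d) / s = (a + d) / s"
    using s ss by (simp_all add: field_simps)
  have I: "inv_sqrt_mat G $ 1 $ 1 = (c + d) / s / d" "inv_sqrt_mat G $ 1 $ 2 = (- b) / s / d"
    "inv_sqrt_mat G $ 2 $ 1 = (- b) / s / d" "inv_sqrt_mat G $ 2 $ 2 = (a + d) / s / d"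
  proof -
    have "inv_sqrt_mat G $ 1 $ 1 = (s - (a + d) / s) / d" "inv_sqrt_mat G $ 2 $ 2 = (s - (c + d) / s) / d"
      by (simp_all add: inv_sqrt_mat_def H a_b_c_d_s_def(4,5))
    then show "inv_sqrt_mat G $ 1 $ 1 = (c + d) / s / d" "inv_sqrt_mat G $ 2 $ 2 = (a + d) / s / d"
      by (simp_all only: I')
    show "inv_sqrt_mat G $ 1 $ 2 = (- b) / s / d" "inv_sqrt_mat G $ 2 $ 1 = (- b) / s / d"
      by (simp_all add: inv_sqrt_mat_def H a_b_c_d_s_def(4,5))
  qed
  show "transpose (sqrt_mat G) = sqrt_mat G" by (simp add: symmetric_2 H)
  show "transpose (inv_sqrt_mat G) = inv_sqrt_mat G" by (simp add: symmetric_2 I)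
  have e: "(a + d) * (a + d) + b * b = a * (s * s)" "(a + d) * b + b * (c + d) = b * (s * s)"
    "b * b + (c + d) * (c + d) = c * (s * s)" unfolding ss using dd by (simp_all add: algebra_simps)
  have frac: "x / s * (y / s) + z / s * (w / s) = (x * y + z * w) / (s * s)"
    "x / s / d * (y / s) + z / s / d * (w / s) = (x * y + z * w) / (d * (s * s))"
    "x / s * (y / s / d) + z / s * (w / s / d) = (x * y + z * w) / (d * (s * s))" for x y z w
    by (simp_all add: add_divide_distrib ac_simps)
  have G: "G$1$1 = a" "G$1$2 = b" "G$2$1 = b" "G$2$2 = c" by (simp_all add: a_b_c_d_s_def pd(1))
  have e': "b * (a + d) + (c + d) * b = b * (s * s)" unfolding e(2)[symmetric] by (simp add: algebra_simps)
  show "sqrt_mat G ** sqrt_mat G = G"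
    unfolding matrix2_eq_iff matrix2_mult_nth H G frac e e' using s by simp
  have f: "(c + d) * (a + d) + (- b) * b = d * (s * s)" "(- b) * b + (a + d) * (c + d) = d * (s * s)"
    "(a + d) * (c + d) + b * (- b) = d * (s * s)" "b * (- b) + (c + d) * (a + d) = d * (s * s)"
    unfolding ss using dd by (simp_all add: algebra_simps)
  have f': "(c + d) * b + (- b) * (c + d) = 0" "(- b) * (a + d) + (a + d) * b = 0"
    "(a + d) * (- b) + b * (a + d) = 0" "b * (c + d) + (c + d) * (- b) = 0" by simp_all
  show "inv_sqrt_mat G ** sqrt_mat G = mat 1" "sqrt_mat G ** inv_sqrt_mat G = mat 1"
    unfolding matrix2_eq_iff matrix2_mult_nth H I frac f f' mat2_nth using s d by simp_all
  have "0 \<le> (a + d) * (x$1 * x$1) + (b + b) * (x$1 * x$2) + (c + d) * (x$2 * x$2)"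
  proof -
    have "0 \<le> x \<bullet> (G *v x)" using assms by (cases "x = 0") (auto simp: pos_def2_def less_imp_le)
    then have "0 \<le> a * (x$1 * x$1) + (b + b) * (x$1 * x$2) + c * (x$2 * x$2)"
      by (simp add: quadratic_form_2 a_b_c_d_s_def pd(1))
    moreover have "0 \<le> d * (x$1 * x$1)" "0 \<le> d * (x$2 * x$2)" using d by simp_all
    ultimately show ?thesis by (simp add: distrib_right)
  qed
  then have "0 \<le> ((a + d) * (x$1 * x$1) + (b + b) * (x$1 * x$2) + (c + d) * (x$2 * x$2)) / s"
    using s by simp
  also have "\<dots> = x \<bullet> (sqrt_mat G *v x)"
    by (simp add: quadratic_form_2 H add_divide_distrib distrib_right)
  finally show "0 \<le> x \<bullet> (sqrt_mat G *v x)" .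
qed

text \<open>Once det H is known to be nonnegative, det H and tr H are the numbers computed from
  \<open>G\<close>, and Cayley-Hamilton leaves no choice for \<open>H\<close>.\<close>

lemma sqrt_mat_unique:
  assumes G: "pos_def2 G" and H: "transpose H = H" "\<And>x. 0 \<le> x \<bullet> (H *v x)" "H ** H = G"
  shows "H = sqrt_mat G"
proof -
  define p q t where "p = H$1$1" "q = H$1$2" "t = H$2$2"
  have q: "H$2$1 = q" using H(1) by (simp add: symmetric_2 p_q_t_def)
  have Gs: "G$1$1 = p * p + q * q" "G$1$2 = p * q + q * t" "G$2$1 = q * p + t * q" "G$2$2 = q * q + t * t"
    unfolding H(3)[symmetric] by (simp_all add: matrix2_mult_nth p_q_t_def(1,3) p_q_t_def(2)[symmetric] q)
  have p: "0 \<le> p" using H(2)[of "axis 1 1"] by (simp add: quadratic_form_2 axis_def p_q_t_def)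
  have t: "0 \<le> t" using H(2)[of "axis 2 1"] by (simp add: quadratic_form_2 axis_def p_q_t_def)
  have detG: "det G = (p * t - q * q)\<^sup>2" by (simp add: det_2 Gs power2_eq_square algebra_simps)
  have "0 \<le> p * (p * t - q * q)"
    using H(2)[of "vector [- q, p]"] by (simp add: quadratic_form_2 q p_q_t_def(1,3)[symmetric] p_q_t_def(2)[symmetric] algebra_simps)
  then have pt: "0 \<le> p * t - q * q"
  proof (cases "p = 0")
    case True
    \<comment> \<open>For p = 0 the form at this vector equals \<open>- (q * q * (t + 2))\<close>,
      so nonnegativity forces q = 0.\<close>
    have "0 \<le> p * ((t + 1) * (t + 1)) - 2 * q * ((t + 1) * q) + t * (q * q)"
      using H(2)[of "vector [- (t + 1), q]"]
      by (simp add: quadratic_form_2 q p_q_t_def(1,3)[symmetric] p_q_t_def(2)[symmetric] algebra_simps)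
    then have "q * q * (t + 2) \<le> 0" using True by (simp add: algebra_simps)
    then have "q = 0"
      using t mult_pos_pos[of "q * q" "t + 2"] not_real_square_gt_zero[of q] by linarith
    then show ?thesis using True by simp
  qed (use p in \<open>simp add: zero_le_mult_iff\<close>)
  have d: "sqrt (det G) = p * t - q * q" unfolding detG using pt by simp
  have "trace G + 2 * sqrt (det G) = (p + t)\<^sup>2"
    unfolding d trace_2 Gs by (simp add: power2_eq_square algebra_simps)
  then have s: "sqrt_tr G = p + t" using p t by (simp add: sqrt_tr_def)
  then have "p + t > 0" using pos_def2D(5)[OF G] by simp
  moreover have e: "p * p + q * q + (p * t - q * q) = p * (p + t)" "p * q + q * t = q * (p + t)"
    "q * p + t * q = q * (p + t)" "q * q + t * t + (p * t - q * q) = t * (p + t)"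
    by (simp_all add: algebra_simps)
  ultimately show ?thesis
    unfolding matrix2_eq_iff sqrt_mat_nth s d Gs e by (simp add: p_q_t_def(1,3) q) (simp add: p_q_t_def(2))
qed

text \<open>\<open>inv_sqrt_mat G\<close> is a combination of \<open>G\<close> and the identity
  whose coefficients depend only on trace and determinant, and these are invariant under orthogonal
  conjugation.\<close>

lemma inv_sqrt_mat_conj:
  assumes "orthogonal_matrix A"
  shows "inv_sqrt_mat (transpose A ** G ** A) = transpose A ** inv_sqrt_mat G ** A"
proof -
  have A: "transpose A ** A = mat 1" "A ** transpose A = mat 1"
    using assms by (simp_all add: orthogonal_matrix_def)
  have "det (transpose A ** G ** A) = det G * det (transpose A ** A)"
    by (simp add: det_mul)
  then have d: "det (transpose A ** G ** A) = det G" by (simp add: A)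
  have "trace (transpose A ** G ** A) = trace (A ** (transpose A ** G))" by (rule trace_mul_sym)
  then have t: "trace (transpose A ** G ** A) = trace G" by (simp add: matrix_mul_assoc A)
  have s: "sqrt_tr (transpose A ** G ** A) = sqrt_tr G" by (simp add: sqrt_tr_def d t)
  have "B ** (c *\<^sub>R X + k *\<^sub>R mat 1) ** C = c *\<^sub>R (B ** X ** C) + k *\<^sub>R (B ** C)"
    for c k and B C X :: "real^2^2"
    by (simp add: matrix2_eq_iff matrix2_mult_nth algebra_simps)
  then have lin: "transpose A ** (c *\<^sub>R X + k *\<^sub>R mat 1) ** A = c *\<^sub>R (transpose A ** X ** A) + k *\<^sub>R mat 1"
    for c k and X :: "real^2^2" by (simp add: A)
  have form: "inv_sqrt_mat G = (- 1 / (sqrt (det G) * sqrt_tr G)) *\<^sub>R G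
      + ((sqrt_tr G - sqrt (det G) / sqrt_tr G) / sqrt (det G)) *\<^sub>R mat 1" for G
    by (simp add: matrix2_eq_iff inv_sqrt_mat_def sqrt_mat_nth diff_divide_distrib add_divide_distrib mult.commute)
  show ?thesis unfolding form[of "transpose A ** G ** A"] form[of G] d s lin ..
qed

section \<open>Continuity of matrix operations, and the polar factor in closed form\<close>

lemma continuous_on_matrix2:
  assumes "\<And>a c. continuous_on S (\<lambda>b. F b $ a $ c)"
  shows "continuous_on S (F :: 'b::topological_space \<Rightarrow> real^2^2)"
proof -
  have "continuous_on S (\<lambda>b. \<chi> a c. F b $ a $ c)"
    by (intro continuous_on_vec_lambda assms)
  then show ?thesis by simp
qed

lemma continuous_on_matrix_mult [continuous_intros]:
  fixes F G :: "'b::topological_space \<Rightarrow> real^2^2"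
  assumes "continuous_on S F" "continuous_on S G"
  shows "continuous_on S (\<lambda>b. F b ** G b)"
  by (rule continuous_on_matrix2) (simp add: matrix2_mult_nth, intro continuous_intros assms)

lemma continuous_on_inv_sqrt_mat:
  assumes "continuous_on S G" "\<And>b. b \<in> S \<Longrightarrow> pos_def2 (G b)"
  shows "continuous_on S (\<lambda>b. inv_sqrt_mat (G b))"
proof -
  have d: "continuous_on S (\<lambda>b. det (G b))" unfolding det_2 by (intro continuous_intros assms(1))
  have s: "continuous_on S (\<lambda>b. sqrt_tr (G b))"
    unfolding sqrt_tr_def trace_2 by (intro continuous_intros assms(1) d)
  have "0 < det (G b)" "0 < sqrt_tr (G b)" if "b \<in> S" for b using pos_def2D[OF assms(2)[OF that]] by auto
  then show ?thesis unfolding inv_sqrt_mat_def sqrt_mat_def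
    by (intro continuous_intros assms(1) d s) (auto simp: less_imp_neq[symmetric])
qed

text \<open>Injectivity makes the Gram matrix positive definite. Every admissible \<open>H\<close>
  then equals its square root, which is invertible, so the other factor is forced.\<close>

lemma polar_factor_eq:
  assumes fin: "fin_tall M" and inj: "\<And>w. w \<noteq> 0 \<Longrightarrow> tall M w \<noteq> 0"
  defines "G \<equiv> tall_transpose_mult M M"
  shows "pos_def2 G" and "polar_factor M = (\<lambda>n. M n v* inv_sqrt_mat G)" and "polar_factor M \<in> V2"
proof -
  have Gvec: "x \<bullet> (G *v y) = tall M x \<bullet> tall M y" for x y
    unfolding G_def by (simp add: tall_transpose_mult_vec fin inner_tall_adj)
  have "transpose G = G"
    by (simp add: symmetric_2 G_def tall_transpose_mult_nth fin inner_commute)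
  then show G: "pos_def2 G" using inj by (auto simp: pos_def2_def Gvec)
  let ?H = "sqrt_mat G" and ?B = "inv_sqrt_mat G"
  let ?Q = "\<lambda>n. M n v* ?B"
  note H = sqrt_mat[OF G]
  have "?B ** (?H ** ?H) ** ?B = (?B ** ?H) ** (?H ** ?B)" by (simp only: matrix_mul_assoc)
  then have BGB: "?B ** G ** ?B = mat 1" by (simp only: H(2-4) matrix_mul_lid)
  have Q: "?Q \<in> V2" unfolding V2_iff
  proof (intro conjI allI)
    show "fin_tall ?Q" by (rule fin_tall_mult[OF fin])
    fix x y
    have "tall ?Q x \<bullet> tall ?Q y = (?B *v x) \<bullet> (G *v (?B *v y))" by (simp add: tall_mult fin Gvec)
    also have "\<dots> = x \<bullet> ((?B ** G ** ?B) *v y)"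
      by (simp only: inner_matrix_vector_2 H(5) matrix_vector_mul_assoc matrix_mul_assoc)
    finally show "tall ?Q x \<bullet> tall ?Q y = x \<bullet> y" by (simp add: BGB)
  qed
  have "polar_factor M = ?Q" unfolding polar_factor_def
  proof (rule the_equality)
    show "?Q \<in> V2 \<and> (\<exists>H. transpose H = H \<and> (\<forall>x. 0 \<le> x \<bullet> (H *v x)) \<and>
        H ** H = tall_transpose_mult M M \<and> M = (\<lambda>n. ?Q n v* H))"
      using Q H by (intro conjI exI[of _ ?H]) (simp_all add: G_def[symmetric] vector_matrix_mul_assoc)
  next
    fix Q' assume "Q' \<in> V2 \<and> (\<exists>H. transpose H = H \<and> (\<forall>x. 0 \<le> x \<bullet> (H *v x)) \<and>
        H ** H = tall_transpose_mult M M \<and> M = (\<lambda>n. Q' n v* H))"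
    then obtain H' where H': "transpose H' = H'" "\<And>x. 0 \<le> x \<bullet> (H' *v x)" "H' ** H' = G"
      "M = (\<lambda>n. Q' n v* H')" unfolding G_def by blast
    have "H' = ?H" by (rule sqrt_mat_unique[OF G H'(1-3)])
    then have "M n v* ?B = Q' n" for n
      using fun_cong[OF H'(4), of n] by (simp add: vector_matrix_mul_assoc H(4))
    then show "Q' = ?Q" by auto
  qed
  then show "polar_factor M = ?Q" "polar_factor M \<in> V2" using Q by simp_all
qed

section \<open>The classifying projection at a point\<close>

definition blk :: "finseq \<Rightarrow> nat \<Rightarrow> real^2" where
  "blk x i = vector [coords x (2 * i), coords x (2 * i + 1)]"

lemma blk_nth [simp]: "blk x i $ 1 = coords x (2 * i)" "blk x i $ 2 = coords x (2 * i + 1)"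
  by (simp_all add: blk_def)

lemma blk_diff: "blk (x - y) i = blk x i - blk y i"
  by (simp add: vector2_eq_iff)

lemma finite_blk: "finite {i. blk x i \<noteq> 0}"
proof -
  have "{i. blk x i \<noteq> 0} \<subseteq> (\<lambda>n. n div 2) ` {n. coords x n \<noteq> 0}"
  proof
    fix i assume "i \<in> {i. blk x i \<noteq> 0}"
    then consider "coords x (2 * i) \<noteq> 0" | "coords x (2 * i + 1) \<noteq> 0" by (auto simp: vector2_eq_iff)
    then show "i \<in> (\<lambda>n. n div 2) ` {n. coords x n \<noteq> 0}"
      by cases (force intro: image_eqI[of _ _ "2 * i"], force intro: image_eqI[of _ _ "2 * i + 1"])
  qed
  then show ?thesis using finite_support_coords finite_surj by blast
qed

lemma sum_pairs: "(\<Sum>n<2 * N::nat. f n) = (\<Sum>i<N. f (2 * i) + f (2 * i + 1) :: real)"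
  by (induction N) auto

lemma inner_blk_below:
  assumes "\<forall>n\<ge>2 * N. coords x n = 0"
  shows "x \<bullet> y = (\<Sum>i<N. blk x i \<bullet> blk y i)"
proof -
  have "x \<bullet> y = (\<Sum>n<2 * N. coords x n * coords y n)"
    using assms by (intro inner_finseq_eq_sum) auto
  then show ?thesis by (simp add: sum_pairs inner_vec_def sum_2)
qed

lemma coords_eq_blk: "coords x n = blk x (n div 2) $ (if even n then 1 else 2)"
  by (auto elim!: evenE oddE)

lemma inner_blk:
  assumes "finite F" "\<And>i. i \<notin> F \<Longrightarrow> blk x i = 0"
  shows "x \<bullet> y = (\<Sum>i\<in>F. blk x i \<bullet> blk y i)"
proof -
  obtain N where N: "F \<subseteq> {..<N}" using assms(1) finite_nat_iff_bounded by blast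
  have "coords x n = 0" if "2 * N \<le> n" for n
  proof -
    have "n div 2 \<notin> F" using that N by auto
    then show ?thesis using assms(2) by (simp add: coords_eq_blk)
  qed
  then have "x \<bullet> y = (\<Sum>i<N. blk x i \<bullet> blk y i)" by (intro inner_blk_below) blast
  also have "\<dots> = (\<Sum>i\<in>F. blk x i \<bullet> blk y i)"
    using N assms(2) by (intro sum.mono_neutral_right) auto
  finally show ?thesis .
qed

lemma norm_blk:
  assumes "finite F" "\<And>i. i \<notin> F \<Longrightarrow> blk x i = 0"
  shows "(norm x)\<^sup>2 = (\<Sum>i\<in>F. (norm (blk x i))\<^sup>2)"
  using inner_blk[OF assms, of x] by (simp add: power2_norm_eq_inner)

lemma orthogonal_inner:
  "orthogonal_matrix (A :: real^2^2) \<Longrightarrow> (A *v x) \<bullet> (A *v y) = x \<bullet> y"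
  by (simp add: inner_matrix_vector_2 matrix_vector_mul_assoc orthogonal_matrix_def)

lemma tall_adj_eq_sum:
  assumes "\<forall>n\<ge>N. M n = 0"
  shows "tall_adj M x = (\<Sum>n<N. coords x n *\<^sub>R M n)"
proof -
  have "{n. M n \<noteq> 0} \<subseteq> {..<N}" using assms by (auto simp: not_le[symmetric])
  then have fin: "fin_tall M" by (rule finite_subset) simp
  have "tall M w \<bullet> x = (\<Sum>n<N. (M n \<bullet> w) * coords x n)" for w
    using assms fin by (subst inner_finseq_eq_sum[of "{..<N}"]) auto
  then show ?thesis
    by (simp add: vec_eq_iff tall_adj_def inner_axis mult.commute)
qed

lemma Psi_eq_0:
  assumes "\<forall>i\<in>J. \<rho> i b \<noteq> 0 \<longrightarrow> i < N" "2 * N \<le> n"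
  shows "Psi J \<rho> \<Omega> j b n = 0"
  using assms(1)[THEN bspec, of "n div 2"] assms(2) by (auto simp: Psi_def Let_def)

lemma fin_Psi:
  assumes "finite {j\<in>J. \<rho> j b \<noteq> 0}" shows "fin_tall (Psi J \<rho> \<Omega> j b)"
proof (rule finite_subset)
  show "{n. Psi J \<rho> \<Omega> j b n \<noteq> 0} \<subseteq> (\<Union>i\<in>{j\<in>J. \<rho> j b \<noteq> 0}. {2 * i, 2 * i + 1})"
    by (auto simp: Psi_def Let_def split: if_splits elim!: evenE oddE)
qed (use assms in simp)

lemma blk_tall_Psi:
  assumes "finite {j\<in>J. \<rho> j b \<noteq> 0}"
  shows "blk (tall (Psi J \<rho> \<Omega> j b) w) i =
    (if i \<in> J \<and> \<rho> i b \<noteq> 0 then sqrt (\<rho> i b) *\<^sub>R (\<Omega> i j b *v w) else 0)"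
proof -
  let ?M = "Psi J \<rho> \<Omega> j b"
  have c: "coords (tall ?M w) n = ?M n \<bullet> w" for n
    by (rule coords_tall) (rule fin_Psi[where J = J and \<rho> = \<rho> and b = b, OF assms])
  have "?M (2 * i) \<bullet> w = (if i \<in> J \<and> \<rho> i b \<noteq> 0 then sqrt (\<rho> i b) *\<^sub>R (\<Omega> i j b *v w) else 0) $ 1"
    "?M (2 * i + 1) \<bullet> w = (if i \<in> J \<and> \<rho> i b \<noteq> 0 then sqrt (\<rho> i b) *\<^sub>R (\<Omega> i j b *v w) else 0) $ 2"
    by (simp_all add: Psi_def matrix_vector_mult_def inner_vec_def sum_2 algebra_simps)
  then show ?thesis by (simp only: vector2_eq_iff blk_nth c)
qed

lemma mat_op_pair_proj:
  "mat_op (\<lambda>m n. coords u m * coords u n + coords v m * coords v n) = pair_proj u v" (is "mat_op ?P = _")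
proof
  fix x
  have "finite ({n. coords u n \<noteq> 0} \<union> {n. coords v n \<noteq> 0})" by (simp add: finite_support_coords)
  then obtain N where N: "{n. coords u n \<noteq> 0} \<union> {n. coords v n \<noteq> 0} \<subseteq> {..<N}"
    unfolding finite_nat_iff_bounded ..
  have z: "coords u n = 0" "coords v n = 0" if "N \<le> n" for n using N that by (auto simp: subset_iff not_less[symmetric])
  have B: "mat_below N ?P" by (auto simp: mat_below_def z)
  have i: "u \<bullet> x = (\<Sum>n<N. coords u n * coords x n)" "v \<bullet> x = (\<Sum>n<N. coords v n * coords x n)"
    by (rule inner_finseq_eq_sum; auto simp: z)+
  show "mat_op ?P x = pair_proj u v x"
    by (rule finseq_eqI)
      (simp add: coords_mat_op_sum[OF B] pair_proj_def i sum_distrib_left sum_distrib_right sum.distrib algebra_simps)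
qed

text \<open>\<open>K\<close> stands for the set of charts containing \<open>b\<close>, while the
  sums run over the possibly smaller set of charts with nonzero weight. Defects are measured in the
  operator norm to avoid the factor sqrt 2, and \<kappa> squared below 1/2 says that the eigenvalue
  bounds \<kappa> squared and 1 - \<kappa> squared leave a gap.\<close>

locale cocycle_at =
  fixes J K :: "nat set" and \<rho> :: "nat \<Rightarrow> 'b \<Rightarrow> real" and \<Omega> :: "'b cochain" and b :: 'b and \<kappa> :: real
  assumes fin: "finite {j\<in>J. \<rho> j b \<noteq> 0}" and rho_nonneg: "\<And>j. j \<in> J \<Longrightarrow> 0 \<le> \<rho> j b"
    and rho_sum: "(\<Sum>j\<in>{j\<in>J. \<rho> j b \<noteq> 0}. \<rho> j b) = 1"
    and SK: "{j\<in>J. \<rho> j b \<noteq> 0} \<subseteq> K"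
    and orth: "\<And>i j. i \<in> K \<Longrightarrow> j \<in> K \<Longrightarrow> orthogonal_matrix (\<Omega> i j b)"
    and close: "\<And>i j k w. i \<in> K \<Longrightarrow> j \<in> K \<Longrightarrow> k \<in> K \<Longrightarrow>
      norm ((\<Omega> i j b ** \<Omega> j k b - \<Omega> i k b) *v w) \<le> \<kappa> * norm w"
    and kappa: "0 \<le> \<kappa>" "\<kappa>\<^sup>2 < 1/2"
begin

abbreviation S :: "nat set" where "S \<equiv> {j\<in>J. \<rho> j b \<noteq> 0}"
abbreviation T :: "nat \<Rightarrow> real^2 \<Rightarrow> finseq" where "T j \<equiv> tall (Psi J \<rho> \<Omega> j b)"
abbreviation Tadj :: "nat \<Rightarrow> finseq \<Rightarrow> real^2" where "Tadj j \<equiv> tall_adj (Psi J \<rho> \<Omega> j b)"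
abbreviation A :: "finseq \<Rightarrow> finseq" where "A \<equiv> mat_op (cl J \<rho> \<Omega> b)"

lemmas finT = fin_Psi[where J = J and \<rho> = \<rho> and b = b and \<Omega> = \<Omega>, OF fin]
lemmas blkT = blk_tall_Psi[where J = J and \<rho> = \<rho> and b = b and \<Omega> = \<Omega>, OF fin]

lemma blkT_out: "i \<notin> S \<Longrightarrow> blk (T j w) i = 0"
  by (auto simp: blkT)

lemma T_inner: "j \<in> K \<Longrightarrow> T j x \<bullet> T j y = x \<bullet> y"
proof -
  assume j: "j \<in> K"
  have "T j x \<bullet> T j y = (\<Sum>i\<in>S. blk (T j x) i \<bullet> blk (T j y) i)"
    using fin blkT_out by (rule inner_blk)
  also have "\<dots> = (\<Sum>i\<in>S. \<rho> i b * (x \<bullet> y))"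
  proof (rule sum.cong[OF refl])
    fix i assume i: "i \<in> S"
    then have o: "orthogonal_matrix (\<Omega> i j b)" using SK orth j by blast
    show "blk (T j x) i \<bullet> blk (T j y) i = \<rho> i b * (x \<bullet> y)"
      using i rho_nonneg[of i] by (simp add: blkT orthogonal_inner[OF o] mult.assoc[symmetric])
  qed
  also have "\<dots> = x \<bullet> y" by (simp only: sum_distrib_right[symmetric] rho_sum mult_1)
  finally show ?thesis .
qed

lemma norm_T: "j \<in> K \<Longrightarrow> norm (T j x) = norm x"
  by (simp add: norm_eq_sqrt_inner T_inner)

text \<open>The weights sum to one, so the squared norm is a weighted average of the squared norms
  of the \<open>z i\<close>.\<close>

lemma norm_le_blocks:
  assumes "\<And>i. i \<notin> S \<Longrightarrow> blk x i = 0" "\<And>i. i \<in> S \<Longrightarrow> blk x i = sqrt (\<rho> i b) *\<^sub>R z i"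
    and z: "\<And>i. i \<in> S \<Longrightarrow> norm (z i) \<le> c" and c: "0 \<le> c"
  shows "norm x \<le> c"
proof (rule power2_le_imp_le)
  have "(norm x)\<^sup>2 = (\<Sum>i\<in>S. (norm (blk x i))\<^sup>2)" using fin assms(1) by (rule norm_blk)
  also have "\<dots> \<le> (\<Sum>i\<in>S. \<rho> i b * c\<^sup>2)"
  proof (rule sum_mono)
    fix i assume i: "i \<in> S"
    then have "(norm (blk x i))\<^sup>2 = \<rho> i b * (norm (z i))\<^sup>2"
      using rho_nonneg[of i] by (simp add: assms(2)[OF i] power_mult_distrib)
    also have "\<dots> \<le> \<rho> i b * c\<^sup>2"
      using i rho_nonneg[of i] z by (intro mult_left_mono power_mono) auto
    finally show "(norm (blk x i))\<^sup>2 \<le> \<rho> i b * c\<^sup>2" .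
  qed
  also have "\<dots> = c\<^sup>2" by (simp only: sum_distrib_right[symmetric] rho_sum mult_1)
  finally show "(norm x)\<^sup>2 \<le> c\<^sup>2" .
qed (rule c)

text \<open>Up to sign and weight, block \<open>i\<close> of the difference is the cocycle defect
  for \<open>i\<close>, \<open>j\<close>, \<open>k\<close>.\<close>

lemma T_close:
  assumes j: "j \<in> K" and k: "k \<in> K"
  shows "norm (T k w - T j (\<Omega> j k b *v w)) \<le> \<kappa> * norm w"
proof (rule norm_le_blocks)
  fix i assume i: "i \<in> S"
  show "blk (T k w - T j (\<Omega> j k b *v w)) i = sqrt (\<rho> i b) *\<^sub>R - ((\<Omega> i j b ** \<Omega> j k b - \<Omega> i k b) *v w)"
    using i by (simp add: blk_diff blkT matrix_vector_mult_diff_rdistrib matrix_vector_mul_assoc scaleR_diff_right)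
  show "norm (- ((\<Omega> i j b ** \<Omega> j k b - \<Omega> i k b) *v w)) \<le> \<kappa> * norm w"
    unfolding norm_minus_cancel using i SK j k by (intro close) auto
qed (use kappa in \<open>simp_all add: blk_diff blkT_out del: mem_Collect_eq\<close>)

text \<open>\<open>T k w\<close> and \<open>T j c\<close> have equal norm and are \<kappa>-close
  relative to it, so their inner product is at least
  \<open>(1 - \<kappa>\<^sup>2 / 2) * (norm w)\<^sup>2\<close>. Pairing with \<open>c\<close> and
  squaring loses at most the factor \<open>1 - \<kappa>\<^sup>2\<close>.\<close>

lemma Tadj_lower:
  assumes j: "j \<in> K" and k: "k \<in> K"
  shows "(1 - \<kappa>\<^sup>2) * (norm w)\<^sup>2 \<le> (norm (Tadj j (T k w)))\<^sup>2"
proof -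
  define c where "c = \<Omega> j k b *v w"
  have c: "norm c = norm w" by (simp add: c_def norm_orthogonal_matrix_mult orth j k)
  define p where "p = T k w \<bullet> T j c"
  have "(norm (T k w - T j c))\<^sup>2 \<le> (\<kappa> * norm w)\<^sup>2"
    using T_close[OF j k, of w] by (intro power_mono) (simp_all add: c_def)
  moreover have "(norm (x - y))\<^sup>2 = (norm x)\<^sup>2 + (norm y)\<^sup>2 - 2 * (x \<bullet> y)" for x y :: finseq
    by (simp add: power2_norm_eq_inner inner_diff_left inner_diff_right inner_commute)
  then have "(norm (T k w - T j c))\<^sup>2 = 2 * (norm w)\<^sup>2 - 2 * p"
    by (simp only: norm_T[OF j] norm_T[OF k] c p_def)
  ultimately have p: "(1 - \<kappa>\<^sup>2 / 2) * (norm w)\<^sup>2 \<le> p"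
    by (simp add: power_mult_distrib algebra_simps)
  have "p = c \<bullet> Tadj j (T k w)" unfolding p_def inner_tall_adj[OF finT] by (rule inner_commute)
  then have "p \<le> norm w * norm (Tadj j (T k w))" using norm_cauchy_schwarz[of c "Tadj j (T k w)"] c by simp
  then have "norm w * ((1 - \<kappa>\<^sup>2 / 2) * norm w) \<le> norm w * norm (Tadj j (T k w))"
    using p by (simp add: power2_eq_square algebra_simps)
  then have "(1 - \<kappa>\<^sup>2 / 2) * norm w \<le> norm (Tadj j (T k w))"
    by (cases "w = 0") (simp_all only: mult_le_cancel_left_pos zero_less_norm_iff norm_zero mult_zero_right norm_ge_zero not_False_eq_True)
  then have "((1 - \<kappa>\<^sup>2 / 2) * norm w)\<^sup>2 \<le> (norm (Tadj j (T k w)))\<^sup>2"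
    using kappa by (intro power_mono) auto
  moreover have "1 - \<kappa>\<^sup>2 \<le> (1 - \<kappa>\<^sup>2 / 2)\<^sup>2" by (simp add: power2_diff)
  then have "(1 - \<kappa>\<^sup>2) * (norm w)\<^sup>2 \<le> (1 - \<kappa>\<^sup>2 / 2)\<^sup>2 * (norm w)\<^sup>2" by (rule mult_right_mono) simp
  ultimately show ?thesis by (simp add: power_mult_distrib)
qed

text \<open>The adjoint image \<open>y\<close> is tested against itself: up to an error \<kappa>
  times the norm of \<open>y\<close>, the vector \<open>T j y\<close> lies in the image of
  \<open>T k\<close>, to which \<open>x\<close> is orthogonal.\<close>

lemma Tadj_upper:
  assumes j: "j \<in> K" and k: "k \<in> K" and x: "Tadj k x = 0"
  shows "(norm (Tadj j x))\<^sup>2 \<le> \<kappa>\<^sup>2 * (norm x)\<^sup>2"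
proof -
  define y where "y = Tadj j x"
  have "y \<bullet> y = T j y \<bullet> x" using inner_tall_adj[OF finT, of y j x] by (simp add: y_def)
  also have "\<dots> = (T j y - T k (\<Omega> k j b *v y)) \<bullet> x + (\<Omega> k j b *v y) \<bullet> Tadj k x"
    by (simp add: inner_tall_adj[OF finT] inner_diff_left)
  also have "\<dots> \<le> norm (T j y - T k (\<Omega> k j b *v y)) * norm x"
    using x norm_cauchy_schwarz by simp
  also have "\<dots> \<le> \<kappa> * norm y * norm x" by (rule mult_right_mono[OF T_close[OF k j]]) simp
  finally have "norm y * norm y \<le> norm y * (\<kappa> * norm x)"
    by (simp add: power2_norm_eq_inner[symmetric] power2_eq_square ac_simps)
  then have "norm y \<le> \<kappa> * norm x"
    using kappa by (cases "y = 0") (simp_all add: mult_le_cancel_left_pos)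
  then have "(norm y)\<^sup>2 \<le> (\<kappa> * norm x)\<^sup>2" by (intro power_mono) auto
  then show ?thesis by (simp add: y_def power_mult_distrib)
qed

lemma mat_below_cl:
  assumes "\<forall>i\<in>S. i < N" shows "mat_below (2 * N) (cl J \<rho> \<Omega> b)"
proof -
  have "Psi J \<rho> \<Omega> j b n = 0" if "2 * N \<le> n" for j n
    using assms that by (intro Psi_eq_0) auto
  then show ?thesis by (auto simp: mat_below_def cl_def)
qed

lemma bound_exists: "\<exists>N. \<forall>i\<in>S. i < N"
proof -
  obtain N where "S \<subseteq> {..<N}" using fin unfolding finite_nat_iff_bounded ..
  then show ?thesis by (intro exI[of _ N]) auto
qed

lemma cl_sym: "cl J \<rho> \<Omega> b m n = cl J \<rho> \<Omega> b n m"
  by (simp add: cl_def inner_commute)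

text \<open>\<open>cl\<close> is the weighted average of the operators \<open>T j\<close> after
  \<open>Tadj j\<close>, which reduces its form to estimates for single charts.\<close>

lemma A_inner: "A x \<bullet> y = (\<Sum>j\<in>S. \<rho> j b * (Tadj j x \<bullet> Tadj j y))"
proof -
  obtain N where N: "\<forall>i\<in>S. i < N" using bound_exists ..
  have "Psi J \<rho> \<Omega> j b n = 0" if "2 * N \<le> n" for j n
    using N that by (intro Psi_eq_0) auto
  then have adj: "Tadj j x = (\<Sum>n<2 * N. coords x n *\<^sub>R Psi J \<rho> \<Omega> j b n)" for j x
    by (intro tall_adj_eq_sum) blast
  let ?g = "\<lambda>j m n. \<rho> j b * ((coords x n *\<^sub>R Psi J \<rho> \<Omega> j b n) \<bullet> (coords y m *\<^sub>R Psi J \<rho> \<Omega> j b m))"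
  have "A x \<bullet> y = (\<Sum>m<2 * N. \<Sum>n<2 * N. \<Sum>j\<in>S. ?g j m n)"
    unfolding mat_op_inner[OF mat_below_cl[OF N]] cl_def sum_distrib_right
    by (intro sum.cong refl) (simp add: inner_commute ac_simps)
  also have "\<dots> = (\<Sum>m<2 * N. \<Sum>j\<in>S. \<Sum>n<2 * N. ?g j m n)" by (intro sum.cong refl sum.swap)
  also have "\<dots> = (\<Sum>j\<in>S. \<Sum>m<2 * N. \<Sum>n<2 * N. ?g j m n)" by (rule sum.swap)
  also have "\<dots> = (\<Sum>j\<in>S. \<rho> j b * (Tadj j x \<bullet> Tadj j y))"
    unfolding adj by (intro sum.cong refl) (simp only: inner_sum_left inner_sum_right sum_distrib_left)
  finally show ?thesis .
qed

lemma A_quadratic: "A x \<bullet> x = (\<Sum>j\<in>S. \<rho> j b * (norm (Tadj j x))\<^sup>2)"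
  by (simp add: A_inner power2_norm_eq_inner)

lemma A_lower:
  assumes "k \<in> K" shows "(1 - \<kappa>\<^sup>2) * (w \<bullet> w) \<le> A (T k w) \<bullet> T k w"
proof -
  have "(\<Sum>j\<in>S. \<rho> j b * ((1 - \<kappa>\<^sup>2) * (norm w)\<^sup>2)) \<le> A (T k w) \<bullet> T k w"
    unfolding A_quadratic using SK rho_nonneg assms
    by (intro sum_mono mult_left_mono Tadj_lower) auto
  then show ?thesis by (simp only: sum_distrib_right[symmetric] rho_sum mult_1 power2_norm_eq_inner)
qed

lemma A_upper:
  assumes "k \<in> K" "Tadj k x = 0" shows "A x \<bullet> x \<le> \<kappa>\<^sup>2 * (x \<bullet> x)"
proof -
  have "A x \<bullet> x \<le> (\<Sum>j\<in>S. \<rho> j b * (\<kappa>\<^sup>2 * (norm x)\<^sup>2))"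
    unfolding A_quadratic using SK rho_nonneg assms
    by (intro sum_mono mult_left_mono Tadj_upper[of _ k]) auto
  then show ?thesis by (simp only: sum_distrib_right[symmetric] rho_sum mult_1 power2_norm_eq_inner)
qed

lemma gap: "\<kappa>\<^sup>2 < 1 - \<kappa>\<^sup>2" using kappa by simp

lemma linear_A: "linear A" and A_self_adjoint: "A x \<bullet> y = x \<bullet> A y"
proof -
  obtain N where N: "\<forall>i\<in>S. i < N" using bound_exists ..
  show "linear A" by (rule linear_mat_op[OF mat_below_cl[OF N]])
  show "A x \<bullet> y = x \<bullet> A y" by (rule mat_op_self_adjoint[OF mat_below_cl[OF N] cl_sym])
qed

text \<open>The image of \<open>T k\<close>, for any chart of nonzero weight, is a test plane; such
  a chart exists because the weights sum to one.\<close>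

lemma gapped: "\<exists>k\<in>S. gapped_operator A (T k (axis 1 1)) (T k (axis 2 1)) (1 - \<kappa>\<^sup>2) (\<kappa>\<^sup>2)"
proof -
  have "S \<noteq> {}" using rho_sum by (metis sum.empty zero_neq_one)
  then obtain k where k: "k \<in> S" by blast
  then have kK: "k \<in> K" using SK by blast
  have T: "a *\<^sub>R T k (axis 1 1) + c *\<^sub>R T k (axis 2 1) = T k (a *\<^sub>R axis 1 1 + c *\<^sub>R axis 2 1)" for a c
    by (simp add: linear_add[OF linear_tall[OF finT]] linear_scale[OF linear_tall[OF finT]])
  have "gapped_operator A (T k (axis 1 1)) (T k (axis 2 1)) (1 - \<kappa>\<^sup>2) (\<kappa>\<^sup>2)"
    unfolding gapped_operator_def
  proof (intro conjI allI impI)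
    show "linear A" by (rule linear_A)
    show "A x \<bullet> y = x \<bullet> A y" for x y by (rule A_self_adjoint)
    show "orthonormal_pair (T k (axis 1 1)) (T k (axis 2 1))"
      by (simp add: orthonormal_pair_def T_inner[OF kK] inner_axis_axis)
    show "\<kappa>\<^sup>2 < 1 - \<kappa>\<^sup>2" by (rule gap)
    show "(1 - \<kappa>\<^sup>2) * ((a *\<^sub>R T k (axis 1 1) + c *\<^sub>R T k (axis 2 1)) \<bullet> (a *\<^sub>R T k (axis 1 1) + c *\<^sub>R T k (axis 2 1)))
        \<le> A (a *\<^sub>R T k (axis 1 1) + c *\<^sub>R T k (axis 2 1)) \<bullet> (a *\<^sub>R T k (axis 1 1) + c *\<^sub>R T k (axis 2 1))" for a c
      unfolding T T_inner[OF kK] by (rule A_lower[OF kK])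
    show "A x \<bullet> x \<le> \<kappa>\<^sup>2 * (x \<bullet> x)" if "T k (axis 1 1) \<bullet> x = 0" "T k (axis 2 1) \<bullet> x = 0" for x
      using that by (intro A_upper[OF kK]) (simp add: tall_adj_def vector2_eq_iff)
  qed
  then show ?thesis using k by blast
qed

abbreviation P :: "finseq \<Rightarrow> finseq" where "P \<equiv> mat_op (Gr_proj (cl J \<rho> \<Omega> b))"

lemma spectral_P:
  obtains u v where "spectral_pair A (1 - \<kappa>\<^sup>2) u v" "P = pair_proj u v"
    "Gr_proj (cl J \<rho> \<Omega> b) = (\<lambda>m n. coords u m * coords u n + coords v m * coords v n)"
    "\<And>x. u \<bullet> x = 0 \<Longrightarrow> v \<bullet> x = 0 \<Longrightarrow> A x \<bullet> x \<le> \<kappa>\<^sup>2 * (x \<bullet> x)"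
proof -
  obtain k where k: "k \<in> S" "gapped_operator A (T k (axis 1 1)) (T k (axis 2 1)) (1 - \<kappa>\<^sup>2) (\<kappa>\<^sup>2)"
    using gapped by blast
  interpret gapped_operator A "T k (axis 1 1)" "T k (axis 2 1)" "1 - \<kappa>\<^sup>2" "\<kappa>\<^sup>2" by (rule k(2))
  obtain N where N: "\<forall>i\<in>S. i < N" using bound_exists ..
  note B = mat_below_cl[OF N]
  \<comment> \<open>The sequences supported in blocks below \<open>N\<close> contain both the range
    of \<open>A\<close> and the image of \<open>T k\<close>, and on them the maximum is
    attained.\<close>
  let ?E = "{x. \<forall>n\<ge>2 * N. coords x n = 0}"
  have TE: "T k w \<in> ?E" for w
  proof -
    have "Psi J \<rho> \<Omega> k b n = 0" if "2 * N \<le> n" for n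
      using N that by (intro Psi_eq_0) auto
    then show ?thesis by (simp add: finT)
  qed
  have "\<exists>u\<in>?E. \<exists>v\<in>?E. spectral_pair A (1 - \<kappa>\<^sup>2) u v"
  proof (rule spectral_pair_exists[OF subspace_below _ TE TE])
    show "A x \<in> ?E" for x using coords_mat_op_ge[OF B] by blast
  next
    fix u w assume "u \<in> ?E" "w \<in> ?E" "w \<noteq> 0" "w \<bullet> u = 0"
    then show "\<exists>v\<in>?E. v \<bullet> v = 1 \<and> v \<bullet> u = 0 \<and> (\<forall>x\<in>?E. x \<bullet> u = 0 \<longrightarrow> A x \<bullet> x \<le> (A v \<bullet> v) * (x \<bullet> x))"
      using mat_op_attains_max[OF B, of u w] by blast
  qed
  then obtain u v where uv: "spectral_pair A (1 - \<kappa>\<^sup>2) u v" by blast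
  show ?thesis
  proof
    show "spectral_pair A (1 - \<kappa>\<^sup>2) u v" by (rule uv)
    show Gr: "Gr_proj (cl J \<rho> \<Omega> b) = (\<lambda>m n. coords u m * coords u n + coords v m * coords v n)"
      by (rule Gr_proj_eq[OF B cl_sym spectral_pair_top_pair[OF uv] top_pair_unique[OF uv]])
    show "P = pair_proj u v" unfolding Gr by (rule mat_op_pair_proj)
    show "A x \<bullet> x \<le> \<kappa>\<^sup>2 * (x \<bullet> x)" if "u \<bullet> x = 0" "v \<bullet> x = 0" for x
      by (rule spectral_pair_perp[OF uv that])
  qed
qed

end

lemma spectral_pair_range_lower:
  assumes "spectral_pair A \<alpha> u v" "pair_proj u v x = x" "linear A"
  shows "\<alpha> * (x \<bullet> x) \<le> A x \<bullet> x"
proof -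
  obtain l1 l2 where l: "A u = l1 *\<^sub>R u" "A v = l2 *\<^sub>R v" "l2 \<le> l1" "\<alpha> \<le> l2" and o: "orthonormal_pair u v"
    using assms(1) unfolding spectral_pair_def by blast
  have o': "u \<bullet> u = 1" "v \<bullet> v = 1" "u \<bullet> v = 0" "v \<bullet> u = 0"
    using o by (auto simp: orthonormal_pair_def inner_commute)
  obtain a c where x: "x = a *\<^sub>R u + c *\<^sub>R v" using assms(2) unfolding pair_proj_def by metis
  have "A x \<bullet> x = l1 * (a * a) + l2 * (c * c)"
    unfolding x by (simp add: linear_add[OF assms(3)] linear_scale[OF assms(3)] l inner_add_left inner_add_right o')
  moreover have "x \<bullet> x = a * a + c * c" unfolding x by (simp add: inner_add_left inner_add_right o')
  moreover have "\<alpha> * (a * a) \<le> l1 * (a * a)" "\<alpha> * (c * c) \<le> l2 * (c * c)"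
    using l by (intro mult_right_mono; simp)+
  ultimately show ?thesis by (simp add: distrib_left)
qed

lemma tall_V2_inner: "M \<in> V2 \<Longrightarrow> tall M x \<bullet> tall M y = x \<bullet> y"
  by (simp add: V2_iff)

lemma tall_V2_norm: "M \<in> V2 \<Longrightarrow> norm (tall M x) = norm x"
  by (simp add: norm_eq_sqrt_inner tall_V2_inner)

lemma tall_tall_adj:
  assumes "M \<in> V2"
  shows "tall M (tall_adj M x) = pair_proj (tall M (axis 1 1)) (tall M (axis 2 1)) x"
proof -
  have fin: "fin_tall M" using assms by (simp add: V2_iff)
  have "tall_adj M x = (tall M (axis 1 1) \<bullet> x) *\<^sub>R axis 1 1 + (tall M (axis 2 1) \<bullet> x) *\<^sub>R axis 2 1"
    by (simp add: vector2_eq_iff tall_adj_def axis_def)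
  then show ?thesis
    by (simp add: pair_proj_def linear_add[OF linear_tall[OF fin]] linear_scale[OF linear_tall[OF fin]])
qed

lemma tall_V2_orthonormal: "M \<in> V2 \<Longrightarrow> orthonormal_pair (tall M (axis 1 1)) (tall M (axis 2 1))"
  by (simp add: orthonormal_pair_def tall_V2_inner inner_axis_axis)

section \<open>Orthonormal frames of the projected plane, and exactness at a point\<close>

context cocycle_at
begin

abbreviation Q :: "nat \<Rightarrow> nat \<Rightarrow> real^2" where "Q j \<equiv> Psi_tilde J \<rho> \<Omega> j b"
abbreviation M :: "nat \<Rightarrow> nat \<Rightarrow> real^2" where
  "M j \<equiv> mat_tall_mult (Gr_proj (cl J \<rho> \<Omega> b)) (Psi J \<rho> \<Omega> j b)"

lemma A_range_lower: "P x = x \<Longrightarrow> (1 - \<kappa>\<^sup>2) * (x \<bullet> x) \<le> A x \<bullet> x"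
proof -
  assume x: "P x = x"
  obtain u v where uv: "spectral_pair A (1 - \<kappa>\<^sup>2) u v" "P = pair_proj u v" by (rule spectral_P) (rule that)
  show ?thesis using spectral_pair_range_lower[OF uv(1) x[unfolded uv(2)] linear_A] .
qed

lemma A_kernel_upper: "P x = 0 \<Longrightarrow> A x \<bullet> x \<le> \<kappa>\<^sup>2 * (x \<bullet> x)"
proof -
  assume Px: "P x = 0"
  obtain u v where uv: "spectral_pair A (1 - \<kappa>\<^sup>2) u v" "P = pair_proj u v"
    "\<And>x. u \<bullet> x = 0 \<Longrightarrow> v \<bullet> x = 0 \<Longrightarrow> A x \<bullet> x \<le> \<kappa>\<^sup>2 * (x \<bullet> x)"
    by (rule spectral_P) (rule that)
  have o: "orthonormal_pair u v" using uv(1) by (simp add: spectral_pair_def)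
  show ?thesis
    using Px unfolding uv(2) by (intro uv(3)) (metis inner_zero_right pair_proj_inner_left[OF o])+
qed

lemma tall_M:
  shows "fin_tall (M j)" and "tall (M j) w = P (T j w)"
proof -
  obtain u v where uv: "P = pair_proj u v"
    "Gr_proj (cl J \<rho> \<Omega> b) = (\<lambda>m n. coords u m * coords u n + coords v m * coords v n)"
    by (rule spectral_P) (rule that)
  show "fin_tall (M j)" unfolding uv(2) by (rule mat_tall_mult_proj(1)[OF finT])
  have "tall (M j) w = pair_proj u v (T j w)" unfolding uv(2) by (rule mat_tall_mult_proj(2)[OF finT])
  then show "tall (M j) w = P (T j w)" unfolding uv(1) .
qed

text \<open>A nonzero vector in the image of \<open>T j\<close> that is killed by \<open>P\<close>
  would violate the gap. Hence the polar decompositions exist and are unique.\<close>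

lemma tall_M_nonzero:
  assumes "j \<in> K" "w \<noteq> 0" shows "tall (M j) w \<noteq> 0"
proof
  assume "tall (M j) w = 0"
  then have "A (T j w) \<bullet> T j w \<le> \<kappa>\<^sup>2 * (w \<bullet> w)"
    using A_kernel_upper[of "T j w"] by (simp add: tall_M T_inner[OF assms(1)])
  then have "(1 - \<kappa>\<^sup>2) * (w \<bullet> w) \<le> \<kappa>\<^sup>2 * (w \<bullet> w)" using A_lower[OF assms(1), of w] by linarith
  moreover have "0 < w \<bullet> w" using assms(2) by simp
  ultimately have "1 - \<kappa>\<^sup>2 \<le> \<kappa>\<^sup>2" by (simp only: mult_le_cancel_right_pos)
  then show False using gap by simp
qed

lemma Gram_pos_def: "j \<in> K \<Longrightarrow> pos_def2 (tall_transpose_mult (M j) (M j))"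
  and Q_eq: "j \<in> K \<Longrightarrow> Q j = (\<lambda>n. M j n v* inv_sqrt_mat (tall_transpose_mult (M j) (M j)))"
  and Q_V2: "j \<in> K \<Longrightarrow> Q j \<in> V2"
  unfolding Psi_tilde_def by (rule polar_factor_eq[OF tall_M(1) tall_M_nonzero]; assumption)+

lemma finQ: "j \<in> K \<Longrightarrow> fin_tall (Q j)"
  using Q_V2 by (simp add: V2_iff)

lemma P_tall_Q: "j \<in> K \<Longrightarrow> P (tall (Q j) w) = tall (Q j) w"
proof -
  assume j: "j \<in> K"
  obtain u v where uv: "spectral_pair A (1 - \<kappa>\<^sup>2) u v" "P = pair_proj u v"
    by (rule spectral_P) (rule that)
  have o: "orthonormal_pair u v" using uv(1) by (simp add: spectral_pair_def)
  obtain B where "Q j = (\<lambda>n. M j n v* B)" using Q_eq[OF j] by blast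
  then have "tall (Q j) w = P (T j (B *v w))" by (simp add: tall_mult tall_M)
  then show ?thesis unfolding uv(2) by (simp add: pair_proj_idem[OF o])
qed

text \<open>The orthonormal columns of \<open>Q j\<close> lie in the plane fixed by
  \<open>P\<close>, and the dimensions agree. This identity removes the middle frame in products of
  transition functions, which makes them exact.\<close>

lemma Q_Q_adj: "j \<in> K \<Longrightarrow> tall (Q j) (tall_adj (Q j) x) = P x"
proof -
  assume j: "j \<in> K"
  obtain u v where uv: "spectral_pair A (1 - \<kappa>\<^sup>2) u v" "P = pair_proj u v"
    by (rule spectral_P) (rule that)
  have o: "orthonormal_pair u v" using uv(1) by (simp add: spectral_pair_def)
  have "pair_proj (tall (Q j) (axis 1 1)) (tall (Q j) (axis 2 1)) = pair_proj u v"
    by (rule pair_proj_subspaces_eq[OF tall_V2_orthonormal[OF Q_V2[OF j]] o])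
      (simp_all only: uv(2)[symmetric] P_tall_Q[OF j])
  then show ?thesis by (simp add: tall_tall_adj[OF Q_V2[OF j]] uv(2))
qed

lemma Q_adj_Q: "j \<in> K \<Longrightarrow> tall_adj (Q j) (tall (Q j) w) = w"
  by (rule vector_eq_ldot[THEN iffD1]) (simp add: inner_tall_adj[OF finQ] tall_V2_inner[OF Q_V2])

lemma Q_adj_P: "j \<in> K \<Longrightarrow> tall_adj (Q j) (P x) = tall_adj (Q j) x"
  using Q_Q_adj[of j x] Q_adj_Q[of j "tall_adj (Q j) x"] by simp

lemma Pi_Z_vec: "j \<in> K \<Longrightarrow> k \<in> K \<Longrightarrow> Pi_Z J \<rho> \<Omega> j k b *v w = tall_adj (Q j) (tall (Q k) w)"
  unfolding Pi_Z_def by (rule tall_transpose_mult_vec) (rule finQ, assumption)+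

lemma Pi_Z_mult:
  assumes "j \<in> K" "k \<in> K" "l \<in> K"
  shows "Pi_Z J \<rho> \<Omega> j k b ** Pi_Z J \<rho> \<Omega> k l b = Pi_Z J \<rho> \<Omega> j l b"
  unfolding matrix_eq
  by (simp add: matrix_vector_mul_assoc[symmetric] Pi_Z_vec assms Q_Q_adj P_tall_Q)

lemma Pi_Z_self: "j \<in> K \<Longrightarrow> Pi_Z J \<rho> \<Omega> j j b = mat 1"
  unfolding matrix_eq by (simp add: Pi_Z_vec Q_adj_Q)

lemma Pi_Z_transpose:
  assumes "j \<in> K" "k \<in> K"
  shows "transpose (Pi_Z J \<rho> \<Omega> j k b) = Pi_Z J \<rho> \<Omega> k j b"
proof -
  note f = finQ[OF assms(1)] finQ[OF assms(2)]
  show ?thesis unfolding Pi_Z_def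
    by (simp add: vec_eq_iff transpose_def tall_transpose_mult_nth[OF f] tall_transpose_mult_nth[OF f(2,1)])
      (simp add: inner_commute)
qed

lemma Pi_Z_orthogonal: "j \<in> K \<Longrightarrow> k \<in> K \<Longrightarrow> orthogonal_matrix (Pi_Z J \<rho> \<Omega> j k b)"
  unfolding orthogonal_matrix by (simp add: Pi_Z_transpose Pi_Z_mult Pi_Z_self)

end

section \<open>Comparison of two approximate cocycles\<close>

definition block_op :: "(nat \<Rightarrow> real^2^2) \<Rightarrow> finseq \<Rightarrow> finseq" where
  "block_op \<mu> x = Abs_finseq (\<lambda>n. (\<mu> (n div 2) *v blk x (n div 2)) $ (if even n then 1 else 2))"

lemma blk_block_op: "blk (block_op \<mu> x) i = \<mu> i *v blk x i"
proof -
  let ?f = "\<lambda>n. (\<mu> (n div 2) *v blk x (n div 2)) $ (if even n then 1 else 2)"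
  have "{n. ?f n \<noteq> 0} \<subseteq> (\<Union>i\<in>{i. blk x i \<noteq> 0}. {2 * i, 2 * i + 1})"
  proof
    fix n assume "n \<in> {n. ?f n \<noteq> 0}"
    then have "blk x (n div 2) \<noteq> 0" by (auto simp: matrix_vector_mult_0_right)
    moreover have "n = 2 * (n div 2) \<or> n = 2 * (n div 2) + 1" by presburger
    ultimately show "n \<in> (\<Union>i\<in>{i. blk x i \<noteq> 0}. {2 * i, 2 * i + 1})" by blast
  qed
  then have "finite {n. ?f n \<noteq> 0}" by (rule finite_subset) (simp add: finite_blk)
  then have "coords (block_op \<mu> x) = ?f" unfolding block_op_def by (rule coords_Abs_finseq)
  then show ?thesis by (simp add: vector2_eq_iff)
qed

lemma finseq_eq_blkI: "(\<And>i. blk x i = blk y i) \<Longrightarrow> x = y"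
  by (rule finseq_eqI) (simp add: coords_eq_blk)

lemma blk_add: "blk (x + y) i = blk x i + blk y i"
  and blk_scaleR: "blk (c *\<^sub>R x) i = c *\<^sub>R blk x i"
  by (simp_all add: vector2_eq_iff)

lemma linear_block_op: "linear (block_op \<mu>)"
  by (intro linearI finseq_eq_blkI)
    (simp_all add: blk_block_op blk_add blk_scaleR matrix_vector_right_distrib matrix_vector_mult_scaleR)

lemma block_op_inner:
  assumes "\<And>i. orthogonal_matrix (\<mu> i)"
  shows "block_op \<mu> x \<bullet> block_op \<mu> y = x \<bullet> y"
proof -
  have "block_op \<mu> x \<bullet> block_op \<mu> y = (\<Sum>i | blk x i \<noteq> 0. blk (block_op \<mu> x) i \<bullet> blk (block_op \<mu> y) i)"
    by (rule inner_blk) (auto simp: finite_blk blk_block_op)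
  also have "\<dots> = (\<Sum>i | blk x i \<noteq> 0. blk x i \<bullet> blk y i)"
    by (simp add: blk_block_op orthogonal_inner[OF assms])
  also have "\<dots> = x \<bullet> y" by (rule inner_blk[symmetric]) (auto simp: finite_blk)
  finally show ?thesis .
qed

lemma matrix_inv_orthogonal:
  assumes "orthogonal_matrix (A :: real^2^2)"
  shows "A ** matrix_inv A = mat 1" and "matrix_inv A ** A = mat 1" and "matrix_inv A = transpose A"
proof -
  have "A ** transpose A = mat 1 \<and> transpose A ** A = mat 1" using assms by (simp add: orthogonal_matrix_def)
  then have "A ** matrix_inv A = mat 1 \<and> matrix_inv A ** A = mat 1"
    unfolding matrix_inv_def by (rule someI)
  then show i: "A ** matrix_inv A = mat 1" "matrix_inv A ** A = mat 1" by simp_all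
  have "matrix_inv A = transpose A ** (A ** matrix_inv A)"
    by (simp only: matrix_mul_assoc orthogonal_matrix_transpose_mult[OF assms] matrix_mul_lid)
  then show "matrix_inv A = transpose A" by (simp add: i)
qed

text \<open>Naturality of the polar factor under changes of orthonormal frame: in the Gram matrix
  \<open>B\<close> cancels and \<open>A\<close> acts by conjugation.\<close>

lemma polar_conj:
  fixes A B C :: "real^2^2"
  assumes A: "orthogonal_matrix A" and B: "orthogonal_matrix B"
  shows "(B ** C ** A) ** inv_sqrt_mat (transpose (B ** C ** A) ** (B ** C ** A)) =
    B ** (C ** inv_sqrt_mat (transpose C ** C)) ** A"
proof -
  define G where "G = transpose C ** C"
  have "transpose (B ** C ** A) ** (B ** C ** A) = transpose A ** transpose C ** (transpose B ** B) ** C ** A"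
    by (simp only: matrix_transpose_mul matrix_mul_assoc)
  also have "\<dots> = transpose A ** G ** A"
    by (simp only: G_def orthogonal_matrix_transpose_mult[OF B] matrix_mul_rid matrix_mul_assoc)
  finally have "(B ** C ** A) ** inv_sqrt_mat (transpose (B ** C ** A) ** (B ** C ** A))
      = (B ** C ** A) ** (transpose A ** inv_sqrt_mat G ** A)"
    by (simp only: inv_sqrt_mat_conj[OF A])
  also have "\<dots> = B ** C ** (A ** transpose A) ** inv_sqrt_mat G ** A" by (simp only: matrix_mul_assoc)
  finally show ?thesis
    unfolding G_def[symmetric] by (simp only: orthogonal_matrix_transpose_mult[OF A] matrix_mul_rid matrix_mul_assoc)
qed

text \<open>The smallness condition comes from \<open>D_transversal\<close>, where a counterexample
  would give \<open>1 - \<kappa>\<^sup>2 \<le> 2 * \<kappa>\<^sup>2 + 2 *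
  \<kappa>'\<^sup>2\<close>.\<close>

locale cocycle_pair_at =
  c: cocycle_at J K \<rho> \<Omega> b \<kappa> + c': cocycle_at J K \<rho> \<Omega>' b \<kappa>
  for J K \<rho> and \<Omega> \<Omega>' :: "'b cochain" and b :: 'b and \<kappa> +
  fixes \<mu> :: "nat \<Rightarrow> real^2^2" and \<kappa>' :: real
  assumes mu: "\<And>i. orthogonal_matrix (\<mu> i)"
    and mu_close: "\<And>i j w. i \<in> K \<Longrightarrow> j \<in> K \<Longrightarrow>
      norm ((\<mu> i ** \<Omega> i j b - \<Omega>' i j b ** \<mu> j) *v w) \<le> \<kappa>' * norm w"
    and kappa': "0 \<le> \<kappa>'" "3 * \<kappa>\<^sup>2 + 2 * \<kappa>'\<^sup>2 < 1"
begin

abbreviation D :: "finseq \<Rightarrow> finseq" where "D \<equiv> block_op \<mu>"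

lemma D_norm: "norm (D x) = norm x"
  by (simp add: norm_eq_sqrt_inner block_op_inner[OF mu])

lemma DT_close:
  assumes j: "j \<in> K" shows "norm (D (c.T j w) - c'.T j (\<mu> j *v w)) \<le> \<kappa>' * norm w"
proof (rule c.norm_le_blocks)
  fix i assume i: "i \<in> c.S"
  show "blk (D (c.T j w) - c'.T j (\<mu> j *v w)) i = sqrt (\<rho> i b) *\<^sub>R ((\<mu> i ** \<Omega> i j b - \<Omega>' i j b ** \<mu> j) *v w)"
    using i by (simp add: blk_diff blk_block_op c.blkT c'.blkT matrix_vector_mult_diff_rdistrib
        matrix_vector_mul_assoc scaleR_diff_right matrix_vector_mult_scaleR)
  show "norm ((\<mu> i ** \<Omega> i j b - \<Omega>' i j b ** \<mu> j) *v w) \<le> \<kappa>' * norm w"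
    using i c.SK j by (intro mu_close) auto
qed (use kappa' in \<open>simp_all add: blk_diff blk_block_op c.blkT_out c'.blkT_out del: mem_Collect_eq\<close>)

text \<open>The adjoint form of \<open>DT_close\<close>, again obtained by testing the difference
  \<open>z\<close> against itself.\<close>

lemma Tadj_D_close:
  assumes j: "j \<in> K" shows "norm (c'.Tadj j (D x) - \<mu> j *v c.Tadj j x) \<le> \<kappa>' * norm x"
proof -
  define z where "z = c'.Tadj j (D x) - \<mu> j *v c.Tadj j x"
  define w where "w = transpose (\<mu> j) *v z"
  have z: "\<mu> j *v w = z" 
    by (simp only: w_def matrix_vector_mul_assoc orthogonal_matrix_transpose_mult[OF mu] matrix_vector_mul_lid)
  have nw: "norm w = norm z" using norm_orthogonal_matrix_mult[OF mu[of j], of w] by (simp add: z)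
  have "z \<bullet> (\<mu> j *v c.Tadj j x) = w \<bullet> c.Tadj j x"
    unfolding w_def inner_matrix_vector_2 by simp
  also have "\<dots> = D (c.T j w) \<bullet> D x" by (simp add: inner_tall_adj[OF c.finT] block_op_inner[OF mu])
  finally have "z \<bullet> z = (c'.T j (\<mu> j *v w) - D (c.T j w)) \<bullet> D x"
    unfolding z using inner_tall_adj[OF c'.finT, of z j "D x"]
    by (simp add: inner_diff_left) (simp add: z_def inner_diff_right)
  also have "\<dots> \<le> norm (c'.T j (\<mu> j *v w) - D (c.T j w)) * norm (D x)" by (rule norm_cauchy_schwarz)
  also have "\<dots> \<le> \<kappa>' * norm z * norm x"
    using DT_close[OF j, of w] unfolding D_norm nw by (intro mult_right_mono) (simp_all add: norm_minus_commute)
  finally have "norm z * norm z \<le> norm z * (\<kappa>' * norm x)"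
    by (simp add: power2_norm_eq_inner[symmetric] power2_eq_square ac_simps)
  then have "norm z \<le> \<kappa>' * norm x"
    using kappa' by (cases "z = 0") (simp_all add: mult_le_cancel_left_pos)
  then show ?thesis by (simp add: z_def)
qed

text \<open>On the first plane the form of \<open>c.A\<close> is large, while on the kernel of the
  second projection the form of \<open>c'.A\<close> is small. The adjoints are \<kappa>'-close, so
  the two forms cannot differ that much; the factors 2 come from squaring a sum.\<close>

lemma D_transversal:
  assumes x: "c.P x = x" and y: "c'.P (D x) = 0" shows "x = 0"
proof (rule ccontr)
  assume "x \<noteq> 0"
  then have pos: "0 < x \<bullet> x" by simp
  have le: "(norm (c.Tadj j x))\<^sup>2 \<le> 2 * (norm (c'.Tadj j (D x)))\<^sup>2 + 2 * \<kappa>'\<^sup>2 * (norm x)\<^sup>2" if j: "j \<in> K" for j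
  proof -
    have "norm (c.Tadj j x) = norm (\<mu> j *v c.Tadj j x)" by (simp add: norm_orthogonal_matrix_mult mu)
    also have "\<dots> \<le> norm (c'.Tadj j (D x)) + norm (c'.Tadj j (D x) - \<mu> j *v c.Tadj j x)" by norm
    also have "\<dots> \<le> norm (c'.Tadj j (D x)) + \<kappa>' * norm x" using Tadj_D_close[OF j, of x] by simp
    finally have "(norm (c.Tadj j x))\<^sup>2 \<le> (norm (c'.Tadj j (D x)) + \<kappa>' * norm x)\<^sup>2"
      by (rule power_mono) simp
    also have "\<dots> \<le> 2 * (norm (c'.Tadj j (D x)))\<^sup>2 + 2 * (\<kappa>' * norm x)\<^sup>2"
      using zero_le_square[of "norm (c'.Tadj j (D x)) - \<kappa>' * norm x"]
      by (simp add: power2_eq_square algebra_simps)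
    finally show ?thesis by (simp add: power_mult_distrib)
  qed
  have "(1 - \<kappa>\<^sup>2) * (x \<bullet> x) \<le> c.A x \<bullet> x" by (rule c.A_range_lower[OF x])
  also have "\<dots> \<le> (\<Sum>j\<in>c.S. \<rho> j b * (2 * (norm (c'.Tadj j (D x)))\<^sup>2 + 2 * \<kappa>'\<^sup>2 * (norm x)\<^sup>2))"
    unfolding c.A_quadratic using c.SK c.rho_nonneg by (intro sum_mono mult_left_mono le) auto
  also have "\<dots> = (\<Sum>j\<in>c.S. \<rho> j b * (2 * (norm (c'.Tadj j (D x)))\<^sup>2)) + (\<Sum>j\<in>c.S. \<rho> j b * (2 * \<kappa>'\<^sup>2 * (norm x)\<^sup>2))"
    by (simp only: distrib_left sum.distrib)
  also have "(\<Sum>j\<in>c.S. \<rho> j b * (2 * (norm (c'.Tadj j (D x)))\<^sup>2)) = 2 * (c'.A (D x) \<bullet> D x)"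
    unfolding c'.A_quadratic sum_distrib_left by (intro sum.cong refl) simp
  also have "(\<Sum>j\<in>c.S. \<rho> j b * (2 * \<kappa>'\<^sup>2 * (norm x)\<^sup>2)) = 2 * \<kappa>'\<^sup>2 * (x \<bullet> x)"
    by (simp only: sum_distrib_right[symmetric] c.rho_sum mult_1 power2_norm_eq_inner)
  also have "c'.A (D x) \<bullet> D x \<le> \<kappa>\<^sup>2 * (x \<bullet> x)"
    using c'.A_kernel_upper[OF y] by (simp add: block_op_inner[OF mu])
  finally have "(1 - \<kappa>\<^sup>2) * (x \<bullet> x) \<le> (2 * \<kappa>\<^sup>2 + 2 * \<kappa>'\<^sup>2) * (x \<bullet> x)" by (simp add: algebra_simps)
  then have "1 - \<kappa>\<^sup>2 \<le> 2 * \<kappa>\<^sup>2 + 2 * \<kappa>'\<^sup>2" using pos by (simp only: mult_le_cancel_right_pos)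
  then show False using kappa'(2) by simp
qed

text \<open>The map \<open>D\<close> followed by the second projection, from the first plane to the
  second, written in the orthonormal frames of the chart \<open>j\<close>.\<close>

definition C :: "nat \<Rightarrow> real^2^2" where
  "C j = (\<chi> a e. tall (c'.Q j) (axis a 1) \<bullet> D (tall (c.Q j) (axis e 1)))"

lemma C_vec: "j \<in> K \<Longrightarrow> C j *v w = tall_adj (c'.Q j) (D (tall (c.Q j) w))"
proof -
  assume j: "j \<in> K"
  note lin = linear_compose[OF linear_tall[OF c.finQ[OF j]] linear_block_op[of \<mu>], unfolded o_def]
  have "D (tall (c.Q j) w) = w $ 1 *\<^sub>R D (tall (c.Q j) (axis 1 1)) + w $ 2 *\<^sub>R D (tall (c.Q j) (axis 2 1))"
    by (subst vec2_expand[of w]) (simp only: linear_add[OF lin] linear_scale[OF lin])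
  then show ?thesis
    by (simp add: vec_eq_iff matrix_vector_mult_def tall_adj_def C_def sum_2 inner_add_right mult.commute)
qed

lemma C_nonzero:
  assumes j: "j \<in> K" and w: "w \<noteq> 0" shows "C j *v w \<noteq> 0"
proof
  assume "C j *v w = 0"
  then have z: "tall_adj (c'.Q j) (D (tall (c.Q j) w)) = 0" unfolding C_vec[OF j] .
  have "c'.P (D (tall (c.Q j) w)) = 0"
    unfolding c'.Q_Q_adj[OF j, symmetric] z by (rule linear_0[OF linear_tall[OF c'.finQ[OF j]]])
  then have "tall (c.Q j) w = 0" by (rule D_transversal[OF c.P_tall_Q[OF j]])
  then show False using tall_V2_norm[OF c.Q_V2[OF j], of w] w by simp
qed

text \<open>Both sides describe the same map of planes, in the frames of \<open>k\<close> and of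
  \<open>j\<close>. The inserted products of a frame with its adjoint are projections, absorbed by
  the adjacent frames.\<close>

lemma C_intertwine:
  assumes "j \<in> K" "k \<in> K"
  shows "C k = Pi_Z J \<rho> \<Omega>' k j b ** C j ** Pi_Z J \<rho> \<Omega> j k b"
  unfolding matrix_eq
  by (simp add: matrix_vector_mul_assoc[symmetric] c.Pi_Z_vec c'.Pi_Z_vec C_vec assms
      c.Q_Q_adj c'.Q_Q_adj c.P_tall_Q c'.Q_adj_P)

definition Iso :: "nat \<Rightarrow> real^2^2" where
  "Iso j = C j ** inv_sqrt_mat (transpose (C j) ** C j)"

lemma C_Gram_pos_def:
  assumes "j \<in> K" shows "pos_def2 (transpose (C j) ** C j)"
proof -
  have "w \<bullet> ((transpose (C j) ** C j) *v w) = (C j *v w) \<bullet> (C j *v w)" for w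
    unfolding matrix_vector_mul_assoc[symmetric] by (rule inner_matrix_vector_2[symmetric])
  then show ?thesis
    unfolding pos_def2_def using C_nonzero[OF assms] by (simp add: matrix_transpose_mul)
qed

lemma Iso_orthogonal: "j \<in> K \<Longrightarrow> orthogonal_matrix (Iso j)"
proof -
  assume j: "j \<in> K"
  define G where "G = transpose (C j) ** C j"
  have G: "pos_def2 G" unfolding G_def by (rule C_Gram_pos_def[OF j])
  note H = sqrt_mat[OF G]
  have "transpose (Iso j) ** Iso j = inv_sqrt_mat G ** G ** inv_sqrt_mat G"
    unfolding Iso_def G_def[symmetric] matrix_transpose_mul H(5) by (simp only: G_def matrix_mul_assoc)
  moreover have "inv_sqrt_mat G ** (sqrt_mat G ** sqrt_mat G) ** inv_sqrt_mat G
      = (inv_sqrt_mat G ** sqrt_mat G) ** (sqrt_mat G ** inv_sqrt_mat G)" by (simp only: matrix_mul_assoc)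
  ultimately show ?thesis unfolding orthogonal_matrix H(2-4) by simp
qed

text \<open>Naturality of the polar factor carries the intertwining relation from \<open>C\<close>
  to the orthogonal matrices \<open>Iso\<close>; solved for the second cocycle it is the coboundary
  relation.\<close>

lemma Iso_conj:
  assumes j: "j \<in> K" and k: "k \<in> K"
  shows "Pi_Z J \<rho> \<Omega>' j k b = Iso j ** Pi_Z J \<rho> \<Omega> j k b ** matrix_inv (Iso k)"
proof -
  let ?A = "Pi_Z J \<rho> \<Omega> j k b" and ?B = "Pi_Z J \<rho> \<Omega>' k j b"
  have A: "orthogonal_matrix ?A" and B: "orthogonal_matrix ?B"
    by (rule c.Pi_Z_orthogonal[OF j k], rule c'.Pi_Z_orthogonal[OF k j])
  have Ck: "C k = ?B ** C j ** ?A" by (rule C_intertwine[OF j k])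
  have "Iso k = ?B ** (Iso j ** ?A)"
    unfolding Iso_def Ck polar_conj[OF A B] by (simp only: matrix_mul_assoc)
  then have "Pi_Z J \<rho> \<Omega>' j k b ** Iso k = Pi_Z J \<rho> \<Omega>' j k b ** ?B ** (Iso j ** ?A)"
    by (simp only: matrix_mul_assoc)
  then have e: "Pi_Z J \<rho> \<Omega>' j k b ** Iso k = Iso j ** ?A"
    by (simp add: c'.Pi_Z_mult c'.Pi_Z_self j k)
  have "Iso k ** matrix_inv (Iso k) = mat 1"
    by (rule matrix_inv_orthogonal(1)[OF Iso_orthogonal[OF k]])
  then show ?thesis unfolding e[symmetric] by (simp add: matrix_mul_assoc[symmetric])
qed

end

section \<open>Continuity\<close>

lemma mat_op_diff_bound:
  assumes B: "mat_below N B" and B0: "mat_below N B0"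
  shows "\<bar>(mat_op B x - mat_op B0 x) \<bullet> y\<bar> \<le> (\<Sum>m<N. \<Sum>n<N. \<bar>B m n - B0 m n\<bar>) * (norm x * norm y)"
proof -
  have "(mat_op B x - mat_op B0 x) \<bullet> y = (\<Sum>m<N. \<Sum>n<N. (B m n - B0 m n) * coords x n * coords y m)"
    by (simp add: inner_diff_left mat_op_inner[OF B] mat_op_inner[OF B0] sum_subtractf[symmetric] left_diff_distrib)
  also have "\<bar>\<dots>\<bar> \<le> (\<Sum>m<N. \<Sum>n<N. \<bar>(B m n - B0 m n) * coords x n * coords y m\<bar>)"
    by (rule order_trans[OF sum_abs]) (intro sum_mono sum_abs)
  also have "\<dots> \<le> (\<Sum>m<N. \<Sum>n<N. \<bar>B m n - B0 m n\<bar> * (norm x * norm y))"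
    unfolding abs_mult mult.assoc by (intro sum_mono mult_left_mono mult_mono abs_coords_le_norm) auto
  finally show ?thesis by (simp only: sum_distrib_right)
qed

text \<open>An eigenvector with nonzero eigenvalue lies in the range of the matrix, so its support
  is bounded like that of the matrix.\<close>

lemma coords_spectral_pair_below:
  assumes "spectral_pair (mat_op B) \<alpha> u v" "0 < \<alpha>" "mat_below N B" "N \<le> n"
  shows "coords u n = 0" "coords v n = 0"
proof -
  obtain l1 l2 where l: "mat_op B u = l1 *\<^sub>R u" "mat_op B v = l2 *\<^sub>R v" "l2 \<le> l1" "\<alpha> \<le> l2"
    using assms(1) unfolding spectral_pair_def by blast
  have "l1 * coords u n = 0" "l2 * coords v n = 0"
    using coords_mat_op_ge[OF assms(3,4), of u] coords_mat_op_ge[OF assms(3,4), of v] unfolding l by simp_all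
  then show "coords u n = 0" "coords v n = 0" using l(3,4) assms(2) by auto
qed

lemma continuous_on_vec2:
  assumes "continuous_on S (\<lambda>b. F b $ 1)" "continuous_on S (\<lambda>b. F b $ 2)"
  shows "continuous_on S (F :: 'b::topological_space \<Rightarrow> real^2)"
proof -
  have "continuous_on S (\<lambda>b. F b $ a)" for a using assms by (cases a rule: exhaust_2[THEN disjE]) auto
  then have "continuous_on S (\<lambda>b. \<chi> a. F b $ a)" by (intro continuous_on_vec_lambda)
  then show ?thesis by simp
qed

lemma tall_transpose_mult_eq_sum:
  assumes "\<forall>n\<ge>N. M n = 0"
  shows "tall_transpose_mult M M' $ a $ c = (\<Sum>n<N. M n $ a * M' n $ c)"
  unfolding tall_transpose_mult_def using assms by simp (intro suminf_finite, auto simp: not_less)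

text \<open>The matrices of a witness are constant, so \<open>Psi\<close> and \<open>cl\<close> vary
  with the base point only through the partition of unity.\<close>

locale constant_cocycle =
  fixes J :: "nat set" and K :: "'b::topological_space \<Rightarrow> nat set" and \<rho> :: "nat \<Rightarrow> 'b \<Rightarrow> real"
    and W :: "nat \<Rightarrow> nat \<Rightarrow> real^2^2" and \<kappa> :: real
  assumes at: "\<And>b. cocycle_at J (K b) \<rho> (\<lambda>j k _. W j k) b \<kappa>"
    and rho_cont: "\<And>j. j \<in> J \<Longrightarrow> continuous_on UNIV (\<rho> j)"
begin

abbreviation \<Omega> :: "'b cochain" where "\<Omega> \<equiv> \<lambda>j k _. W j k"

lemma Psi_continuous: "continuous_on UNIV (\<lambda>b. Psi J \<rho> \<Omega> j b n)"
proof -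
  let ?a = "if even n then 1 else 2 :: 2"
  \<comment> \<open>Where the weight vanishes, sqrt 0 = 0 reproduces the default value, so one
    continuous formula covers all points.\<close>
  have "Psi J \<rho> \<Omega> j b n = (if n div 2 \<in> J then sqrt (\<rho> (n div 2) b) *\<^sub>R (W (n div 2) j $ ?a) else 0)" for b
    by (simp add: Psi_def Let_def)
  then show ?thesis
    using rho_cont[of "n div 2"] by (cases "n div 2 \<in> J") (auto intro!: continuous_intros)
qed

text \<open>Over such a \<open>V\<close> all matrices live in a common block of size 2 N, and
  continuity concerns finitely many entries.\<close>

context
  fixes V :: "'b set" and N :: nat
  assumes N: "\<forall>b\<in>V. \<forall>j\<in>J. \<rho> j b \<noteq> 0 \<longrightarrow> j < N"
begin

lemma Psi_below: "b \<in> V \<Longrightarrow> \<forall>n\<ge>2 * N. Psi J \<rho> \<Omega> j b n = 0"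
  using N by (auto intro: Psi_eq_0)

lemma cl_below: "b \<in> V \<Longrightarrow> mat_below (2 * N) (cl J \<rho> \<Omega> b)"
  using N by (intro cocycle_at.mat_below_cl[OF at]) blast

lemma cl_continuous: "continuous_on V (\<lambda>b. cl J \<rho> \<Omega> b m n)"
proof -
  have "cl J \<rho> \<Omega> b m n = (\<Sum>j\<in>{j\<in>J. j < N}. \<rho> j b * (Psi J \<rho> \<Omega> j b m \<bullet> Psi J \<rho> \<Omega> j b n))" if "b \<in> V" for b
    unfolding cl_def using N[rule_format, OF that] by (intro sum.mono_neutral_left) auto
  moreover have "continuous_on V (\<lambda>b. \<Sum>j\<in>{j\<in>J. j < N}. \<rho> j b * (Psi J \<rho> \<Omega> j b m \<bullet> Psi J \<rho> \<Omega> j b n))"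
    by (intro continuous_intros continuous_on_subset[OF Psi_continuous] continuous_on_subset[OF rho_cont]) auto
  ultimately show ?thesis by (simp cong: continuous_on_cong)
qed

lemma Gr_proj_below: "b \<in> V \<Longrightarrow> mat_below (2 * N) (Gr_proj (cl J \<rho> \<Omega> b))"
proof -
  assume b: "b \<in> V"
  interpret c: cocycle_at J "K b" \<rho> \<Omega> b \<kappa> by (rule at)
  obtain u v where uv: "spectral_pair c.A (1 - \<kappa>\<^sup>2) u v"
    "Gr_proj (cl J \<rho> \<Omega> b) = (\<lambda>m n. coords u m * coords u n + coords v m * coords v n)"
    by (rule c.spectral_P) (rule that)
  have "0 < 1 - \<kappa>\<^sup>2" using c.kappa by simp
  then show ?thesis
    using coords_spectral_pair_below[OF uv(1) _ cl_below[OF b]] by (auto simp: mat_below_def uv(2))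
qed

text \<open>The gap is the same at all points, so entries of the projection change by at most a
  fixed multiple of \<open>\<delta>\<close>, the sum of the entrywise changes of
  \<open>cl\<close>.\<close>

lemma Gr_proj_continuous: "continuous_on V (\<lambda>b. Gr_proj (cl J \<rho> \<Omega> b) m n)"
  unfolding continuous_on_def
proof
  fix b0 assume b0: "b0 \<in> V"
  let ?P = "\<lambda>b. Gr_proj (cl J \<rho> \<Omega> b)"
  define \<delta> where "\<delta> b = (\<Sum>m<2 * N. \<Sum>n<2 * N. \<bar>cl J \<rho> \<Omega> b m n - cl J \<rho> \<Omega> b0 m n\<bar>)" for b
  interpret c0: cocycle_at J "K b0" \<rho> \<Omega> b0 \<kappa> by (rule at)
  have bound: "norm (?P b m n - ?P b0 m n) \<le> 4 * (\<delta> b / (1 - \<kappa>\<^sup>2 - \<kappa>\<^sup>2))" if b: "b \<in> V" for b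
  proof -
    interpret c: cocycle_at J "K b" \<rho> \<Omega> b \<kappa> by (rule at)
    obtain u0 v0 where 0: "spectral_pair c0.A (1 - \<kappa>\<^sup>2) u0 v0" "c0.P = pair_proj u0 v0"
      "\<And>x. u0 \<bullet> x = 0 \<Longrightarrow> v0 \<bullet> x = 0 \<Longrightarrow> c0.A x \<bullet> x \<le> \<kappa>\<^sup>2 * (x \<bullet> x)"
      by (rule c0.spectral_P) (rule that)
    obtain u v where 1: "spectral_pair c.A (1 - \<kappa>\<^sup>2) u v" "c.P = pair_proj u v"
      "\<And>x. u \<bullet> x = 0 \<Longrightarrow> v \<bullet> x = 0 \<Longrightarrow> c.A x \<bullet> x \<le> \<kappa>\<^sup>2 * (x \<bullet> x)"
      by (rule c.spectral_P) (rule that)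
    have d: "\<bar>(c.A x - c0.A x) \<bullet> y\<bar> \<le> \<delta> b * (norm x * norm y)" for x y
      unfolding \<delta>_def by (rule mat_op_diff_bound[OF cl_below[OF b] cl_below[OF b0]])
    have "\<bar>(c.P x - c0.P x) \<bullet> y\<bar> \<le> 4 * (\<delta> b / (1 - \<kappa>\<^sup>2 - \<kappa>\<^sup>2)) * (norm x * norm y)" for x y
      unfolding 0(2) 1(2)
      by (rule pair_proj_continuity_bound[OF 1(1) 0(1) c.linear_A c0.linear_A c.gap 1(3) 0(3) d])
    from this[of "basis_finseq n" "basis_finseq m"]
    have "\<bar>coords (c.P (basis_finseq n)) m - coords (c0.P (basis_finseq n)) m\<bar> \<le> 4 * (\<delta> b / (1 - \<kappa>\<^sup>2 - \<kappa>\<^sup>2))"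
      by (simp add: inner_basis_finseq norm_basis_finseq)
    moreover have "coords (mat_op B (basis_finseq n)) m = B m n" if "mat_below (2 * N) B" for B
      using that by (simp add: coords_mat_op_sum mat_below_def if_distrib[of "\<lambda>x. _ * x"] cong: if_cong)
    ultimately show ?thesis using Gr_proj_below[OF b] Gr_proj_below[OF b0] by simp
  qed
  have "continuous_on V \<delta>" unfolding \<delta>_def by (intro continuous_intros cl_continuous)
  then have "(\<delta> \<longlongrightarrow> \<delta> b0) (at b0 within V)" using b0 by (simp add: continuous_on_def)
  moreover have "\<delta> b0 = 0" by (simp add: \<delta>_def)
  ultimately have "((\<lambda>b. 4 * (\<delta> b / (1 - \<kappa>\<^sup>2 - \<kappa>\<^sup>2))) \<longlongrightarrow> 4 * (0 / (1 - \<kappa>\<^sup>2 - \<kappa>\<^sup>2))) (at b0 within V)"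
    using c0.gap by (intro tendsto_intros) auto
  then have "((\<lambda>b. 4 * (\<delta> b / (1 - \<kappa>\<^sup>2 - \<kappa>\<^sup>2))) \<longlongrightarrow> 0) (at b0 within V)" by simp
  moreover have "\<forall>\<^sub>F b in at b0 within V. norm (?P b m n - ?P b0 m n) \<le> 4 * (\<delta> b / (1 - \<kappa>\<^sup>2 - \<kappa>\<^sup>2))"
    using bound by (auto simp: eventually_at_filter)
  ultimately have "((\<lambda>b. ?P b m n - ?P b0 m n) \<longlongrightarrow> 0) (at b0 within V)"
    by (rule Lim_null_comparison[rotated])
  then show "((\<lambda>b. ?P b m n) \<longlongrightarrow> ?P b0 m n) (at b0 within V)" by (rule LIM_zero_cancel)
qed

lemma Psi_tilde_below_continuous:
  shows "b \<in> V \<Longrightarrow> j \<in> K b \<Longrightarrow> \<forall>n\<ge>2 * N. Psi_tilde J \<rho> \<Omega> j b n = 0"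
    and "continuous_on (V \<inter> {b. j \<in> K b}) (\<lambda>b. Psi_tilde J \<rho> \<Omega> j b n)"
proof -
  let ?P = "\<lambda>b. Gr_proj (cl J \<rho> \<Omega> b)" and ?\<Psi> = "\<lambda>b. Psi J \<rho> \<Omega> j b"
  define M where "M b = mat_tall_mult (?P b) (?\<Psi> b)" for b
  define G where "G b = tall_transpose_mult (M b) (M b)" for b
  have M: "M b m = (\<Sum>n<2 * N. ?P b m n *\<^sub>R ?\<Psi> b n)" if "b \<in> V" for b m
    unfolding M_def mat_tall_mult_def using Psi_below[OF that, of j] by (intro suminf_finite) (auto simp: not_less)
  have M0: "\<forall>n\<ge>2 * N. M b n = 0" if "b \<in> V" for b
    using Gr_proj_below[OF that] by (auto simp: M[OF that] mat_below_def)
  have Mc: "continuous_on V (\<lambda>b. M b m)" for m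
  proof -
    have "continuous_on V (\<lambda>b. \<Sum>n<2 * N. ?P b m n *\<^sub>R ?\<Psi> b n)"
      by (intro continuous_intros Gr_proj_continuous continuous_on_subset[OF Psi_continuous]) auto
    then show ?thesis by (simp add: M cong: continuous_on_cong)
  qed
  have Gc: "continuous_on V G"
  proof (rule continuous_on_matrix2)
    fix a c
    have "continuous_on V (\<lambda>b. \<Sum>n<2 * N. M b n $ a * M b n $ c)"
      by (intro continuous_intros Mc)
    then show "continuous_on V (\<lambda>b. G b $ a $ c)"
      by (simp add: G_def tall_transpose_mult_eq_sum[OF M0] cong: continuous_on_cong)
  qed
  have Q: "Psi_tilde J \<rho> \<Omega> j b = (\<lambda>n. M b n v* inv_sqrt_mat (G b))" "pos_def2 (G b)" if "j \<in> K b" for b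
    using cocycle_at.Q_eq[OF at that] cocycle_at.Gram_pos_def[OF at that] unfolding M_def G_def by simp_all
  show "\<forall>n\<ge>2 * N. Psi_tilde J \<rho> \<Omega> j b n = 0" if "b \<in> V" "j \<in> K b"
    using M0[OF that(1)] by (simp add: Q(1)[OF that(2)])
  have "continuous_on (V \<inter> {b. j \<in> K b}) (\<lambda>b. inv_sqrt_mat (G b))"
    using Q(2) by (intro continuous_on_inv_sqrt_mat continuous_on_subset[OF Gc]) auto
  then have "continuous_on (V \<inter> {b. j \<in> K b}) (\<lambda>b. M b n v* inv_sqrt_mat (G b))"
    unfolding vector_matrix_mult_def sum_2
    by (intro continuous_on_vec_lambda continuous_intros continuous_on_subset[OF Mc]) auto
  then show "continuous_on (V \<inter> {b. j \<in> K b}) (\<lambda>b. Psi_tilde J \<rho> \<Omega> j b n)"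
    by (rule continuous_on_eq) (simp add: Q(1))
qed

lemma Pi_Z_continuous_below:
  "continuous_on (V \<inter> {b. j \<in> K b \<and> k \<in> K b}) (Pi_Z J \<rho> \<Omega> j k)"
proof (rule continuous_on_matrix2)
  fix a c
  let ?Q = "\<lambda>j b. Psi_tilde J \<rho> \<Omega> j b"
  have "continuous_on (V \<inter> {b. j \<in> K b \<and> k \<in> K b}) (\<lambda>b. \<Sum>n<2 * N. ?Q j b n $ a * ?Q k b n $ c)"
    by (intro continuous_intros continuous_on_subset[OF Psi_tilde_below_continuous(2)]) auto
  moreover have "(\<Sum>n<2 * N. ?Q j b n $ a * ?Q k b n $ c) = Pi_Z J \<rho> \<Omega> j k b $ a $ c"
    if "b \<in> V \<inter> {b. j \<in> K b \<and> k \<in> K b}" for b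
    using that unfolding Pi_Z_def
    by (intro tall_transpose_mult_eq_sum[symmetric] Psi_tilde_below_continuous(1)) auto
  ultimately show "continuous_on (V \<inter> {b. j \<in> K b \<and> k \<in> K b}) (\<lambda>b. Pi_Z J \<rho> \<Omega> j k b $ a $ c)"
    by (rule continuous_on_eq)
qed

end

end

section \<open>Localization on the base\<close>

lemma continuous_on_locally:
  assumes "open S" "\<And>b. b \<in> S \<Longrightarrow> \<exists>V. open V \<and> b \<in> V \<and> continuous_on (V \<inter> S) f"
  shows "continuous_on S f"
proof -
  obtain V where V: "\<And>b. b \<in> S \<Longrightarrow> open (V b) \<and> b \<in> V b \<and> continuous_on (V b \<inter> S) f" using assms(2) by metis
  have "continuous_on (\<Union>b\<in>S. V b \<inter> S) f"
    using V assms(1) by (intro continuous_on_open_UN) auto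
  moreover have "(\<Union>b\<in>S. V b \<inter> S) = S" using V by auto
  ultimately show ?thesis by simp
qed

lemma locally_finite_bound:
  assumes "\<exists>V. open V \<and> b \<in> V \<and> finite {j\<in>J. \<exists>c\<in>V. \<rho> j c \<noteq> (0::real)}"
  shows "\<exists>V N. open V \<and> b \<in> V \<and> (\<forall>c\<in>V. \<forall>j\<in>J. \<rho> j c \<noteq> 0 \<longrightarrow> j < (N::nat))"
proof -
  obtain V where V: "open V" "b \<in> V" "finite {j\<in>J. \<exists>c\<in>V. \<rho> j c \<noteq> 0}" using assms by blast
  obtain N where "{j\<in>J. \<exists>c\<in>V. \<rho> j c \<noteq> 0} \<subseteq> {..<N}" using V(3) unfolding finite_nat_iff_bounded ..
  then have "\<forall>c\<in>V. \<forall>j\<in>J. \<rho> j c \<noteq> 0 \<longrightarrow> j < N" by auto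
  then show ?thesis using V(1,2) by blast
qed

section \<open>Cohomology classes\<close>

lemma continuous_on_blk_tall:
  assumes "\<And>n. continuous_on S (\<lambda>b. M b n)" "\<And>b. b \<in> S \<Longrightarrow> fin_tall (M b)"
  shows "continuous_on S (\<lambda>b. blk (tall (M b) w) i)"
proof -
  have "continuous_on S (\<lambda>b. vector [M b (2 * i) \<bullet> w, M b (2 * i + 1) \<bullet> w] :: real^2)"
    by (rule continuous_on_vec2) (simp_all, (intro continuous_intros assms(1))+)
  then show ?thesis by (rule continuous_on_eq) (simp add: coords_tall[OF assms(2)] vector2_eq_iff)
qed

definition iso_between ::
  "nat set \<Rightarrow> (nat \<Rightarrow> 'b \<Rightarrow> real) \<Rightarrow> (nat \<Rightarrow> nat \<Rightarrow> real^2^2) \<Rightarrow> (nat \<Rightarrow> nat \<Rightarrow> real^2^2) \<Rightarrow>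
    (nat \<Rightarrow> real^2^2) \<Rightarrow> nat \<Rightarrow> 'b \<Rightarrow> real^2^2" where
  "iso_between J \<rho> W W' \<mu> j b = cocycle_pair_at.Iso J \<rho> (\<lambda>j k _. W j k) (\<lambda>j k _. W' j k) b \<mu> j"

lemma iso_between_continuous:
  fixes \<rho> :: "nat \<Rightarrow> 'b::topological_space \<Rightarrow> real"
  assumes c: "constant_cocycle J K \<rho> W \<kappa>" and c': "constant_cocycle J K \<rho> W' \<kappa>"
    and p: "\<And>b. cocycle_pair_at J (K b) \<rho> (\<lambda>j k _. W j k) (\<lambda>j k _. W' j k) b \<kappa> \<mu> \<kappa>'"
    and N: "\<forall>b\<in>V. \<forall>j\<in>J. \<rho> j b \<noteq> 0 \<longrightarrow> j < N"
  shows "continuous_on (V \<inter> {b. j \<in> K b}) (iso_between J \<rho> W W' \<mu> j)"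
proof -
  let ?S = "V \<inter> {b. j \<in> K b}"
  let ?Q = "\<lambda>b. Psi_tilde J \<rho> (\<lambda>j k _. W j k) j b" and ?Q' = "\<lambda>b. Psi_tilde J \<rho> (\<lambda>j k _. W' j k) j b"
  interpret c: constant_cocycle J K \<rho> W \<kappa> by (rule c)
  interpret c': constant_cocycle J K \<rho> W' \<kappa> by (rule c')
  define C where "C b = cocycle_pair_at.C J \<rho> (\<lambda>j k _. W j k) (\<lambda>j k _. W' j k) b \<mu> j" for b
  have fin: "fin_tall (?Q b)" "fin_tall (?Q' b)" if "b \<in> ?S" for b
    using cocycle_at.finQ[OF c.at[of b]] cocycle_at.finQ[OF c'.at[of b]] that by auto
  have Cc: "continuous_on ?S C"
  proof (rule continuous_on_matrix2)
    fix a e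
    have "continuous_on ?S (\<lambda>b. \<Sum>i<N. blk (tall (?Q' b) (axis a 1)) i \<bullet> (\<mu> i *v blk (tall (?Q b) (axis e 1)) i))"
      unfolding matrix_vector_mult_def sum_2
      by (intro continuous_intros continuous_on_vec_lambda continuous_on_blk_tall fin
          c.Psi_tilde_below_continuous(2)[OF N] c'.Psi_tilde_below_continuous(2)[OF N])
    then show "continuous_on ?S (\<lambda>b. C b $ a $ e)"
    proof (rule continuous_on_eq)
      fix b assume b: "b \<in> ?S"
      interpret p: cocycle_pair_at J "K b" \<rho> "\<lambda>j k _. W j k" "\<lambda>j k _. W' j k" b \<kappa> \<mu> \<kappa>' by (rule p)
      have "\<forall>n\<ge>2 * N. coords (tall (?Q' b) (axis a 1)) n = 0"
        using c'.Psi_tilde_below_continuous(1)[OF N, of b j] b by (simp add: coords_tall[OF fin(2)[OF b]])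
      then show "(\<Sum>i<N. blk (tall (?Q' b) (axis a 1)) i \<bullet> (\<mu> i *v blk (tall (?Q b) (axis e 1)) i)) = C b $ a $ e"
        by (simp add: C_def p.C_def inner_blk_below blk_block_op)
    qed
  qed
  have "pos_def2 (transpose (C b) ** C b)" if "b \<in> ?S" for b
    unfolding C_def using cocycle_pair_at.C_Gram_pos_def[OF p] that by blast
  moreover have "continuous_on ?S (\<lambda>b. transpose (C b))"
    by (rule continuous_on_matrix2) (simp add: transpose_def, intro continuous_intros Cc)
  ultimately have "continuous_on ?S (\<lambda>b. C b ** inv_sqrt_mat (transpose (C b) ** C b))"
    by (intro continuous_on_matrix_mult continuous_on_inv_sqrt_mat Cc)
  then show ?thesis
    by (rule continuous_on_eq) (simp add: iso_between_def cocycle_pair_at.Iso_def[OF p] C_def)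
qed

lemma Pi_Z_in_cocycles:
  fixes U :: "nat \<Rightarrow> 'b::topological_space set"
  assumes opn: "\<And>j. j \<in> J \<Longrightarrow> open (U j)" and pu: "partition_of_unity J U \<rho>"
    and c: "constant_cocycle J (\<lambda>b. {j\<in>J. b \<in> U j}) \<rho> W \<kappa>"
  shows "Pi_Z J \<rho> (\<lambda>j k b. W j k) \<in> cocycles J U"
proof -
  interpret c: constant_cocycle J "\<lambda>b. {j\<in>J. b \<in> U j}" \<rho> W \<kappa> by (rule c)
  have "continuous_on (U j \<inter> U k) (Pi_Z J \<rho> (\<lambda>j k b. W j k) j k)" if jk: "j \<in> J" "k \<in> J" for j k
  proof (rule continuous_on_locally)
    show "open (U j \<inter> U k)" using opn jk by blast
    fix b
    obtain V N where VN: "open V" "b \<in> V" and N: "\<forall>c\<in>V. \<forall>j\<in>J. \<rho> j c \<noteq> 0 \<longrightarrow> j < N"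
      using locally_finite_bound[of b J \<rho>] pu unfolding partition_of_unity_def by blast
    have "V \<inter> {b. j \<in> {j\<in>J. b \<in> U j} \<and> k \<in> {j\<in>J. b \<in> U j}} = V \<inter> (U j \<inter> U k)" using jk by auto
    then have "continuous_on (V \<inter> (U j \<inter> U k)) (Pi_Z J \<rho> (\<lambda>j k b. W j k) j k)"
      using c.Pi_Z_continuous_below[OF N, of j k] by simp
    then show "\<exists>V. open V \<and> b \<in> V \<and> continuous_on (V \<inter> (U j \<inter> U k)) (Pi_Z J \<rho> (\<lambda>j k b. W j k) j k)"
      using VN(1,2) by blast
  qed
  moreover have "orthogonal_matrix (Pi_Z J \<rho> (\<lambda>j k b. W j k) j k b)" if "j \<in> J" "k \<in> J" "b \<in> U j \<inter> U k" for j k b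
    using cocycle_at.Pi_Z_orthogonal[OF c.at] that by auto
  moreover have "Pi_Z J \<rho> (\<lambda>j k b. W j k) j k b ** Pi_Z J \<rho> (\<lambda>j k b. W j k) k l b = Pi_Z J \<rho> (\<lambda>j k b. W j k) j l b"
    if "j \<in> J" "k \<in> J" "l \<in> J" "b \<in> U j \<inter> U k \<inter> U l" for j k l b
    using cocycle_at.Pi_Z_mult[OF c.at] that by auto
  ultimately show ?thesis by (simp add: cocycles_def cochains_def)
qed

section \<open>Coboundaries, and cohomology as an equivalence relation\<close>

lemma cohomologousI:
  assumes "\<Omega> \<in> cocycles J U" "\<Omega>' \<in> cocycles J U"
    and "\<And>j. j \<in> J \<Longrightarrow> continuous_on (U j) (\<mu> j)"
    and "\<And>j b. j \<in> J \<Longrightarrow> b \<in> U j \<Longrightarrow> orthogonal_matrix (\<mu> j b)"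
    and "\<And>j k b. j \<in> J \<Longrightarrow> k \<in> J \<Longrightarrow> b \<in> U j \<inter> U k \<Longrightarrow> \<Omega>' j k b = \<mu> j b ** \<Omega> j k b ** matrix_inv (\<mu> k b)"
  shows "(\<Omega>, \<Omega>') \<in> cohomologous J U"
  unfolding cohomologous_def using assms by blast

lemma Pi_Z_cohomologous:
  fixes U :: "nat \<Rightarrow> 'b::topological_space set"
  assumes opn: "\<And>j. j \<in> J \<Longrightarrow> open (U j)" and pu: "partition_of_unity J U \<rho>"
    and c: "constant_cocycle J (\<lambda>b. {j\<in>J. b \<in> U j}) \<rho> W \<kappa>"
    and c': "constant_cocycle J (\<lambda>b. {j\<in>J. b \<in> U j}) \<rho> W' \<kappa>"
    and p: "\<And>b. cocycle_pair_at J {j\<in>J. b \<in> U j} \<rho> (\<lambda>j k _. W j k) (\<lambda>j k _. W' j k) b \<kappa> \<mu> \<kappa>'"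
  shows "(Pi_Z J \<rho> (\<lambda>j k b. W j k), Pi_Z J \<rho> (\<lambda>j k b. W' j k)) \<in> cohomologous J U"
proof -
  let ?I = "iso_between J \<rho> W W' \<mu>"
  have cont: "continuous_on (U j) (?I j)" if j: "j \<in> J" for j
  proof (rule continuous_on_locally)
    show "open (U j)" using opn j by blast
    fix b
    obtain V N where VN: "open V" "b \<in> V" and N: "\<forall>c\<in>V. \<forall>j\<in>J. \<rho> j c \<noteq> 0 \<longrightarrow> j < N"
      using locally_finite_bound[of b J \<rho>] pu unfolding partition_of_unity_def by blast
    have "V \<inter> {b. j \<in> {j\<in>J. b \<in> U j}} = V \<inter> U j" using j by auto
    then have "continuous_on (V \<inter> U j) (?I j)"
      using iso_between_continuous[OF c c' p N, of j] by simp
    then show "\<exists>V. open V \<and> b \<in> V \<and> continuous_on (V \<inter> U j) (?I j)" using VN(1,2) by blast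
  qed
  have orth: "orthogonal_matrix (?I j b)" if "j \<in> J" "b \<in> U j" for j b
    unfolding iso_between_def using cocycle_pair_at.Iso_orthogonal[OF p, of j b] that by simp
  have conj: "Pi_Z J \<rho> (\<lambda>j k b. W' j k) j k b = ?I j b ** Pi_Z J \<rho> (\<lambda>j k b. W j k) j k b ** matrix_inv (?I k b)"
    if "j \<in> J" "k \<in> J" "b \<in> U j \<inter> U k" for j k b
    unfolding iso_between_def using cocycle_pair_at.Iso_conj[OF p, of j b k] that by simp
  show ?thesis
    using cohomologousI[OF Pi_Z_in_cocycles[OF opn pu c] Pi_Z_in_cocycles[OF opn pu c'] cont orth conj] .
qed

lemma cohomologous_sym: "(\<Omega>, \<Omega>') \<in> cohomologous J U \<Longrightarrow> (\<Omega>', \<Omega>) \<in> cohomologous J U"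
proof -
  assume "(\<Omega>, \<Omega>') \<in> cohomologous J U"
  then obtain \<mu> where c: "\<Omega> \<in> cocycles J U" "\<Omega>' \<in> cocycles J U"
    and \<mu>: "\<And>j. j \<in> J \<Longrightarrow> continuous_on (U j) (\<mu> j)" "\<And>j b. j \<in> J \<Longrightarrow> b \<in> U j \<Longrightarrow> orthogonal_matrix (\<mu> j b)"
    and eq: "\<And>j k b. j \<in> J \<Longrightarrow> k \<in> J \<Longrightarrow> b \<in> U j \<inter> U k \<Longrightarrow> \<Omega>' j k b = \<mu> j b ** \<Omega> j k b ** matrix_inv (\<mu> k b)"
    unfolding cohomologous_def by blast
  let ?\<nu> = "\<lambda>j b. transpose (\<mu> j b)"
  have "continuous_on (U j) (?\<nu> j)" if "j \<in> J" for j
    by (rule continuous_on_matrix2) (simp add: transpose_def, intro continuous_intros \<mu>(1)[OF that])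
  moreover have "orthogonal_matrix (?\<nu> j b)" if "j \<in> J" "b \<in> U j" for j b
    using \<mu>(2)[OF that] by (rule orthogonal_matrix_transpose_iff)
  moreover have "\<Omega> j k b = ?\<nu> j b ** \<Omega>' j k b ** matrix_inv (?\<nu> k b)"
    if jk: "j \<in> J" "k \<in> J" and b: "b \<in> U j \<inter> U k" for j k b
  proof -
    have o: "orthogonal_matrix (\<mu> j b)" "orthogonal_matrix (\<mu> k b)" using \<mu>(2) jk b by auto
    have "?\<nu> j b ** \<Omega>' j k b ** matrix_inv (?\<nu> k b)
        = (?\<nu> j b ** \<mu> j b) ** \<Omega> j k b ** (transpose (\<mu> k b) ** \<mu> k b)"
      unfolding eq[OF jk b] matrix_inv_orthogonal(3)[OF o(2)]
        matrix_inv_orthogonal(3)[OF orthogonal_matrix_transpose_iff[OF o(2)]] transpose_transpose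
      by (simp only: matrix_mul_assoc)
    then show ?thesis by (simp add: orthogonal_matrix_transpose_mult o)
  qed
  ultimately show ?thesis by (intro cohomologousI[where \<mu> = ?\<nu>] c)
qed

lemma cohomologous_trans:
  assumes "(\<Omega>1, \<Omega>2) \<in> cohomologous J U" "(\<Omega>2, \<Omega>3) \<in> cohomologous J U"
  shows "(\<Omega>1, \<Omega>3) \<in> cohomologous J U"
proof -
  obtain \<mu> where c: "\<Omega>1 \<in> cocycles J U" and \<mu>: "\<And>j. j \<in> J \<Longrightarrow> continuous_on (U j) (\<mu> j)"
    "\<And>j b. j \<in> J \<Longrightarrow> b \<in> U j \<Longrightarrow> orthogonal_matrix (\<mu> j b)"
    and eq: "\<And>j k b. j \<in> J \<Longrightarrow> k \<in> J \<Longrightarrow> b \<in> U j \<inter> U k \<Longrightarrow> \<Omega>2 j k b = \<mu> j b ** \<Omega>1 j k b ** matrix_inv (\<mu> k b)"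
    using assms(1) unfolding cohomologous_def by blast
  obtain \<nu> where c': "\<Omega>3 \<in> cocycles J U" and \<nu>: "\<And>j. j \<in> J \<Longrightarrow> continuous_on (U j) (\<nu> j)"
    "\<And>j b. j \<in> J \<Longrightarrow> b \<in> U j \<Longrightarrow> orthogonal_matrix (\<nu> j b)"
    and eq': "\<And>j k b. j \<in> J \<Longrightarrow> k \<in> J \<Longrightarrow> b \<in> U j \<inter> U k \<Longrightarrow> \<Omega>3 j k b = \<nu> j b ** \<Omega>2 j k b ** matrix_inv (\<nu> k b)"
    using assms(2) unfolding cohomologous_def by blast
  let ?\<mu> = "\<lambda>j b. \<nu> j b ** \<mu> j b"
  have "continuous_on (U j) (?\<mu> j)" if "j \<in> J" for j
    by (intro continuous_on_matrix_mult \<mu>(1) \<nu>(1) that)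
  moreover have "orthogonal_matrix (?\<mu> j b)" if "j \<in> J" "b \<in> U j" for j b
    using \<mu>(2)[OF that] \<nu>(2)[OF that] by (intro orthogonal_matrix_mul)
  moreover have "\<Omega>3 j k b = ?\<mu> j b ** \<Omega>1 j k b ** matrix_inv (?\<mu> k b)"
    if jk: "j \<in> J" "k \<in> J" and b: "b \<in> U j \<inter> U k" for j k b
  proof -
    have o: "orthogonal_matrix (\<mu> k b)" "orthogonal_matrix (\<nu> k b)" using \<mu>(2) \<nu>(2) jk b by auto
    show ?thesis
      unfolding eq'[OF jk b] eq[OF jk b] matrix_inv_orthogonal(3)[OF o(1)] matrix_inv_orthogonal(3)[OF o(2)]
        matrix_inv_orthogonal(3)[OF orthogonal_matrix_mul[OF o(2) o(1)]] matrix_transpose_mul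
      by (simp only: matrix_mul_assoc)
  qed
  ultimately show ?thesis by (intro cohomologousI[where \<mu> = ?\<mu>] c c')
qed

lemma coh_class_eq: "(\<Omega>, \<Omega>') \<in> cohomologous J U \<Longrightarrow> coh_class J U \<Omega> = coh_class J U \<Omega>'"
  unfolding coh_class_def using cohomologous_sym cohomologous_trans by blast

section \<open>The cocycle of an approximate circle bundle\<close>

text \<open>With t = 2 sin s, the hypothesis bounds 2 s by sqrt 2 / 36. Halving the angle shows sin
  s < s for s > 0, which yields the strict inequality on which the strict Frobenius bound 1/2
  depends.\<close>

lemma enn2real_tau:
  assumes nn: "0 \<le> \<beta>" "0 \<le> \<epsilon>" "0 < r" and tau: "tau r \<beta> \<epsilon> J U \<le> 2" "tau_tilde r \<beta> \<epsilon> J U \<le> sqrt 2 / 36"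
  defines "t \<equiv> enn2real (tau r \<beta> \<epsilon> J U)"
  shows "0 \<le> t" and "t < sqrt 2 / 36"
    and "\<And>j b b'. j \<in> J \<Longrightarrow> b \<in> U j \<Longrightarrow> b' \<in> U j \<Longrightarrow> dist b b' + 10 * \<epsilon> + 9 * \<beta> \<le> r * t"
proof -
  show t0: "0 \<le> t" by (simp add: t_def)
  have "tau r \<beta> \<epsilon> J U < top" using tau(1) by (rule le_less_trans) simp
  then have te: "tau r \<beta> \<epsilon> J U = ennreal t" by (simp add: t_def)
  then have t2: "t \<le> 2" using tau(1) t0 by (simp add: ennreal_le_iff flip: ennreal_numeral)
  define s where "s = arcsin (t / 2)"
  have "sin s = t / 2" unfolding s_def using t0 t2 by (intro sin_arcsin) auto
  moreover have "0 \<le> s" using arcsin_le_arcsin[of 0 "t / 2"] t0 t2 by (simp add: s_def)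
  moreover have "2 * s \<le> sqrt 2 / 36" using tau(2) by (simp add: s_def tau_tilde_def t_def)
  ultimately have s: "t = 2 * sin s" "2 * s \<le> sqrt 2 / 36" "0 \<le> s" by simp_all
  show "t < sqrt 2 / 36"
  proof (cases "s = 0")
    case True then show ?thesis using s by simp
  next
    case False
    have "sqrt 2 \<le> 2" using real_sqrt_le_mono[of 2 4] by simp
    then have s1: "s / 2 < pi / 2" "0 < s / 2" using s(2,3) False pi_gt3 by auto
    then have "cos (s / 2) < 1" using cos_monotone_0_pi[of 0 "s / 2"] pi_gt_zero by simp
    moreover have "0 < cos (s / 2)" using s1 by (intro cos_gt_zero_pi) auto
    then have "sin (s / 2) * cos (s / 2) \<le> s / 2 * cos (s / 2)"
      using s1 by (intro mult_right_mono sin_x_le_x) auto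
    ultimately have "sin (s / 2) * cos (s / 2) < s / 2"
      using mult_strict_left_mono[of "cos (s / 2)" 1 "s / 2"] s1 by linarith
    moreover have "sin s = 2 * sin (s / 2) * cos (s / 2)" using sin_double[of "s / 2"] by simp
    ultimately show ?thesis using s by simp
  qed
  fix j b b' assume j: "j \<in> J" and b: "b \<in> U j" "b' \<in> U j"
  have "ennreal (dist b b') \<le> ediameter (U j)"
    unfolding ediameter_def using b by (intro SUP_upper2[of "(b, b')"]) auto
  also have "\<dots> \<le> (SUP j\<in>J. ediameter (U j))" using j by (rule SUP_upper)
  finally have "(ennreal (dist b b') + ennreal (10 * \<epsilon> + 9 * \<beta>)) / ennreal r \<le> ennreal t"
    unfolding te[symmetric] tau_def by (intro divide_right_mono_ennreal add_right_mono)
  moreover have "(ennreal (dist b b') + ennreal (10 * \<epsilon> + 9 * \<beta>)) / ennreal r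
      = ennreal ((dist b b' + (10 * \<epsilon> + 9 * \<beta>)) / r)"
    using nn by (simp add: ennreal_plus[symmetric] divide_ennreal del: ennreal_plus)
  ultimately have "(dist b b' + (10 * \<epsilon> + 9 * \<beta>)) / r \<le> t" using t0 by (simp add: ennreal_le_iff)
  then show "dist b b' + 10 * \<epsilon> + 9 * \<beta> \<le> r * t" using nn(3) by (simp add: pos_divide_le_eq mult.commute)
qed

locale circle_bundle =
  fixes \<pi> :: "'x::metric_space \<Rightarrow> 'b::metric_space" and J :: "nat set" and U :: "nat \<Rightarrow> 'b set"
    and r \<beta> \<epsilon> t :: real
  assumes circ: "approx_circle_bundle r \<beta> \<epsilon> \<pi> J U"
    and t: "0 \<le> t" "t < sqrt 2 / 36"
    and diam: "\<And>j b b'. j \<in> J \<Longrightarrow> b \<in> U j \<Longrightarrow> b' \<in> U j \<Longrightarrow> dist b b' + 10 * \<epsilon> + 9 * \<beta> \<le> r * t"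
begin

abbreviation "triv \<equiv> trivializations r \<beta> \<epsilon> \<pi> J U"
abbreviation "coord \<equiv> circle_coords"
abbreviation "wits \<Phi> \<equiv> wit \<pi> J U (circle_coords \<Phi>)"

lemma nn: "0 \<le> \<beta>" "0 \<le> \<epsilon>" "0 < r"
proof -
  show b: "0 \<le> \<beta>" "0 \<le> \<epsilon>" using circ by (auto simp: approx_circle_bundle_def)
  then have "0 \<le> 16 / pi * (\<epsilon> + \<beta>)" by simp
  then show "0 < r" using circ unfolding approx_circle_bundle_def by linarith
qed

lemma t_small: "t < 1/20" "t * t < 2 / 1296"
proof -
  have "sqrt 2 < 3/2" by (rule real_less_lsqrt) (simp_all add: power2_eq_square)
  then show "t < 1/20" using t by simp
  have "t * t < (sqrt 2 / 36) * (sqrt 2 / 36)" using t by (intro mult_strict_mono) auto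
  then show "t * t < 2 / 1296" by simp
qed

lemma ball_exists:
  assumes "j \<in> J" "k \<in> J" "l \<in> J" "U j \<inter> U k \<inter> U l \<noteq> {}"
  shows "\<exists>x. cball (\<pi> x) \<beta> \<subseteq> U j \<inter> U k \<inter> U l"
  using circ assms unfolding approx_circle_bundle_def by blast

lemma trivE:
  assumes "\<Phi> \<in> triv" "j \<in> J"
  obtains rj where "approx_local_trivialization r \<beta> \<epsilon> \<pi> (U j) rj (\<Phi> j)"
  using assms unfolding trivializations_def by blast

text \<open>With this diameter bound as \<open>D\<close>, the quantity
  \<open>(D + 10 * \<epsilon>) / r\<close> controlling near isometries becomes
  \<open>t\<close>.\<close>

lemma diam': "j \<in> J \<Longrightarrow> \<forall>b\<in>U j. \<forall>b'\<in>U j. dist b b' \<le> r * t - 10 * \<epsilon>"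
  using diam nn by fastforce

lemma coord_norm: "\<Phi> \<in> triv \<Longrightarrow> j \<in> J \<Longrightarrow> x \<in> \<pi> -` U j \<Longrightarrow> norm (coord \<Phi> j x) = 1"
  using approx_local_trivializationD(1)[OF _ diam'] by (auto elim!: trivE simp: circle_coords_def)

text \<open>Density over triple overlaps is what converts estimates at points of the fibres into
  estimates of matrices.\<close>

lemma coords_dense:
  assumes \<Phi>: "\<Phi> \<in> triv" and jkl: "j \<in> J" "k \<in> J" "l \<in> J" "U j \<inter> U k \<inter> U l \<noteq> {}" and z: "norm z = 1"
  shows "\<exists>y \<in> \<pi> -` (U j \<inter> U k \<inter> U l). norm (coord \<Phi> l y - z) \<le> 1/20"
proof -
  obtain rl where T: "approx_local_trivialization r \<beta> \<epsilon> \<pi> (U l) rl (\<Phi> l)" using trivE[OF \<Phi> jkl(3)] .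
  obtain x where x: "cball (\<pi> x) \<beta> \<subseteq> U j \<inter> U k \<inter> U l" using ball_exists[OF jkl] ..
  obtain y where y: "y \<in> \<pi> -` (U j \<inter> U k \<inter> U l)" "rl * circle_dist (snd (\<Phi> l y)) z \<le> \<epsilon>"
    using approx_local_trivializationD(4)[OF T diam'[OF jkl(3)] x _ z] by blast
  have "r \<le> rl" using T by (simp add: approx_local_trivialization_def)
  then have "r * circle_dist (snd (\<Phi> l y)) z \<le> \<epsilon>"
    using y(2) mult_right_mono[OF _ circle_dist_nonneg] order_trans by blast
  \<comment> \<open>The diameter estimate for a point and itself reads 10 \<epsilon> + 9 \<beta>
    \<le> r t.\<close>
  also have "\<epsilon> \<le> r * t" using diam[of l "\<pi> y" "\<pi> y"] y(1) jkl(3) nn by simp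
  also have "\<dots> \<le> r * (1/20)" using t_small nn by (intro mult_left_mono) auto
  finally have "circle_dist (snd (\<Phi> l y)) z \<le> 1/20" using nn by simp
  moreover have "norm (snd (\<Phi> l y)) = 1"
    using approx_local_trivializationD(1)[OF T diam'[OF jkl(3)]] y(1) by simp
  ultimately have "norm (snd (\<Phi> l y) - z) \<le> 1/20" using norm_diff_le_circle_dist[OF _ z] by fastforce
  then show ?thesis using y(1) by (auto simp: circle_coords_def)
qed

lemma coords_near_isometric:
  assumes \<Phi>: "\<Phi> \<in> triv" "\<Phi>' \<in> triv" and jk: "j \<in> J" "k \<in> J" "U j \<inter> U k \<noteq> {}"
  shows "isometric_within (3 * t) (\<pi> -` (U j \<inter> U k)) (coord \<Phi> j) (coord \<Phi>' k)"
proof -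
  obtain r1 where T1: "approx_local_trivialization r \<beta> \<epsilon> \<pi> (U j) r1 (\<Phi> j)" using trivE[OF \<Phi>(1) jk(1)] .
  obtain r2 where T2: "approx_local_trivialization r \<beta> \<epsilon> \<pi> (U k) r2 (\<Phi>' k)" using trivE[OF \<Phi>(2) jk(2)] .
  obtain x where "cball (\<pi> x) \<beta> \<subseteq> U j \<inter> U k" using ball_exists[OF jk(1,2,2)] jk(3) by auto
  moreover have "(r * t - 10 * \<epsilon> + 10 * \<epsilon>) / r \<le> t" using nn by simp
  ultimately show ?thesis unfolding circle_coords_def
    using t_small(1) by (intro trivializations_near_isometric[OF T1 T2 diam'[OF jk(1)] diam'[OF jk(2)]]) auto
qed

lemma fibre_nonempty: "j \<in> J \<Longrightarrow> k \<in> J \<Longrightarrow> U j \<inter> U k \<noteq> {} \<Longrightarrow> \<pi> -` (U j \<inter> U k) \<noteq> {}"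
proof -
  assume jk: "j \<in> J" "k \<in> J" "U j \<inter> U k \<noteq> {}"
  obtain x where "cball (\<pi> x) \<beta> \<subseteq> U j \<inter> U k" using ball_exists[OF jk(1,2,2)] jk(3) by auto
  moreover have "\<pi> x \<in> cball (\<pi> x) \<beta>" using nn(1) by simp
  ultimately show ?thesis by blast
qed

lemma wit_nonempty:
  assumes "\<Phi> \<in> triv" shows "wits \<Phi> \<noteq> {}"
proof -
  have "\<exists>M. j \<in> J \<longrightarrow> k \<in> J \<longrightarrow> U j \<inter> U k \<noteq> {} \<longrightarrow>
      M \<in> wit_pair (\<pi> -` (U j \<inter> U k)) (coord \<Phi> j) (coord \<Phi> k)" for j k
  proof (cases "j \<in> J \<and> k \<in> J \<and> U j \<inter> U k \<noteq> {}")
    case True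
    then have "wit_pair (\<pi> -` (U j \<inter> U k)) (coord \<Phi> j) (coord \<Phi> k) \<noteq> {}"
      using coord_norm[OF assms] fibre_nonempty[of j k] by (intro wit_pair_nonempty) auto
    then show ?thesis by blast
  qed blast
  then obtain W where "\<And>j k. j \<in> J \<longrightarrow> k \<in> J \<longrightarrow> U j \<inter> U k \<noteq> {} \<longrightarrow>
      W j k \<in> wit_pair (\<pi> -` (U j \<inter> U k)) (coord \<Phi> j) (coord \<Phi> k)"
    by metis
  then have "W \<in> wits \<Phi>" unfolding wit_def by blast
  then show ?thesis by blast
qed

lemma wit_close:
  assumes \<Phi>: "\<Phi> \<in> triv" and W: "W \<in> wits \<Phi>" and jk: "j \<in> J" "k \<in> J"
    and x: "\<pi> x \<in> U j" "\<pi> x \<in> U k"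
  shows "norm (c2v (coord \<Phi> j x) - W j k *v c2v (coord \<Phi> k x)) \<le> 3 * t"
proof -
  have ne: "U j \<inter> U k \<noteq> {}" using x by blast
  have "W j k \<in> wit_pair (\<pi> -` (U j \<inter> U k)) (coord \<Phi> j) (coord \<Phi> k)"
    using W jk ne by (simp add: wit_def)
  then show ?thesis
    using coord_norm[OF \<Phi>] jk x t coords_near_isometric[OF \<Phi> \<Phi> jk ne] by (intro wit_pair_close[of "W j k" "\<pi> -` (U j \<inter> U k)"]) auto
qed

lemma wit_orthogonal:
  assumes "W \<in> wits \<Phi>" "j \<in> J" "k \<in> J" "b \<in> U j" "b \<in> U k"
  shows "orthogonal_matrix (W j k)"
  using assms orthogonal_wit_pair unfolding wit_def by blast

lemma fibre_matrices_close:
  assumes \<Phi>: "\<Phi> \<in> triv" and jkl: "j \<in> J" "k \<in> J" "l \<in> J" "U j \<inter> U k \<inter> U l \<noteq> {}"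
    and AB: "orthogonal_matrix A" "orthogonal_matrix B" and c: "c < 1"
    and close: "\<And>x. \<pi> x \<in> U j \<Longrightarrow> \<pi> x \<in> U k \<Longrightarrow> \<pi> x \<in> U l \<Longrightarrow>
      norm (A *v c2v (coord \<Phi> l x) - B *v c2v (coord \<Phi> l x)) \<le> c"
  shows "norm ((A - B) *v w) \<le> c * norm w" and "norm (A - B) \<le> sqrt 2 * c"
proof -
  let ?Z = "coord \<Phi> l ` (\<pi> -` (U j \<inter> U k \<inter> U l))"
  have Z: "norm z = 1" "norm (A *v c2v z - B *v c2v z) \<le> c" if "z \<in> ?Z" for z
    using that coord_norm[OF \<Phi> jkl(3)] close by auto
  have dense: "\<exists>w\<in>?Z. norm (w - z) \<le> 1/20" if "norm z = 1" for z
    using coords_dense[OF \<Phi> jkl that] by blast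
  have lt: "c + 2 * (1/20) < 2" using c by simp
  show "norm ((A - B) *v w) \<le> c * norm w" "norm (A - B) \<le> sqrt 2 * c"
    using orthogonal_matrices_close[OF AB Z dense lt] by blast+
qed

lemma orthogonal_step:
  assumes "orthogonal_matrix (A :: real^2^2)" "norm (x - B *v y) \<le> e"
  shows "norm (A *v x - (A ** B) *v y) \<le> e"
  using assms(2) norm_orthogonal_matrix_mult[OF assms(1), of "x - B *v y"]
  by (simp add: matrix_vector_mult_diff_distrib matrix_vector_mul_assoc)

text \<open>Three replacements lead from \<open>W j k ** W k l\<close> to \<open>W j l\<close> on
  the coordinate of \<open>l\<close>, through the coordinates of \<open>k\<close> and
  \<open>j\<close>. Each costs 3 t, since orthogonal matrices do not enlarge errors.\<close>

lemma wit_cocycle_close: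
  assumes \<Phi>: "\<Phi> \<in> triv" and W: "W \<in> wits \<Phi>"
    and jkl: "j \<in> J" "k \<in> J" "l \<in> J" and b: "b \<in> U j" "b \<in> U k" "b \<in> U l"
  shows "norm ((W j k ** W k l - W j l) *v w) \<le> 9 * t * norm w"
    and "norm (W j k ** W k l - W j l) \<le> sqrt 2 * (9 * t)"
proof -
  have ojk: "orthogonal_matrix (W j k)" and okl: "orthogonal_matrix (W k l)" and ojl: "orthogonal_matrix (W j l)"
    using wit_orthogonal[OF W] jkl b by blast+
  have ne: "U j \<inter> U k \<inter> U l \<noteq> {}" using b by blast
  have lt: "9 * t < 1" using t_small(1) by simp
  have close: "norm ((W j k ** W k l) *v c2v (coord \<Phi> l x) - W j l *v c2v (coord \<Phi> l x)) \<le> 9 * t"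
    if x: "\<pi> x \<in> U j" "\<pi> x \<in> U k" "\<pi> x \<in> U l" for x
    using orthogonal_step[OF ojk wit_close[OF \<Phi> W jkl(2,3) x(2,3)]]
      wit_close[OF \<Phi> W jkl(1,2) x(1,2)] wit_close[OF \<Phi> W jkl(1,3) x(1,3)] by norm
  show "norm ((W j k ** W k l - W j l) *v w) \<le> 9 * t * norm w"
    "norm (W j k ** W k l - W j l) \<le> sqrt 2 * (9 * t)"
    using fibre_matrices_close[OF \<Phi> jkl ne orthogonal_matrix_mul[OF ojk okl] ojl lt close] by blast+
qed

lemma wit_approx_cocycle:
  assumes \<Phi>: "\<Phi> \<in> triv" and W: "W \<in> wits \<Phi>"
  shows "\<exists>\<eta><1/2. (\<lambda>j k b. W j k) \<in> approx_lc_cocycles \<eta> J U"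
proof -
  define c where "c = sqrt 2 * (9 * t)"
  have "c < sqrt 2 * (9 * (sqrt 2 / 36))" unfolding c_def using t by (intro mult_strict_left_mono) auto
  then have c: "0 \<le> c" "c < 1/2" using t by (simp_all add: c_def)
  \<comment> \<open>The supremum must be strictly below \<eta>, and \<eta> strictly below 1/2; the
    midpoint serves both.\<close>
  define \<eta> where "\<eta> = (c + 1/2) / 2"
  have \<eta>: "c < \<eta>" "\<eta> < 1/2" using c by (simp_all add: \<eta>_def)
  have "(SUP (j, k, l) \<in> J \<times> J \<times> J. SUP b \<in> U j \<inter> U k \<inter> U l.
      ennreal (norm (W j k ** W k l - W j l))) \<le> ennreal c"
    using wit_cocycle_close(2)[OF \<Phi> W] by (auto intro!: SUP_least ennreal_leI simp: c_def)
  also have "\<dots> < ennreal \<eta>" using \<eta> c by (simp add: ennreal_lessI)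
  finally have "(\<lambda>j k b. W j k) \<in> approx_cocycles \<eta> J U"
    using wit_orthogonal[OF W] by (auto simp: approx_cocycles_def cochains_def)
  then have "(\<lambda>j k b. W j k) \<in> approx_lc_cocycles \<eta> J U"
    by (auto simp: approx_lc_cocycles_def locally_constant_on_def)
  then show ?thesis using \<eta>(2) by blast
qed

lemma wit_constant_cocycle:
  assumes \<Phi>: "\<Phi> \<in> triv" and W: "W \<in> wits \<Phi>" and pu: "partition_of_unity J U \<rho>"
  shows "constant_cocycle J (\<lambda>b. {j\<in>J. b \<in> U j}) \<rho> W (9 * t)"
proof
  fix b
  have "finite {j\<in>J. \<exists>c\<in>V. \<rho> j c \<noteq> 0} \<Longrightarrow> b \<in> V \<Longrightarrow> finite {j\<in>J. \<rho> j b \<noteq> 0}" for V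
    by (erule rev_finite_subset) blast
  then show "finite {j\<in>J. \<rho> j b \<noteq> 0}" using pu unfolding partition_of_unity_def by blast
  show "0 \<le> \<rho> j b" if "j \<in> J" for j using pu that unfolding partition_of_unity_def by blast
  show "(\<Sum>j\<in>{j\<in>J. \<rho> j b \<noteq> 0}. \<rho> j b) = 1" using pu unfolding partition_of_unity_def by blast
  show "{j\<in>J. \<rho> j b \<noteq> 0} \<subseteq> {j\<in>J. b \<in> U j}"
  proof
    fix j assume j: "j \<in> {j\<in>J. \<rho> j b \<noteq> 0}"
    then have "closure {b. \<rho> j b \<noteq> 0} \<subseteq> U j" using pu unfolding partition_of_unity_def by blast
    moreover have "b \<in> closure {b. \<rho> j b \<noteq> 0}" using j by (intro subsetD[OF closure_subset]) simp
    ultimately show "j \<in> {j\<in>J. b \<in> U j}" using j by blast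
  qed
  show "orthogonal_matrix (W i j)" if "i \<in> {j\<in>J. b \<in> U j}" "j \<in> {j\<in>J. b \<in> U j}" for i j
    using wit_orthogonal[OF W] that by blast
  show "norm ((W i j ** W j k - W i k) *v w) \<le> 9 * t * norm w"
    if "i \<in> {j\<in>J. b \<in> U j}" "j \<in> {j\<in>J. b \<in> U j}" "k \<in> {j\<in>J. b \<in> U j}" for i j k w
    using wit_cocycle_close(1)[OF \<Phi> W] that by blast
  show "0 \<le> 9 * t" using t by simp
  show "(9 * t)\<^sup>2 < 1/2" using t_small(2) by (simp add: power2_eq_square)
next
  show "continuous_on UNIV (\<rho> j)" if "j \<in> J" for j
    using pu that unfolding partition_of_unity_def by blast
qed

text \<open>The intertwining error 12 t consists of four errors of 3 t: one from each witness, and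
  one from comparing the two families in each of the charts \<open>i\<close> and
  \<open>j\<close>.\<close>

lemma wit_cohomologous:
  assumes \<Phi>: "\<Phi> \<in> triv" and W: "W \<in> wits \<Phi>"
    and \<Phi>': "\<Phi>' \<in> triv" and W': "W' \<in> wits \<Phi>'" and pu: "partition_of_unity J U \<rho>"
  shows "(Pi_Z J \<rho> (\<lambda>j k b. W j k), Pi_Z J \<rho> (\<lambda>j k b. W' j k)) \<in> cohomologous J U"
proof -
  let ?f = "coord \<Phi>" and ?f' = "coord \<Phi>'"
  have "\<exists>M. orthogonal_matrix M \<and> (j \<in> J \<longrightarrow> (\<forall>x \<in> \<pi> -` U j. norm (c2v (?f' j x) - M *v c2v (?f j x)) \<le> 3 * t))" for j
  proof (cases "j \<in> J \<and> U j \<noteq> {}")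
    case True
    then have iso: "isometric_within (3 * t) (\<pi> -` U j) (?f' j) (?f j)"
      using coords_near_isometric[OF \<Phi>' \<Phi>, of j j] by simp
    have "\<exists>M. orthogonal_matrix M \<and> (\<forall>x \<in> \<pi> -` U j. norm (c2v (?f' j x) - M *v c2v (?f j x)) \<le> 3 * t)"
      by (rule orthogonal_matrix_close_exists[OF _ _ iso]) (use coord_norm[OF \<Phi>] coord_norm[OF \<Phi>'] True in auto)
    then show ?thesis by blast
  next
    case False
    \<comment> \<open>The matrices must be orthogonal for all indices, so the identity serves as
      default outside \<open>J\<close> and for empty charts.\<close>
    then show ?thesis using orthogonal_rot[of 0] by auto
  qed
  then obtain \<mu> where mu: "\<And>j. orthogonal_matrix (\<mu> j)"
    and mu_close: "\<And>j x. j \<in> J \<Longrightarrow> \<pi> x \<in> U j \<Longrightarrow> norm (c2v (?f' j x) - \<mu> j *v c2v (?f j x)) \<le> 3 * t"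
    by (metis vimageI)
  have close: "norm ((\<mu> i ** W i j - W' i j ** \<mu> j) *v w) \<le> 12 * t * norm w"
    if ij: "i \<in> J" "j \<in> J" and b: "b \<in> U i" "b \<in> U j" for i j b w
  proof -
    have o: "orthogonal_matrix (W i j)" and o': "orthogonal_matrix (W' i j)"
      using wit_orthogonal[OF W] wit_orthogonal[OF W'] ij b by blast+
    have ne: "U i \<inter> U j \<inter> U j \<noteq> {}" using b by blast
    have lt: "12 * t < 1" using t_small(1) by simp
    have close: "norm ((\<mu> i ** W i j) *v c2v (?f j x) - (W' i j ** \<mu> j) *v c2v (?f j x)) \<le> 12 * t"
      if x: "\<pi> x \<in> U i" "\<pi> x \<in> U j" for x
      using orthogonal_step[OF mu[of i] wit_close[OF \<Phi> W ij x]] orthogonal_step[OF o' mu_close[OF ij(2) x(2)]]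
        mu_close[OF ij(1) x(1)] wit_close[OF \<Phi>' W' ij x] by norm
    show ?thesis
      by (rule fibre_matrices_close(1)[OF \<Phi> ij(1,2,2) ne orthogonal_matrix_mul[OF mu o]
            orthogonal_matrix_mul[OF o' mu] lt close])
  qed
  note c = wit_constant_cocycle[OF \<Phi> W pu] and c' = wit_constant_cocycle[OF \<Phi>' W' pu]
  have "cocycle_pair_at J {j\<in>J. b \<in> U j} \<rho> (\<lambda>j k _. W j k) (\<lambda>j k _. W' j k) b (9 * t) \<mu> (12 * t)" for b
  proof (intro cocycle_pair_at.intro cocycle_pair_at_axioms.intro)
    show "cocycle_at J {j\<in>J. b \<in> U j} \<rho> (\<lambda>j k _. W j k) b (9 * t)"
      "cocycle_at J {j\<in>J. b \<in> U j} \<rho> (\<lambda>j k _. W' j k) b (9 * t)"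
      using constant_cocycle.at[OF c] constant_cocycle.at[OF c'] by blast+
    show "orthogonal_matrix (\<mu> i)" for i by (rule mu)
    show "norm ((\<mu> i ** W i j - W' i j ** \<mu> j) *v w) \<le> 12 * t * norm w"
      if "i \<in> {j\<in>J. b \<in> U j}" "j \<in> {j\<in>J. b \<in> U j}" for i j w using close that by blast
    show "0 \<le> 12 * t" using t by simp
    \<comment> \<open>The left side is 531 times t squared, and t squared is below 2/1296.\<close>
    show "3 * (9 * t)\<^sup>2 + 2 * (12 * t)\<^sup>2 < 1" using t_small(2) by (simp add: power2_eq_square)
  qed
  moreover have "open (U j)" if "j \<in> J" for j
    using circ that unfolding approx_circle_bundle_def good_open_cover_def by blast
  ultimately show ?thesis by (intro Pi_Z_cohomologous[OF _ pu c c']) auto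
qed

text \<open>Provides a reference family, so that the common class in \<open>H1\<close> is the class
  of an actual cocycle.\<close>

lemma triv_nonempty: "triv \<noteq> {}"
proof -
  have "\<forall>j\<in>J. \<exists>\<phi> rj. approx_local_trivialization r \<beta> \<epsilon> \<pi> (U j) rj \<phi>"
    using circ unfolding approx_circle_bundle_def by blast
  then obtain \<Phi> where "\<forall>j\<in>J. \<exists>rj. approx_local_trivialization r \<beta> \<epsilon> \<pi> (U j) rj (\<Phi> j)"
    by (rule bchoice[THEN exE])
  then have "\<Phi> \<in> triv" unfolding trivializations_def by blast
  then show ?thesis by blast
qed

end

theorem theorem3p42:
  fixes \<pi> :: "'x::metric_space \<Rightarrow> 'b::metric_space"
    and J :: "nat set" and U :: "nat \<Rightarrow> 'b set" and \<rho> :: "nat \<Rightarrow> 'b \<Rightarrow> real"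
    and r \<beta> \<epsilon> :: real
  assumes "0 \<le> r" and "0 \<le> \<beta>" and "0 \<le> \<epsilon>"
    and "approx_circle_bundle r \<beta> \<epsilon> \<pi> J U"
    and "locally_finite_family J U"
    and "tau r \<beta> \<epsilon> J U \<le> 2"
    and "tau_tilde r \<beta> \<epsilon> J U \<le> sqrt 2 / 36"
    and "partition_of_unity J U \<rho>"
  shows "(\<forall>\<Phi> \<in> trivializations r \<beta> \<epsilon> \<pi> J U.
            wit \<pi> J U (circle_coords \<Phi>) \<noteq> {} \<and>
            (\<forall>W \<in> wit \<pi> J U (circle_coords \<Phi>).
               (\<exists>\<eta><1/2. (\<lambda>j k b. W j k) \<in> approx_lc_cocycles \<eta> J U) \<and>
               Pi_Z J \<rho> (\<lambda>j k b. W j k) \<in> cocycles J U)) \<and>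
         (\<exists>c \<in> H1 J U.
            \<forall>\<Phi> \<in> trivializations r \<beta> \<epsilon> \<pi> J U. \<forall>W \<in> wit \<pi> J U (circle_coords \<Phi>).
              coh_class J U (Pi_Z J \<rho> (\<lambda>j k b. W j k)) = c)"
proof -
  have "0 \<le> 16 / pi * (\<epsilon> + \<beta>)" using assms(2,3) by simp
  then have r: "0 < r" using assms(4) unfolding approx_circle_bundle_def by linarith
  note tau = enn2real_tau[OF assms(2,3) r assms(6,7)]
  interpret circle_bundle \<pi> J U r \<beta> \<epsilon> "enn2real (tau r \<beta> \<epsilon> J U)"
    using assms(4) tau by unfold_locales
  have cocycle: "Pi_Z J \<rho> (\<lambda>j k b. W j k) \<in> cocycles J U"
    if "\<Phi> \<in> triv" "W \<in> wit \<pi> J U (circle_coords \<Phi>)" for \<Phi> W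
    \<comment> \<open>Comparing a witness with itself suffices, because \<open>cohomologous\<close>
      relates only cocycles.\<close>
    using wit_cohomologous[OF that that assms(8)] unfolding cohomologous_def by blast
  obtain \<Phi>0 where \<Phi>0: "\<Phi>0 \<in> triv" using triv_nonempty by blast
  obtain W0 where W0: "W0 \<in> wit \<pi> J U (circle_coords \<Phi>0)" using wit_nonempty[OF \<Phi>0] by blast
  let ?c = "coh_class J U (Pi_Z J \<rho> (\<lambda>j k b. W0 j k))"
  have c: "?c \<in> H1 J U" unfolding H1_def coh_class_def by (rule quotientI[OF cocycle[OF \<Phi>0 W0]])
  have "coh_class J U (Pi_Z J \<rho> (\<lambda>j k b. W j k)) = ?c"
    if "\<Phi> \<in> triv" "W \<in> wit \<pi> J U (circle_coords \<Phi>)" for \<Phi> W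
    by (rule coh_class_eq[OF wit_cohomologous[OF that \<Phi>0 W0 assms(8)]])
  then have "\<exists>c \<in> H1 J U. \<forall>\<Phi> \<in> triv. \<forall>W \<in> wit \<pi> J U (circle_coords \<Phi>).
      coh_class J U (Pi_Z J \<rho> (\<lambda>j k b. W j k)) = c"
    by (intro bexI[OF _ c] ballI)
  then show ?thesis
    by (intro conjI ballI wit_nonempty wit_approx_cocycle cocycle)
qed

end
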